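(* Let $T_1,\dots,T_N\in\mathfrak G\cup\mathfrak B$ be a finite collection of good and bad maps with $\Sigma_G\neq\emptyset$ and $\Sigma_B\neq\emptyset$, let $\Sigma=\{1,\dots,N\}$, and let $\mathbf p=(p_j)_{j\in\Sigma}$ be a positive probability vector. Let $F$ be the associated random map. Then: (1) There exists a unique (up to scalar multiplication) stationary $\sigma$-finite measure $\mu_{\mathbf p}$ for $F$ that is absolutely continuous with respect to the one-dimensional Lebesgue measure $\lambda$ on $[0,1]$. Moreover, this measure is ergodic. (2) The density $\frac{d\mu_{\mathbf p}}{d\lambda}$ is bounded away from zero, is locally Lipschitz on $(0,c)$ and on $(c,1)$, and is not in $L^q$ (with respect to $\lambda$) for any $q>1$.
   Context: Fix $c\in(0,1)$. $D$ denotes the derivative (one-sided at $0$ and $1$). The Schwarzian derivative is $\mathbf ST=\frac{D^3T}{DT}-\frac32\big(\frac{D^2T}{DT}\big)^2$; $T$ has non-positive Schwarzian derivative on an interval if $DT\ne0$ and $\mathbf ST\le0$ there. The class $\mathfrak G$ of good maps consists of the maps $T_g:[0,1]\to[0,1]$ such that (G1) $T_g|_{(0,c)}$ and $T_g|_{(c,1)}$ are $C^3$ diffeomorphisms onto $(0,1)$ and $T_g(\{0,c,1\})\subseteq\{0,1\}$; (G2) $T_g$ has non-positive Schwarzian derivative on $[0,c)$ and $(c,1]$; (G3) there are associated constants $r_g\ge1$, $0<K_g<1$, $M_g>r_g$ with $K_g|x-c|^{r_g-1}\le|DT_g(x)|\le M_g|x-c|^{r_g-1}$ for all $x\in[0,1]\setminus\{c\}$;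 (G4) $|DT_g(0)|,|DT_g(1)|>1$. The class $\mathfrak B$ of bad maps consists of the maps $T_b:[0,1]\to[0,1]$ such that (B1) $T_b|_{(0,c)}$ and $T_b|_{(c,1)}$ are $C^3$ diffeomorphisms, each onto $(0,c)$ or $(c,1)$, $T_b(\{0,1\})\subseteq\{0,1\}$ and $T_b(c)=c$; (B2) $T_b$ has non-positive Schwarzian derivative on $[0,c)$ and $(c,1]$; (B3) there are associated constants $\ell_b>1$, $0<K_b<1$, $M_b>\ell_b$ with $K_b|x-c|^{\ell_b-1}\le|DT_b(x)|\le M_b|x-c|^{\ell_b-1}$ for all $x\in[0,1]\setminus\{c\}$; (B4) $|DT_b(0)|,|DT_b(1)|>1$. For $T_1,\dots,T_N\in\mathfrak G\cup\mathfrak B$ put $\Sigma=\{1,\dots,N\}$, $\Sigma_G=\{j:T_j\in\mathfrak G\}$, $\Sigma_B=\{j:T_j\in\mathfrak B\}$. The random map (skew product) is $F:\Sigma^{\mathbb N}\times[0,1]\to\Sigma^{\mathbb N}\times[0,1]$, $F(\omega,x)=(\sigma\omega,T_{\omega_1}(x))$, with $\sigma$ the left shift. $\mathbb P$ is the $\mathbf p$-Bernoulli measure on $\Sigma^{\mathbb N}$. A Borel measure $\mu$ on $[0,1]$ is stationary for $F$ if $\sum_{j\in\Sigma}p_j\mu(T_j^{-1}A)=\mu(A)$ for all Borel $A\subseteq[0,1]$ (equivalently, $\mathbb P\times\mu$ is $F$-invariant); it is ergodic for $F$ if $\mathbb P\times\mu$ is ergodic for $F$. A probability vector is positive if all its entries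 are positive. *)

theory Defs
  imports "HOL-Probability.Probability"
begin

text \<open>Interval maps are total functions on the reals of which only the values on \<open>[0,1]\<close> matter.\<close>

section \<open>Derivatives\<close>

text \<open>On an open set this is the ordinary derivative, at an endpoint belonging to an interval \<open>S\<close>
  it is the one-sided one. Values are meaningful only where differentiability is also required.\<close>

definition deriv_within :: "real set \<Rightarrow> (real \<Rightarrow> real) \<Rightarrow> real \<Rightarrow> real" where
  "deriv_within S f = (\<lambda>x. vector_derivative f (at x within S))"

definition times_differentiable_on :: "nat \<Rightarrow> (real \<Rightarrow> real) \<Rightarrow> real set \<Rightarrow> bool" where
  "times_differentiable_on k f S \<longleftrightarrow> (\<forall>j<k. (deriv_within S ^^ j) f differentiable_on S)"

definition C_on :: "nat \<Rightarrow> (real \<Rightarrow> real) \<Rightarrow> real set \<Rightarrow> bool" where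
  "C_on k f S \<longleftrightarrow> times_differentiable_on k f S \<and> continuous_on S ((deriv_within S ^^ k) f)"

definition C_diffeo :: "nat \<Rightarrow> (real \<Rightarrow> real) \<Rightarrow> real set \<Rightarrow> real set \<Rightarrow> bool" where
  "C_diffeo k f S R \<longleftrightarrow> bij_betw f S R \<and> C_on k f S \<and> C_on k (inv_into S f) R"

definition schwarzian :: "real set \<Rightarrow> (real \<Rightarrow> real) \<Rightarrow> real \<Rightarrow> real" where
  "schwarzian S f x =
     (deriv_within S ^^ 3) f x / deriv_within S f x
     - 3 / 2 * ((deriv_within S ^^ 2) f x / deriv_within S f x)\<^sup>2"

definition nonpos_schwarzian_on :: "(real \<Rightarrow> real) \<Rightarrow> real set \<Rightarrow> bool" where
  "nonpos_schwarzian_on f S \<longleftrightarrow>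
     times_differentiable_on 3 f S \<and> (\<forall>x\<in>S. deriv_within S f x \<noteq> 0 \<and> schwarzian S f x \<le> 0)"

definition locally_lipschitz_on :: "(real \<Rightarrow> real) \<Rightarrow> real set \<Rightarrow> bool" where
  "locally_lipschitz_on f S \<longleftrightarrow> (\<forall>x\<in>S. \<exists>u>0. \<exists>L. L-lipschitz_on (cball x u \<inter> S) f)"

section \<open>Good and bad maps\<close>

definition good_maps :: "real \<Rightarrow> (real \<Rightarrow> real) set" where
  "good_maps c = {T.
     T ` {0..1} \<subseteq> {0..1} \<and>
     C_diffeo 3 T {0<..<c} {0<..<1} \<and> C_diffeo 3 T {c<..<1} {0<..<1} \<and>
     T ` {0, c, 1} \<subseteq> {0, 1} \<and>
     nonpos_schwarzian_on T {0..<c} \<and> nonpos_schwarzian_on T {c<..1} \<and>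
     (\<exists>r K M. r \<ge> 1 \<and> 0 < K \<and> K < 1 \<and> M > r \<and>
        (\<forall>x\<in>{0..1} - {c}.
           K * \<bar>x - c\<bar> powr (r - 1) \<le> \<bar>deriv_within {0..1} T x\<bar> \<and>
           \<bar>deriv_within {0..1} T x\<bar> \<le> M * \<bar>x - c\<bar> powr (r - 1))) \<and>
     \<bar>deriv_within {0..1} T 0\<bar> > 1 \<and> \<bar>deriv_within {0..1} T 1\<bar> > 1}"

definition bad_maps :: "real \<Rightarrow> (real \<Rightarrow> real) set" where
  "bad_maps c = {T.
     T ` {0..1} \<subseteq> {0..1} \<and>
     (\<exists>J\<in>{{0<..<c}, {c<..<1}}. C_diffeo 3 T {0<..<c} J) \<and>
     (\<exists>J\<in>{{0<..<c}, {c<..<1}}. C_diffeo 3 T {c<..<1} J) \<and>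
     T ` {0, 1} \<subseteq> {0, 1} \<and> T c = c \<and>
     nonpos_schwarzian_on T {0..<c} \<and> nonpos_schwarzian_on T {c<..1} \<and>
     (\<exists>l K M. l > 1 \<and> 0 < K \<and> K < 1 \<and> M > l \<and>
        (\<forall>x\<in>{0..1} - {c}.
           K * \<bar>x - c\<bar> powr (l - 1) \<le> \<bar>deriv_within {0..1} T x\<bar> \<and>
           \<bar>deriv_within {0..1} T x\<bar> \<le> M * \<bar>x - c\<bar> powr (l - 1))) \<and>
     \<bar>deriv_within {0..1} T 0\<bar> > 1 \<and> \<bar>deriv_within {0..1} T 1\<bar> > 1}"

section \<open>The random map\<close>

abbreviation lebesgue01 :: "real measure" where
  "lebesgue01 \<equiv> restrict_space lborel {0..1}"

text \<open>Sequences are indexed from \<open>0\<close>, so \<open>\<omega> 0\<close> is the first symbol of \<open>\<omega>\<close>.\<close>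

definition bernoulli_measure :: "nat \<Rightarrow> (nat \<Rightarrow> real) \<Rightarrow> (nat \<Rightarrow> nat) measure" where
  "bernoulli_measure N p = (\<Pi>\<^sub>M i\<in>UNIV. point_measure {1..N} (\<lambda>j. ennreal (p j)))"

definition skew_product ::
  "(nat \<Rightarrow> real \<Rightarrow> real) \<Rightarrow> (nat \<Rightarrow> nat) \<times> real \<Rightarrow> (nat \<Rightarrow> nat) \<times> real" where
  "skew_product T = (\<lambda>(\<omega>, x). (\<lambda>n. \<omega> (Suc n), T (\<omega> 0) x))"

definition ergodic :: "'a measure \<Rightarrow> ('a \<Rightarrow> 'a) \<Rightarrow> bool" where
  "ergodic M F \<longleftrightarrow>
     (\<forall>A\<in>sets M. F -` A \<inter> space M = A \<longrightarrow> emeasure M A = 0 \<or> emeasure M (space M - A) = 0)"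

definition ergodic_for ::
  "nat \<Rightarrow> (nat \<Rightarrow> real) \<Rightarrow> (nat \<Rightarrow> real \<Rightarrow> real) \<Rightarrow> real measure \<Rightarrow> bool" where
  "ergodic_for N p T \<mu> \<longleftrightarrow> ergodic (bernoulli_measure N p \<Otimes>\<^sub>M \<mu>) (skew_product T)"

definition stationary ::
  "nat \<Rightarrow> (nat \<Rightarrow> real) \<Rightarrow> (nat \<Rightarrow> real \<Rightarrow> real) \<Rightarrow> real measure \<Rightarrow> bool" where
  "stationary N p T \<mu> \<longleftrightarrow>
     sets \<mu> = sets (restrict_space borel {0..1}) \<and>
     (\<forall>A\<in>sets \<mu>. (\<Sum>j\<in>{1..N}. ennreal (p j) * emeasure \<mu> (T j -` A \<inter> {0..1})) = emeasure \<mu> A)"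

text \<open>The zero measure is excluded: it is trivially stationary and absolutely continuous.\<close>

definition sigma_finite_acsm ::
  "nat \<Rightarrow> (nat \<Rightarrow> real) \<Rightarrow> (nat \<Rightarrow> real \<Rightarrow> real) \<Rightarrow> real measure \<Rightarrow> bool" where
  "sigma_finite_acsm N p T \<mu> \<longleftrightarrow>
     stationary N p T \<mu> \<and> sigma_finite_measure \<mu> \<and> absolutely_continuous lebesgue01 \<mu> \<and>
     emeasure \<mu> (space \<mu>) \<noteq> 0"

end

theory Submission
  imports Defs
begin

text \<open>Every branch of every map has an inverse \<open>\<psi>\<close> with nonnegative Schwarzian derivative, that is,
  \<open>|\<psi>'| powr (-1/2)\<close> is concave. Hence the transfer operator \<open>P\<close> preserves a cone of densities with
  universal distortion bounds on each of \<open>(0, c)\<close> and \<open>(c, 1)\<close>, and the inverse branches contract the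
  hyperbolic metric of these intervals, strictly for the good maps. Almost every orbit returns
  to a compact set \<open>K\<close> away from \<open>0\<close>, \<open>c\<close> and \<open>1\<close>: the endpoints repel, and close to \<open>c\<close> a good map is eventually
  chosen, which throws the point towards an endpoint. This recurrence makes \<open>\<Sum>k. P^k 1\<close> infinite everywhere
  and turns subinvariant densities into invariant ones. A pointwise cluster point of the normalised partial sums
  is the invariant density \<open>h\<close>, since \<open>P\<close> is a finite sum at each point; it inherits the Lipschitz and lower
  bounds from the cone. A forward invariant set of positive measure is full by a covering argument with small
  inverse images of compact cores, which gives uniqueness (compare \<open>h\<close> with \<open>min f (a h)\<close>) and, with a
  zero-one law for the symbols, ergodicity. Finally a bad map improves a bound \<open>h \<ge> C |x - c|^(-\<alpha>)\<close> to the exponent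
  \<open>1 - (1 - \<alpha>) / l\<close>, so \<open>h\<close> lies in no \<open>L^q\<close> with \<open>q > 1\<close>.\<close>

section \<open>Distortion of inverse branches\<close>

text \<open>A bad map fixes \<open>c\<close> with vanishing derivative, and no integrability of the
  density is available there, so compactness in \<open>L^1\<close> cannot be used. Everything is
  kept pointwise and local instead. The cone is cut out by linear inequalities, hence the bounds
  pass from single inverse branches to sums over branches and over iterates with unchanged
  constants, and mass is cancelled only where integrability over \<open>K\<close> secures it. The
  cone has to live on each side of \<open>c\<close> separately, because the range of a bad branch is
  a single side. A good branch has range \<open>(0, 1)\<close>: it carries information from one side
  to the other, and it is the source of strict expansion, since the metric of \<open>(0, 1)\<close>
  is smaller, by a definite factor away from 0 and 1, than the metric of the side containing the
  point. The final exponent is explained by the fixed point 1 of \<alpha> -> 1 - (1 - \<alpha>) / l: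
  each step divides the distance to 1 by \<open>l\<close>, and \<open>1 / |x - c|\<close> is the
  borderline non-integrable power.\<close>

text \<open>The weights \<open>|\<psi>'|\<close> of inverse branches on \<open>(a, b)\<close> belong to this cone; the two monotonicity conditions
  are the integrated forms of \<open>-2 / (x - a) \<le> \<psi>'' / \<psi>' \<le> 2 / (b - x)\<close>.\<close>

definition koebe_cone :: "real \<Rightarrow> real \<Rightarrow> (real \<Rightarrow> real) \<Rightarrow> bool" where
  "koebe_cone a b g \<longleftrightarrow> (\<forall>x\<in>{a<..<b}. 0 \<le> g x) \<and>
     (\<forall>x y. a < x \<longrightarrow> x \<le> y \<longrightarrow> y < b \<longrightarrow>
        g x * (x - a)\<^sup>2 \<le> g y * (y - a)\<^sup>2 \<and> g y * (b - y)\<^sup>2 \<le> g x * (b - x)\<^sup>2)"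

lemma koebe_coneI:
  assumes "\<And>x. a < x \<Longrightarrow> x < b \<Longrightarrow> 0 \<le> g x"
    and "\<And>x y. a < x \<Longrightarrow> x \<le> y \<Longrightarrow> y < b \<Longrightarrow> g x * (x - a)\<^sup>2 \<le> g y * (y - a)\<^sup>2"
    and "\<And>x y. a < x \<Longrightarrow> x \<le> y \<Longrightarrow> y < b \<Longrightarrow> g y * (b - y)\<^sup>2 \<le> g x * (b - x)\<^sup>2"
  shows "koebe_cone a b g"
  using assms unfolding koebe_cone_def by auto

lemma koebe_coneD:
  assumes "koebe_cone a b g" "a < x" "x \<le> y" "y < b"
  shows "0 \<le> g x" "0 \<le> g y"
    and "g x * (x - a)\<^sup>2 \<le> g y * (y - a)\<^sup>2" "g y * (b - y)\<^sup>2 \<le> g x * (b - x)\<^sup>2"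
  using assms unfolding koebe_cone_def by auto

lemma koebe_cone_cong:
  assumes "koebe_cone a b f" "\<And>x. a < x \<Longrightarrow> x < b \<Longrightarrow> f x = g x"
  shows "koebe_cone a b g"
  using assms unfolding koebe_cone_def by auto

lemma koebe_cone_const: "0 \<le> k \<Longrightarrow> koebe_cone a b (\<lambda>_. k)"
  by (rule koebe_coneI) (auto intro!: mult_left_mono power_mono)

lemma koebe_cone_add:
  assumes "koebe_cone a b f" "koebe_cone a b g"
  shows "koebe_cone a b (\<lambda>x. f x + g x)"
  using koebe_coneD[OF assms(1)] koebe_coneD[OF assms(2)]
  by (intro koebe_coneI) (fastforce simp: distrib_right intro: add_mono)+

lemma koebe_cone_scale:
  assumes "koebe_cone a b f" "0 \<le> k"
  shows "koebe_cone a b (\<lambda>x. k * f x)"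
  using koebe_coneD[OF assms(1)] assms(2)
  by (intro koebe_coneI) (auto simp: mult.assoc intro!: mult_left_mono)

lemma koebe_cone_sum:
  assumes "\<And>i. i \<in> I \<Longrightarrow> koebe_cone a b (f i)"
  shows "koebe_cone a b (\<lambda>x. \<Sum>i\<in>I. f i x)"
  using assms
  by (induction I rule: infinite_finite_induct) (auto intro: koebe_cone_const koebe_cone_add)

text \<open>The quotient \<open>(x - a') / (x - a)\<close> is nondecreasing when
  \<open>a \<le> a'\<close>, so its square can be multiplied into the condition at \<open>a\<close>;
  symmetrically at \<open>b\<close>. Needed because a good branch has range \<open>(0, 1)\<close>,
  while the cone is imposed on the two sides.\<close>

lemma koebe_cone_subinterval:
  assumes "koebe_cone a b g" "a \<le> a'" "b' \<le> b"
  shows "koebe_cone a' b' g"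
proof (rule koebe_coneI)
  fix x y assume *: "a' < x" "x \<le> y" "y < b'"
  have "((x - a') / (x - a))\<^sup>2 \<le> ((y - a') / (y - a))\<^sup>2"
  proof (intro power_mono)
    have "(x - a') * (y - a) \<le> (y - a') * (x - a)"
      using mult_left_mono[of x y "a' - a"] * assms by (simp add: algebra_simps)
    then show "(x - a') / (x - a) \<le> (y - a') / (y - a)"
      using * assms by (simp add: divide_simps)
  qed (use * assms in auto)
  then have "(g x * (x - a)\<^sup>2) * ((x - a') / (x - a))\<^sup>2 \<le> (g y * (y - a)\<^sup>2) * ((y - a') / (y - a))\<^sup>2"
    using koebe_coneD[OF assms(1), of x y] * assms by (intro mult_mono[OF koebe_coneD(3)[OF assms(1)]]) auto
  then show "g x * (x - a')\<^sup>2 \<le> g y * (y - a')\<^sup>2"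
    using * assms by (simp add: power_divide)
next
  fix x y assume *: "a' < x" "x \<le> y" "y < b'"
  have "((b' - y) / (b - y))\<^sup>2 \<le> ((b' - x) / (b - x))\<^sup>2"
  proof (intro power_mono)
    have "(b' - y) * (b - x) \<le> (b' - x) * (b - y)"
      using mult_left_mono[of x y "b - b'"] * assms by (simp add: algebra_simps)
    then show "(b' - y) / (b - y) \<le> (b' - x) / (b - x)"
      using * assms by (simp add: divide_simps)
  qed (use * assms in auto)
  then have "(g y * (b - y)\<^sup>2) * ((b' - y) / (b - y))\<^sup>2 \<le> (g x * (b - x)\<^sup>2) * ((b' - x) / (b - x))\<^sup>2"
    using koebe_coneD[OF assms(1), of x y] * assms by (intro mult_mono[OF koebe_coneD(4)[OF assms(1)]]) auto
  then show "g y * (b' - y)\<^sup>2 \<le> g x * (b' - x)\<^sup>2"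
    using * assms by (simp add: power_divide)
qed (use koebe_coneD(1)[OF assms(1) _ order_refl] assms in auto)

text \<open>A general filter is allowed because the invariant density arises along a cluster filter
  and not along a subsequence.\<close>

lemma koebe_cone_tendsto:
  assumes "F \<noteq> bot" "\<And>x. a < x \<Longrightarrow> x < b \<Longrightarrow> ((\<lambda>n. f n x) \<longlongrightarrow> g x) F"
    and "\<forall>\<^sub>F n in F. koebe_cone a b (f n)"
  shows "koebe_cone a b g"
proof (rule koebe_coneI)
  fix x y assume *: "a < x" "x \<le> y" "y < b"
  show "g x * (x - a)\<^sup>2 \<le> g y * (y - a)\<^sup>2"
    by (rule tendsto_le[OF assms(1) tendsto_mult_right[OF assms(2)] tendsto_mult_right[OF assms(2)]])
      (use * assms(3) in \<open>auto elim!: eventually_mono simp: koebe_coneD\<close>)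
  show "g y * (b - y)\<^sup>2 \<le> g x * (b - x)\<^sup>2"
    by (rule tendsto_le[OF assms(1) tendsto_mult_right[OF assms(2)] tendsto_mult_right[OF assms(2)]])
      (use * assms(3) in \<open>auto elim!: eventually_mono simp: koebe_coneD\<close>)
next
  fix x assume *: "a < x" "x < b"
  show "0 \<le> g x"
    by (rule tendsto_lowerbound[OF assms(2) _ assms(1)])
      (use * assms(3) in \<open>auto elim!: eventually_mono simp: koebe_coneD(1)[OF _ _ order_refl]\<close>)
qed

text \<open>Left of the midpoint the condition at \<open>b\<close> limits the decay, right of it the
  condition at \<open>a\<close>; the loss is at most the square of half the length over the length.
  This is what keeps the density away from zero up to the ends of a side.\<close>

lemma koebe_cone_lower:
  assumes "koebe_cone a b g" "a < x" "x < b"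
  shows "g ((a + b) / 2) / 4 \<le> g x"
proof (cases "x \<le> (a + b) / 2")
  case True
  have "g ((a + b) / 2) * (b - (a + b) / 2)\<^sup>2 \<le> g x * (b - x)\<^sup>2"
    by (rule koebe_coneD(4)[OF assms(1)]) (use assms True in auto)
  also have "\<dots> \<le> g x * (b - a)\<^sup>2"
    using assms koebe_coneD(1)[OF assms(1,2) order_refl assms(3)]
    by (intro mult_left_mono power_mono) auto
  also have "b - (a + b) / 2 = (b - a) / 2" by (simp add: field_simps)
  finally have "(g ((a + b) / 2) / 4) * (b - a)\<^sup>2 \<le> g x * (b - a)\<^sup>2" by (simp add: power_divide)
  then show ?thesis by (rule mult_right_le_imp_le) (use assms in auto)
next
  case False
  have "g ((a + b) / 2) * ((a + b) / 2 - a)\<^sup>2 \<le> g x * (x - a)\<^sup>2"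
    by (rule koebe_coneD(3)[OF assms(1)]) (use assms False in auto)
  also have "\<dots> \<le> g x * (b - a)\<^sup>2"
    using assms koebe_coneD(1)[OF assms(1,2) order_refl assms(3)]
    by (intro mult_left_mono power_mono) auto
  also have "(a + b) / 2 - a = (b - a) / 2" by (simp add: field_simps)
  finally have "(g ((a + b) / 2) / 4) * (b - a)\<^sup>2 \<le> g x * (b - a)\<^sup>2" by (simp add: power_divide)
  then show ?thesis by (rule mult_right_le_imp_le) (use assms in auto)
qed

text \<open>A Harnack inequality on compact cores. The constant depends only on the geometry of the
  core, so it is the same for all iterates and all their sums.\<close>

lemma koebe_cone_compare:
  assumes g: "koebe_cone a b g" and "0 < d" and x: "a + d \<le> x" "x \<le> b - d" and y: "a + d \<le> y" "y \<le> b - d"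
  shows "g x \<le> g y * ((b - a) / d)\<^sup>2"
proof (cases "x \<le> y")
  case True
  have "0 \<le> g y" using koebe_coneD(2)[OF g _ True] assms by auto
  have "g x * d\<^sup>2 \<le> g x * (x - a)\<^sup>2"
    using koebe_coneD(1)[OF g _ True] assms by (intro mult_left_mono power_mono) auto
  also have "\<dots> \<le> g y * (y - a)\<^sup>2" using koebe_coneD(3)[OF g _ True] assms by auto
  also have "\<dots> \<le> g y * (b - a)\<^sup>2" using \<open>0 \<le> g y\<close> assms by (intro mult_left_mono power_mono) auto
  finally show ?thesis using \<open>0 < d\<close> by (simp add: power_divide field_simps)
next
  case False
  then have yx: "y \<le> x" by simp
  have "0 \<le> g y" using koebe_coneD(1)[OF g _ yx] assms by auto
  have "g x * d\<^sup>2 \<le> g x * (b - x)\<^sup>2"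
    using koebe_coneD(2)[OF g _ yx] assms by (intro mult_left_mono power_mono) auto
  also have "\<dots> \<le> g y * (b - y)\<^sup>2" using koebe_coneD(4)[OF g _ yx] assms by auto
  also have "\<dots> \<le> g y * (b - a)\<^sup>2" using \<open>0 \<le> g y\<close> assms by (intro mult_left_mono power_mono) auto
  finally show ?thesis using \<open>0 < d\<close> by (simp add: power_divide field_simps)
qed

text \<open>The weights \<open>(x - a)^2\<close> and \<open>(b - x)^2\<close> are Lipschitz and at
  least \<open>d^2\<close> on the core, and the two monotonicity conditions bound the increment of
  \<open>g\<close> from opposite sides.\<close>

lemma koebe_cone_lipschitz:
  assumes g: "koebe_cone a b g" and "0 < d"
  shows "\<exists>L. L-lipschitz_on {a + d..b - d} g"
proof (cases "a + d \<le> b - d")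
  case False
  then show ?thesis by (auto intro!: exI[of _ 0] simp: lipschitz_on_def)
next
  case True
  define M where "M = g (a + d) * ((b - a) / d)\<^sup>2"
  define L where "L = M * (2 * (b - a) / d\<^sup>2)"
  have bd: "0 \<le> g x" "g x \<le> M" if "x \<in> {a + d..b - d}" for x
    unfolding M_def using koebe_cone_compare[OF g \<open>0 < d\<close>, of x "a + d"] that True
      koebe_coneD(1)[OF g, of x x] \<open>0 < d\<close> by auto
  then have M: "0 \<le> M" using True by (meson atLeastAtMost_iff order_refl order_trans)
  have "\<bar>g x - g y\<bar> \<le> L * (y - x)" if xy: "x \<in> {a + d..b - d}" "y \<in> {a + d..b - d}" "x \<le> y" for x y
  proof -
    have sq: "v\<^sup>2 - u\<^sup>2 \<le> 2 * (b - a) * (y - x)" if "0 \<le> u" "v = u + (y - x)" "v \<le> b - a" for u v :: real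
    proof -
      have "v\<^sup>2 - u\<^sup>2 = (v + u) * (y - x)" unfolding that(2) by algebra
      also have "\<dots> \<le> (2 * (b - a)) * (y - x)" using that xy by (intro mult_right_mono) auto
      finally show ?thesis .
    qed
    \<comment> \<open>One estimate serves both ends: \<open>u\<close> and \<open>v\<close> are the
      distances of \<open>x\<close> and \<open>y\<close> to \<open>a\<close>, or those of
      \<open>y\<close> and \<open>x\<close> to \<open>b\<close>.\<close>
    have key: "p - q \<le> L * (y - x)"
      if "p * u\<^sup>2 \<le> q * v\<^sup>2" "d \<le> u" "v = u + (y - x)" "v \<le> b - a" "0 \<le> q" "q \<le> M" for p q u v :: real
    proof -
      have "(p - q) * u\<^sup>2 \<le> q * (v\<^sup>2 - u\<^sup>2)"
        using that(1) by (simp add: left_diff_distrib right_diff_distrib)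
      also have "\<dots> \<le> M * (2 * (b - a) * (y - x))"
        using that sq[of u v] \<open>0 < d\<close> xy by (intro mult_mono) (auto intro!: power_mono)
      finally have 1: "(p - q) * u\<^sup>2 \<le> M * (2 * (b - a) * (y - x))" .
      have "(p - q) * d\<^sup>2 \<le> M * (2 * (b - a) * (y - x))"
      proof (cases "p \<le> q")
        case True
        have "0 \<le> M * (2 * (b - a) * (y - x))" using M xy \<open>0 < d\<close> \<open>a + d \<le> b - d\<close> by auto
        moreover have "(p - q) * d\<^sup>2 \<le> 0" using True by (simp add: mult_nonpos_nonneg)
        ultimately show ?thesis by linarith
      next
        case False
        then have "(p - q) * d\<^sup>2 \<le> (p - q) * u\<^sup>2"
          using that \<open>0 < d\<close> by (intro mult_left_mono power_mono) auto
        with 1 show ?thesis by linarith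
      qed
      then show ?thesis using \<open>0 < d\<close> unfolding L_def by (simp add: field_simps)
    qed
    have "g x - g y \<le> L * (y - x)"
      by (rule key[of _ "x - a" _ "y - a"]) (use koebe_coneD(3)[OF g, of x y] bd xy \<open>0 < d\<close> in auto)
    moreover have "g y - g x \<le> L * (y - x)"
      by (rule key[of _ "b - y" _ "b - x"]) (use koebe_coneD(4)[OF g, of x y] bd xy \<open>0 < d\<close> in auto)
    ultimately show ?thesis by linarith
  qed
  then have "\<bar>g x - g y\<bar> \<le> L * \<bar>x - y\<bar>" if "x \<in> {a + d..b - d}" "y \<in> {a + d..b - d}" for x y
    using that by (cases "x \<le> y") (force simp: abs_minus_commute)+
  moreover have "0 \<le> L" unfolding L_def using M \<open>0 < d\<close> True by auto
  ultimately show ?thesis by (auto simp: lipschitz_on_def dist_real_def intro!: exI[of _ L])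
qed

section \<open>Positive concave functions and the weights of inverse branches\<close>

lemma concave_pos_derivative_bounds:
  fixes k :: "real \<Rightarrow> real"
  assumes k1: "\<And>x. x \<in> {a<..<b} \<Longrightarrow> (k has_real_derivative k1 x) (at x)"
    and k2: "\<And>x. x \<in> {a<..<b} \<Longrightarrow> (k1 has_real_derivative k2 x) (at x)"
    and nonpos: "\<And>x. x \<in> {a<..<b} \<Longrightarrow> k2 x \<le> 0"
    and pos: "\<And>x. x \<in> {a<..<b} \<Longrightarrow> 0 < k x"
    and x: "x \<in> {a<..<b}"
  shows "0 \<le> k x + k1 x * (b - x)" "0 \<le> k x - k1 x * (x - a)"
proof -
  have anti: "k1 v \<le> k1 u" if "u \<in> {a<..<b}" "v \<in> {a<..<b}" "u \<le> v" for u v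
    by (rule DERIV_nonpos_imp_nonincreasing[OF that(3)]) (use that k2 nonpos in force)
  have tangent: "k z \<le> k x + k1 x * (z - x)" if z: "z \<in> {a<..<b}" for z
  proof (cases z x rule: linorder_cases)
    case less
    obtain u where u: "z < u" "u < x" "k x - k z = (x - z) * k1 u"
      using MVT2[OF less, of k k1] k1 x z by fastforce
    have "(x - z) * k1 x \<le> (x - z) * k1 u"
      using anti[of u x] u x z by (intro mult_left_mono) auto
    with u show ?thesis by (simp add: algebra_simps)
  next
    case greater
    obtain u where u: "x < u" "u < z" "k z - k x = (z - x) * k1 u"
      using MVT2[OF greater, of k k1] k1 x z by fastforce
    have "(z - x) * k1 u \<le> (z - x) * k1 x"
      using anti[of x u] u x z by (intro mult_left_mono) auto
    with u show ?thesis by (simp add: algebra_simps)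
  qed simp
  show "0 \<le> k x + k1 x * (b - x)"
  proof (rule ccontr)
    assume neg: "\<not> 0 \<le> k x + k1 x * (b - x)"
    have "k1 x < 0" using neg pos[OF x] x by (smt (verit) greaterThanLessThan_iff zero_le_mult_iff)
    \<comment> \<open>The zero of the tangent at \<open>x\<close>. The negated claim says that the
      tangent is negative at \<open>b\<close>, so this zero lies inside the interval, where the
      concave \<open>k\<close> is below its tangent but positive.\<close>
    let ?z = "x - k x / k1 x"
    have "x < ?z" using \<open>k1 x < 0\<close> pos[OF x] by (simp add: divide_less_0_iff)
    moreover have "?z < b" using neg \<open>k1 x < 0\<close> by (simp add: field_simps)
    ultimately have "?z \<in> {a<..<b}" using x by auto
    from tangent[OF this] pos[OF this] show False using \<open>k1 x < 0\<close> by simp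
  qed
  show "0 \<le> k x - k1 x * (x - a)"
  proof (rule ccontr)
    assume neg: "\<not> 0 \<le> k x - k1 x * (x - a)"
    have "0 < k1 x" using neg pos[OF x] x by (smt (verit) greaterThanLessThan_iff mult_nonpos_nonneg)
    let ?z = "x - k x / k1 x"
    have "?z < x" using \<open>0 < k1 x\<close> pos[OF x] by simp
    moreover have "a < ?z" using neg \<open>0 < k1 x\<close> by (simp add: field_simps)
    ultimately have "?z \<in> {a<..<b}" using x by auto
    from tangent[OF this] pos[OF this] show False using \<open>0 < k1 x\<close> by simp
  qed
qed

locale inverse_branch =
  fixes \<psi> \<phi> \<phi>1 \<phi>2 :: "real \<Rightarrow> real" and s a b a' b' :: real
  assumes ab: "a < b"
    and sign: "s = 1 \<or> s = -1"
    and deriv_psi: "x \<in> {a<..<b} \<Longrightarrow> (\<psi> has_real_derivative s / (\<phi> x)\<^sup>2) (at x)"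
    and phi_pos: "x \<in> {a<..<b} \<Longrightarrow> 0 < \<phi> x"
    and deriv_phi: "x \<in> {a<..<b} \<Longrightarrow> (\<phi> has_real_derivative \<phi>1 x) (at x)"
    and deriv_phi1: "x \<in> {a<..<b} \<Longrightarrow> (\<phi>1 has_real_derivative \<phi>2 x) (at x)"
    and phi2_nonpos: "x \<in> {a<..<b} \<Longrightarrow> \<phi>2 x \<le> 0"
    and psi_range: "x \<in> {a<..<b} \<Longrightarrow> \<psi> x \<in> {a'<..<b'}"
begin

text \<open>The weight \<open>\<phi>\<close> is \<open>|\<psi>'| powr (-1/2)\<close>; the Schwarzian of \<open>\<psi>\<close> being nonnegative means that \<open>\<phi>\<close> is concave.
  Concavity is inherited by \<open>\<phi> |e - \<psi>|\<close> because \<open>1 / (e - \<psi>)\<close> has the same Schwarzian.\<close>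

lemma deriv_kappa:
  assumes x: "x \<in> {a<..<b}"
  shows "((\<lambda>x. \<phi> x * (e - \<psi> x)) has_real_derivative \<phi>1 x * (e - \<psi> x) - s / \<phi> x) (at x)"
    and "((\<lambda>x. \<phi>1 x * (e - \<psi> x) - s / \<phi> x) has_real_derivative \<phi>2 x * (e - \<psi> x)) (at x)"
proof -
  have "\<phi> x \<noteq> 0" using phi_pos[OF x] by simp
  show "((\<lambda>x. \<phi> x * (e - \<psi> x)) has_real_derivative \<phi>1 x * (e - \<psi> x) - s / \<phi> x) (at x)"
    using \<open>\<phi> x \<noteq> 0\<close> by (auto intro!: derivative_eq_intros deriv_psi deriv_phi x simp: power2_eq_square)
  show "((\<lambda>x. \<phi>1 x * (e - \<psi> x) - s / \<phi> x) has_real_derivative \<phi>2 x * (e - \<psi> x)) (at x)"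
    using \<open>\<phi> x \<noteq> 0\<close>
    by (auto intro!: derivative_eq_intros deriv_psi deriv_phi deriv_phi1 x simp: power2_eq_square)
qed

text \<open>The tangent bounds for the positive concave function
  \<open>\<phi> * (b' - \<psi>)\<close>: its tangent at \<open>x\<close> is still nonnegative at
  both ends of \<open>(a, b)\<close>.\<close>

lemma kappa_upper:
  assumes x: "x \<in> {a<..<b}"
  defines "k \<equiv> \<phi> x * (b' - \<psi> x)" and "k1 \<equiv> \<phi>1 x * (b' - \<psi> x) - s / \<phi> x"
  shows "0 < k" "0 \<le> k + k1 * (b - x)" "0 \<le> k - k1 * (x - a)"
proof -
  show "0 < k" unfolding k_def using phi_pos[OF x] psi_range[OF x] by auto
  show "0 \<le> k + k1 * (b - x)" "0 \<le> k - k1 * (x - a)" unfolding k_def k1_def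
    by (rule concave_pos_derivative_bounds[where k="\<lambda>x. \<phi> x * (b' - \<psi> x)" and
          ?k1.0="\<lambda>x. \<phi>1 x * (b' - \<psi> x) - s / \<phi> x" and ?k2.0="\<lambda>x. \<phi>2 x * (b' - \<psi> x)", OF deriv_kappa _ _ x];
        use psi_range phi_pos phi2_nonpos in \<open>fastforce intro: mult_nonpos_nonneg\<close>)+
qed

lemma deriv_kappa':
  assumes x: "x \<in> {a<..<b}"
  shows "((\<lambda>x. \<phi> x * (\<psi> x - e)) has_real_derivative \<phi>1 x * (\<psi> x - e) + s / \<phi> x) (at x)"
    and "((\<lambda>x. \<phi>1 x * (\<psi> x - e) + s / \<phi> x) has_real_derivative \<phi>2 x * (\<psi> x - e)) (at x)"
  using DERIV_minus[OF deriv_kappa(1)[OF x, of e]] DERIV_minus[OF deriv_kappa(2)[OF x, of e]]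
  by (simp_all add: algebra_simps)

lemma kappa_lower:
  assumes x: "x \<in> {a<..<b}"
  defines "k \<equiv> \<phi> x * (\<psi> x - a')" and "k1 \<equiv> \<phi>1 x * (\<psi> x - a') + s / \<phi> x"
  shows "0 < k" "0 \<le> k + k1 * (b - x)" "0 \<le> k - k1 * (x - a)"
proof -
  show "0 < k" unfolding k_def using phi_pos[OF x] psi_range[OF x] by auto
  show "0 \<le> k + k1 * (b - x)" "0 \<le> k - k1 * (x - a)" unfolding k_def k1_def
    by (rule concave_pos_derivative_bounds[where k="\<lambda>x. \<phi> x * (\<psi> x - a')" and
          ?k1.0="\<lambda>x. \<phi>1 x * (\<psi> x - a') + s / \<phi> x" and ?k2.0="\<lambda>x. \<phi>2 x * (\<psi> x - a')", OF deriv_kappa' _ _ x];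
        use psi_range phi_pos phi2_nonpos in \<open>fastforce intro: mult_nonpos_nonneg\<close>)+
qed

text \<open>The two bounds come from the Wronskian of the concave functions \<open>\<phi> (\<psi> - a')\<close> and \<open>\<phi> (b' - \<psi>)\<close>,
  which is the constant \<open>s (b' - a')\<close>.\<close>

lemma poincare_contraction:
  assumes x: "x \<in> {a<..<b}"
  shows "(b' - a') * ((x - a) * (b - x)) \<le> (b - a) * ((\<phi> x)\<^sup>2 * ((\<psi> x - a') * (b' - \<psi> x)))"
proof -
  define k l k1 l1 where "k = \<phi> x * (b' - \<psi> x)" and "l = \<phi> x * (\<psi> x - a')"
    and "k1 = \<phi>1 x * (b' - \<psi> x) - s / \<phi> x" and "l1 = \<phi>1 x * (\<psi> x - a') + s / \<phi> x"
  have "\<phi> x \<noteq> 0" using phi_pos[OF x] by simp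
  have wronskian: "l1 * k - l * k1 = s * (b' - a')"
    unfolding k_def l_def k1_def l1_def using \<open>\<phi> x \<noteq> 0\<close> by (simp add: field_simps)
  have k: "0 < k" "0 \<le> k + k1 * (b - x)" "0 \<le> k - k1 * (x - a)"
    using kappa_upper[OF x] unfolding k_def k1_def by auto
  have l: "0 < l" "0 \<le> l + l1 * (b - x)" "0 \<le> l - l1 * (x - a)"
    using kappa_lower[OF x] unfolding l_def l1_def by auto
  have pos: "0 < x - a" "0 < b - x" using x by auto
  \<comment> \<open>The two nonnegative products below add up to \<open>(b - a) * (l * k)\<close>
    minus the Wronskian times \<open>(x - a) * (b - x)\<close>; the second estimate exchanges the
    roles of \<open>k\<close> and \<open>l\<close> for the opposite sign.\<close>
  have *: "(l1 * k - l * k1) * ((x - a) * (b - x)) \<le> (b - a) * (l * k)"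
  proof -
    have "0 \<le> (l - l1 * (x - a)) * (k * (b - x))" "0 \<le> (k + k1 * (b - x)) * (l * (x - a))"
      using k l pos by auto
    then show ?thesis by (simp add: algebra_simps)
  qed
  have **: "- (l1 * k - l * k1) * ((x - a) * (b - x)) \<le> (b - a) * (l * k)"
  proof -
    have "0 \<le> (k - k1 * (x - a)) * (l * (b - x))" "0 \<le> (l + l1 * (b - x)) * (k * (x - a))"
      using k l pos by auto
    then show ?thesis by (simp add: algebra_simps)
  qed
  have "(b' - a') * ((x - a) * (b - x)) \<le> (b - a) * (l * k)"
    using sign
  proof
    assume "s = -1"
    then have "- (l1 * k - l * k1) = b' - a'" using wronskian by simp
    with ** show ?thesis by metis
  qed (use * wronskian in simp)
  also have "l * k = (\<phi> x)\<^sup>2 * ((\<psi> x - a') * (b' - \<psi> x))"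
    unfolding k_def l_def by (simp add: power2_eq_square)
  finally show ?thesis .
qed

text \<open>Up to sign, the numerators of the derivatives of \<open>(b - x) / k x\<close> and
  \<open>(x - a) / k x\<close> are the values of the tangent of \<open>k\<close> at \<open>b\<close>
  and at \<open>a\<close>, which are nonnegative.\<close>

lemma kappa_quotient_mono:
  fixes k k1 :: "real \<Rightarrow> real"
  assumes k: "\<And>x. x \<in> {a<..<b} \<Longrightarrow> (k has_real_derivative k1 x) (at x)"
    and pos: "\<And>x. x \<in> {a<..<b} \<Longrightarrow> 0 < k x"
    and bd: "\<And>x. x \<in> {a<..<b} \<Longrightarrow> 0 \<le> k x + k1 x * (b - x)" "\<And>x. x \<in> {a<..<b} \<Longrightarrow> 0 \<le> k x - k1 x * (x - a)"
    and xy: "a < x" "x \<le> y" "y < b"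
  shows "((b - y) / k y)\<^sup>2 \<le> ((b - x) / k x)\<^sup>2" "((x - a) / k x)\<^sup>2 \<le> ((y - a) / k y)\<^sup>2"
proof -
  have "(b - y) / k y \<le> (b - x) / k x"
  proof (rule DERIV_nonpos_imp_nonincreasing[OF xy(2)])
    fix z assume "x \<le> z" "z \<le> y"
    then have z: "z \<in> {a<..<b}" using xy by auto
    have "((\<lambda>x. (b - x) / k x) has_real_derivative - (k z + k1 z * (b - z)) / (k z)\<^sup>2) (at z)"
      using pos[OF z] by (auto intro!: derivative_eq_intros k z simp: power2_eq_square field_simps)
    moreover have "- (k z + k1 z * (b - z)) / (k z)\<^sup>2 \<le> 0" using bd(1)[OF z] by (simp add: divide_nonpos_nonneg)
    ultimately show "\<exists>d. ((\<lambda>x. (b - x) / k x) has_real_derivative d) (at z) \<and> d \<le> 0" by blast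
  qed
  then show "((b - y) / k y)\<^sup>2 \<le> ((b - x) / k x)\<^sup>2"
    using pos[of y] xy by (intro power_mono) auto
  have "(x - a) / k x \<le> (y - a) / k y"
  proof (rule DERIV_nonneg_imp_nondecreasing[OF xy(2)])
    fix z assume "x \<le> z" "z \<le> y"
    then have z: "z \<in> {a<..<b}" using xy by auto
    have "((\<lambda>x. (x - a) / k x) has_real_derivative (k z - k1 z * (z - a)) / (k z)\<^sup>2) (at z)"
      using pos[OF z] by (auto intro!: derivative_eq_intros k z simp: power2_eq_square field_simps)
    moreover have "0 \<le> (k z - k1 z * (z - a)) / (k z)\<^sup>2" using bd(2)[OF z] by simp
    ultimately show "\<exists>d. ((\<lambda>x. (x - a) / k x) has_real_derivative d) (at z) \<and> 0 \<le> d" by blast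
  qed
  then show "((x - a) / k x)\<^sup>2 \<le> ((y - a) / k y)\<^sup>2"
    using pos[of x] xy by (intro power_mono) auto
qed

lemma psi_monotone:
  assumes "a < x" "x \<le> y" "y < b"
  shows "s = 1 \<Longrightarrow> \<psi> x \<le> \<psi> y" "s = -1 \<Longrightarrow> \<psi> y \<le> \<psi> x"
proof -
  have D: "(\<psi> has_real_derivative s / (\<phi> z)\<^sup>2) (at z)" if "x \<le> z" "z \<le> y" for z
    using deriv_psi assms that by auto
  show "\<psi> x \<le> \<psi> y" if "s = 1"
    by (rule DERIV_nonneg_imp_nondecreasing[OF assms(2)]) (use D that in fastforce)
  show "\<psi> y \<le> \<psi> x" if "s = -1"
    by (rule DERIV_nonpos_imp_nonincreasing[OF assms(2)]) (use D that in fastforce)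
qed

text \<open>The quantity at \<open>a\<close> factors as
  \<open>g (\<psi> x) * (\<psi> x - a')^2\<close> times the square of
  \<open>(x - a) / (\<phi> x * (\<psi> x - a'))\<close>. The first factor is monotone by the cone
  condition on \<open>g\<close>, the second by the concavity of
  \<open>\<phi> * (\<psi> - a')\<close>. A decreasing \<psi> exchanges the roles of
  \<open>a'\<close> and \<open>b'\<close>.\<close>

lemma koebe_cone_pullback:
  assumes g: "koebe_cone a' b' g"
  shows "koebe_cone a b (\<lambda>x. g (\<psi> x) / (\<phi> x)\<^sup>2)"
proof (rule koebe_coneI)
  fix x assume "a < x" "x < b"
  then show "0 \<le> g (\<psi> x) / (\<phi> x)\<^sup>2" using psi_range[of x] koebe_coneD(1)[OF g _ order_refl] by auto
next
  fix x y assume xy: "a < x" "x \<le> y" "y < b"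
  then have x: "x \<in> {a<..<b}" and y: "y \<in> {a<..<b}" by auto
  have r: "a' < \<psi> x" "\<psi> x < b'" "a' < \<psi> y" "\<psi> y < b'" using psi_range[OF x] psi_range[OF y] by auto
  note p = phi_pos[OF x] phi_pos[OF y]
  note upper = kappa_quotient_mono[OF deriv_kappa(1)[where e=b'] kappa_upper xy]
  note lower = kappa_quotient_mono[OF deriv_kappa'(1)[where e=a'] kappa_lower xy]
  have nonneg: "0 \<le> g (\<psi> x)" "0 \<le> g (\<psi> y)" using r koebe_coneD(1)[OF g _ order_refl] by auto
  have "g (\<psi> x) / (\<phi> x)\<^sup>2 * (x - a)\<^sup>2 \<le> g (\<psi> y) / (\<phi> y)\<^sup>2 * (y - a)\<^sup>2 \<and>
        g (\<psi> y) / (\<phi> y)\<^sup>2 * (b - y)\<^sup>2 \<le> g (\<psi> x) / (\<phi> x)\<^sup>2 * (b - x)\<^sup>2"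
    using sign
  proof
    assume "s = 1"
    then have le: "\<psi> x \<le> \<psi> y" using psi_monotone xy by auto
    have "(g (\<psi> x) * (\<psi> x - a')\<^sup>2) * ((x - a) / (\<phi> x * (\<psi> x - a')))\<^sup>2
        \<le> (g (\<psi> y) * (\<psi> y - a')\<^sup>2) * ((y - a) / (\<phi> y * (\<psi> y - a')))\<^sup>2"
      by (rule mult_mono[OF koebe_coneD(3)[OF g] lower(2)]) (use r le nonneg in auto)
    moreover have "(g (\<psi> y) * (b' - \<psi> y)\<^sup>2) * ((b - y) / (\<phi> y * (b' - \<psi> y)))\<^sup>2
        \<le> (g (\<psi> x) * (b' - \<psi> x)\<^sup>2) * ((b - x) / (\<phi> x * (b' - \<psi> x)))\<^sup>2"
      by (rule mult_mono[OF koebe_coneD(4)[OF g] upper(1)]) (use r le nonneg in auto)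
    ultimately show ?thesis using r p by (simp add: power_divide power_mult_distrib)
  next
    assume "s = -1"
    then have le: "\<psi> y \<le> \<psi> x" using psi_monotone xy by auto
    have "(g (\<psi> x) * (b' - \<psi> x)\<^sup>2) * ((x - a) / (\<phi> x * (b' - \<psi> x)))\<^sup>2
        \<le> (g (\<psi> y) * (b' - \<psi> y)\<^sup>2) * ((y - a) / (\<phi> y * (b' - \<psi> y)))\<^sup>2"
      by (rule mult_mono[OF koebe_coneD(4)[OF g] upper(2)]) (use r le nonneg in auto)
    moreover have "(g (\<psi> y) * (\<psi> y - a')\<^sup>2) * ((b - y) / (\<phi> y * (\<psi> y - a')))\<^sup>2
        \<le> (g (\<psi> x) * (\<psi> x - a')\<^sup>2) * ((b - x) / (\<phi> x * (\<psi> x - a')))\<^sup>2"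
      by (rule mult_mono[OF koebe_coneD(3)[OF g] lower(1)]) (use r le nonneg in auto)
    ultimately show ?thesis using r p by (simp add: power_divide power_mult_distrib)
  qed
  then show "g (\<psi> x) / (\<phi> x)\<^sup>2 * (x - a)\<^sup>2 \<le> g (\<psi> y) / (\<phi> y)\<^sup>2 * (y - a)\<^sup>2"
    and "g (\<psi> y) / (\<phi> y)\<^sup>2 * (b - y)\<^sup>2 \<le> g (\<psi> x) / (\<phi> x)\<^sup>2 * (b - x)\<^sup>2" by auto
qed

end

text \<open>With \<phi> the square root of \<open>|T1|\<close> along the inverse branch, the second
  derivative of \<phi> is the Schwarzian of \<open>T\<close> divided by a positive quantity, so a
  nonpositive Schwarzian of \<open>T\<close> is concavity of \<phi>.\<close>

lemma inverse_branch_inv_into: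
  fixes T T1 T2 T3 :: "real \<Rightarrow> real"
  assumes bij: "bij_betw T {a'<..<b'} {a<..<b}" and "a < b"
    and T1: "\<And>y. y \<in> {a'<..<b'} \<Longrightarrow> (T has_real_derivative T1 y) (at y)"
    and T2: "\<And>y. y \<in> {a'<..<b'} \<Longrightarrow> (T1 has_real_derivative T2 y) (at y)"
    and T3: "\<And>y. y \<in> {a'<..<b'} \<Longrightarrow> (T2 has_real_derivative T3 y) (at y)"
    and nz: "\<And>y. y \<in> {a'<..<b'} \<Longrightarrow> T1 y \<noteq> 0"
    and schwarz: "\<And>y. y \<in> {a'<..<b'} \<Longrightarrow> T3 y / T1 y - 3 / 2 * (T2 y / T1 y)\<^sup>2 \<le> 0"
  shows "\<exists>\<phi>1 \<phi>2 s. inverse_branch (inv_into {a'<..<b'} T) (\<lambda>x. sqrt \<bar>T1 (inv_into {a'<..<b'} T x)\<bar>) \<phi>1 \<phi>2 s a b a' b'"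
proof -
  define \<psi> where "\<psi> = inv_into {a'<..<b'} T"
  have range: "\<psi> x \<in> {a'<..<b'}" and T\<psi>: "T (\<psi> x) = x" if "x \<in> {a<..<b}" for x
    using that bij unfolding \<psi>_def by (auto simp: bij_betw_def intro: inv_into_into f_inv_into_f)
      (metis bij bij_betw_def greaterThanLessThan_iff inv_into_into that)+
  have \<psi>T: "\<psi> (T y) = y" if "y \<in> {a'<..<b'}" for y
    unfolding \<psi>_def using bij that by (simp add: bij_betw_inv_into_left)
  have "a' < b'" using range[of "(a + b) / 2"] \<open>a < b\<close> by auto
  \<comment> \<open>The image of the interval under the continuous \<open>T1\<close> is connected
    and omits 0, so \<open>T1\<close> has constant sign.\<close>
  have "\<exists>s. (s = 1 \<or> s = -1) \<and> (\<forall>y\<in>{a'<..<b'}. T1 y = s * \<bar>T1 y\<bar>)"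
  proof -
    have cont: "continuous_on {a'<..<b'} T1"
      by (rule continuous_at_imp_continuous_on) (use T2 DERIV_isCont in blast)
    have "connected (T1 ` {a'<..<b'})" by (rule connected_continuous_image[OF cont connected_Ioo])
    moreover have "0 \<notin> T1 ` {a'<..<b'}" using nz by force
    ultimately have "(\<forall>y\<in>{a'<..<b'}. 0 < T1 y) \<or> (\<forall>y\<in>{a'<..<b'}. T1 y < 0)"
      unfolding is_interval_connected_1[symmetric] is_interval_1
      by (smt (verit) image_eqI)
    then show ?thesis
    proof
      assume "\<forall>y\<in>{a'<..<b'}. 0 < T1 y"
      then show ?thesis by (intro exI[of _ 1]) auto
    next
      assume "\<forall>y\<in>{a'<..<b'}. T1 y < 0"
      then show ?thesis by (intro exI[of _ "-1"]) auto
    qed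
  qed
  then obtain s where s: "s = 1 \<or> s = -1" and sT1: "\<And>y. y \<in> {a'<..<b'} \<Longrightarrow> T1 y = s * \<bar>T1 y\<bar>" by blast
  have ss: "s * s = 1" using s by auto
  have pos: "0 < s * T1 y" if "y \<in> {a'<..<b'}" for y
    using sT1[OF that] nz[OF that] s by auto
  have abs_eq: "\<bar>T1 y\<bar> = s * T1 y" if "y \<in> {a'<..<b'}" for y
    using sT1[OF that] ss by (metis mult.assoc mult_1)
  have dpsi: "(\<psi> has_real_derivative inverse (T1 (\<psi> x))) (at x)" if x: "x \<in> {a<..<b}" for x
  proof -
    have "(\<psi> has_field_derivative inverse (T1 (\<psi> x))) (at (T (\<psi> x)))"
      unfolding has_field_derivative_def
    proof (rule has_derivative_inverse_strong[where S="{a'<..<b'}" and f=T and x="\<psi> x"])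
      show "(T has_derivative (*) (T1 (\<psi> x))) (at (\<psi> x))"
        using T1[OF range[OF x]] by (simp add: has_field_derivative_def)
      show "continuous_on {a'<..<b'} T"
        by (rule continuous_at_imp_continuous_on) (use T1 DERIV_isCont in blast)
    qed (use range[OF x] nz \<psi>T in \<open>auto simp: fun_eq_iff\<close>)
    then show ?thesis using T\<psi>[OF x] by simp
  qed
  define f where "f = (\<lambda>x. sqrt (s * T1 (\<psi> x)))"
  define f1 where "f1 = (\<lambda>x. s * T2 (\<psi> x) / (2 * sqrt (s * T1 (\<psi> x)) * T1 (\<psi> x)))"
  \<comment> \<open>The Schwarzian of \<open>T\<close> at \<psi> over \<open>2 * |T1|\<close> to the
    power 3/2.\<close>
  define f2 where "f2 = (\<lambda>x. (T3 (\<psi> x) / T1 (\<psi> x) - 3 / 2 * (T2 (\<psi> x) / T1 (\<psi> x))\<^sup>2) / (2 * (s * T1 (\<psi> x)) * sqrt (s * T1 (\<psi> x))))"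
  have feq: "sqrt \<bar>T1 (\<psi> x)\<bar> = f x" if "x \<in> {a<..<b}" for x
    unfolding f_def using abs_eq[OF range[OF that]] by simp
  have df: "(f has_real_derivative f1 x) (at x)" if x: "x \<in> {a<..<b}" for x
    unfolding f_def f1_def using pos[OF range[OF x]] nz[OF range[OF x]]
    by (auto intro!: derivative_eq_intros DERIV_chain2[OF T2] dpsi x range simp: field_simps)
  have df1: "(f1 has_real_derivative f2 x) (at x)" if x: "x \<in> {a<..<b}" for x
  proof -
    define r where "r = sqrt (s * T1 (\<psi> x))"
    have r: "0 < r" "T1 (\<psi> x) = s * r\<^sup>2"
      using pos[OF range[OF x]] ss by (auto simp: r_def mult.assoc[symmetric])
    have "s \<noteq> 0" using s by auto
    have "((\<lambda>x. sqrt (s * T1 (\<psi> x))) has_real_derivative f1 x) (at x)" using df[OF x] unfolding f_def .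
    note D = this
    have "(f1 has_real_derivative
       (s * (T3 (\<psi> x) * inverse (T1 (\<psi> x))) * (2 * r * T1 (\<psi> x))
        - s * T2 (\<psi> x) * (2 * f1 x * T1 (\<psi> x) + T2 (\<psi> x) * inverse (T1 (\<psi> x)) * (2 * r)))
       / ((2 * r * T1 (\<psi> x)) * (2 * r * T1 (\<psi> x)))) (at x)"
      unfolding f1_def[abs_def] r_def using pos[OF range[OF x]] nz[OF range[OF x]]
      by (intro DERIV_divide DERIV_mult DERIV_cmult DERIV_chain2[OF T3] DERIV_chain2[OF T2] dpsi x range)
        (auto intro!: D[unfolded f1_def])
    also have "(s * (T3 (\<psi> x) * inverse (T1 (\<psi> x))) * (2 * r * T1 (\<psi> x))
        - s * T2 (\<psi> x) * (2 * f1 x * T1 (\<psi> x) + T2 (\<psi> x) * inverse (T1 (\<psi> x)) * (2 * r)))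
       / ((2 * r * T1 (\<psi> x)) * (2 * r * T1 (\<psi> x))) = f2 x"
      unfolding f1_def f2_def r_def[symmetric] r(2) using s r(1)
      by (auto simp: field_simps power2_eq_square)
    finally show ?thesis .
  qed
  have "inverse_branch \<psi> (\<lambda>x. sqrt \<bar>T1 (\<psi> x)\<bar>) f1 f2 s a b a' b'"
  proof
    show "a < b" by fact
    show "s = 1 \<or> s = -1" by fact
    fix x assume x: "x \<in> {a<..<b}"
    show "(\<psi> has_real_derivative s / (sqrt \<bar>T1 (\<psi> x)\<bar>)\<^sup>2) (at x)"
      using dpsi[OF x] sT1[OF range[OF x]] s by (auto simp: inverse_eq_divide)
    show "0 < sqrt \<bar>T1 (\<psi> x)\<bar>" using nz[OF range[OF x]] by simp
    show "\<psi> x \<in> {a'<..<b'}" by (rule range[OF x])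
    show "((\<lambda>x. sqrt \<bar>T1 (\<psi> x)\<bar>) has_real_derivative f1 x) (at x)"
      by (rule has_field_derivative_transform_within_open[OF df[OF x] _ x]) (use feq in auto)
    show "(f1 has_real_derivative f2 x) (at x)" by (rule df1[OF x])
    show "f2 x \<le> 0" unfolding f2_def
      using schwarz[OF range[OF x]] pos[OF range[OF x]] by (intro divide_nonpos_nonneg) auto
  qed
  then show ?thesis unfolding \<psi>_def by blast
qed

section \<open>Change of variables and a covering lemma\<close>

lemma emeasure_vimage_branch:
  fixes T \<psi> d :: "real \<Rightarrow> real"
  assumes bij: "bij_betw T {a'<..<b'} {a<..<b}"
    and inv: "\<And>x. x \<in> {a<..<b} \<Longrightarrow> \<psi> x \<in> {a'<..<b'} \<and> T (\<psi> x) = x"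
    and cont: "continuous_on {a'<..<b'} T"
    and d: "\<And>x. x \<in> {a<..<b} \<Longrightarrow> (\<psi> has_real_derivative d x) (at x)"
    and A: "A \<in> sets borel"
  shows "emeasure lborel (T -` A \<inter> {a'<..<b'}) = (\<integral>\<^sup>+x. ennreal \<bar>d x\<bar> * indicator (A \<inter> {a<..<b}) x \<partial>lborel)"
proof -
  have \<psi>T: "\<psi> (T y) = y" if "y \<in> {a'<..<b'}" for y
  proof -
    have "T y \<in> {a<..<b}" using bij that by (auto simp: bij_betw_def)
    from inv[OF this] show ?thesis using bij that by (meson bij_betw_imp_inj_on inj_onD)
  qed
  have image: "\<psi> ` (A \<inter> {a<..<b}) = T -` A \<inter> {a'<..<b'}"
  proof (intro equalityI subsetI)
    fix y assume y: "y \<in> T -` A \<inter> {a'<..<b'}"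
    then have "T y \<in> {a<..<b}" using bij by (auto simp: bij_betw_def)
    then show "y \<in> \<psi> ` (A \<inter> {a<..<b})" using y \<psi>T[of y] by (auto intro!: image_eqI[of y \<psi> "T y"])
  qed (use inv in auto)
  have meas: "T -` A \<inter> {a'<..<b'} \<in> sets borel"
    using cont A borel_measurable_continuous_on_restrict measurable_sets[of T "restrict_space borel {a'<..<b'}" borel A]
    by (force simp: space_restrict_space sets_restrict_space_iff)
  then have lm: "T -` A \<inter> {a'<..<b'} \<in> lmeasurable"
    by (intro bounded_set_imp_lmeasurable bounded_subset[OF bounded_Ioo[of a' b']]) auto
  let ?S = "A \<inter> {a<..<b}"
  have "(\<lambda>x. \<bar>d x\<bar> *\<^sub>R (1::real)) absolutely_integrable_on ?S \<and>
     integral ?S (\<lambda>x. \<bar>d x\<bar> *\<^sub>R (1::real)) = measure lebesgue (T -` A \<inter> {a'<..<b'})"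
  proof (subst has_absolute_integral_change_of_variables_real[where g=\<psi> and f="\<lambda>_. 1::real"])
    show "?S \<in> sets lebesgue" using A by auto
    show "inj_on \<psi> ?S" by (rule inj_on_inverseI[of _ T]) (use inv in auto)
    show "(\<psi> has_real_derivative d x) (at x within ?S)" if "x \<in> ?S" for x
      using d[of x] that by (auto intro: has_field_derivative_at_within)
    show "(\<lambda>_. 1::real) absolutely_integrable_on \<psi> ` ?S \<and>
       integral (\<psi> ` ?S) (\<lambda>_. 1) = measure lebesgue (T -` A \<inter> {a'<..<b'})"
      unfolding image using lm
      by (simp add: absolutely_integrable_on_iff_nonneg lmeasurable_iff_integrable_on[symmetric] lmeasure_integral)
  qed
  then have "((\<lambda>x. \<bar>d x\<bar>) has_integral measure lebesgue (T -` A \<inter> {a'<..<b'})) ?S"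
    by (auto simp: absolutely_integrable_on_def has_integral_iff)
  then have "(\<integral>\<^sup>+ x. ennreal (indicator ?S x * \<bar>d x\<bar>) \<partial>lborel) = ennreal (measure lebesgue (T -` A \<inter> {a'<..<b'}))"
    by (intro nn_integral_has_integral_lebesgue) auto
  also have "\<dots> = emeasure lborel (T -` A \<inter> {a'<..<b'})"
    using emeasure_eq_measure2[OF lm] meas by simp
  also have "(\<integral>\<^sup>+ x. ennreal (indicator ?S x * \<bar>d x\<bar>) \<partial>lborel) = (\<integral>\<^sup>+x. ennreal \<bar>d x\<bar> * indicator ?S x \<partial>lborel)"
    by (intro nn_integral_cong) (auto split: split_indicator)
  finally show ?thesis by simp
qed

text \<open>The set version says that the push-forward of Lebesgue measure on the domain of the
  branch has density \<open>|d|\<close> on its range; read as an equality of measures it gives the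
  formula for every nonnegative measurable \<open>F\<close>.\<close>

lemma nn_integral_branch:
  fixes T \<psi> d :: "real \<Rightarrow> real" and F :: "real \<Rightarrow> ennreal"
  assumes bij: "bij_betw T {a'<..<b'} {a<..<b}"
    and inv: "\<And>x. x \<in> {a<..<b} \<Longrightarrow> \<psi> x \<in> {a'<..<b'} \<and> T (\<psi> x) = x"
    and cont: "continuous_on {a'<..<b'} T"
    and d: "\<And>x. x \<in> {a<..<b} \<Longrightarrow> (\<psi> has_real_derivative d x) (at x)"
    and contd: "continuous_on {a<..<b} (\<lambda>x. \<bar>d x\<bar>)"
    and F: "F \<in> borel_measurable borel"
  shows "(\<integral>\<^sup>+y. F (T y) * indicator {a'<..<b'} y \<partial>lborel) = (\<integral>\<^sup>+x. F x * ennreal \<bar>d x\<bar> * indicator {a<..<b} x \<partial>lborel)"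
proof -
  let ?S = "{a'<..<b'}" and ?R = "{a<..<b}"
  have Tm: "T \<in> measurable (restrict_space lborel ?S) borel"
    using borel_measurable_continuous_on_restrict[OF cont] by (simp cong: measurable_cong_sets add: sets_restrict_space_cong[of lborel borel])
  have dm: "(\<lambda>x. ennreal \<bar>d x\<bar> * indicator ?R x) \<in> borel_measurable lborel"
  proof -
    have "(\<lambda>x. indicator ?R x *\<^sub>R \<bar>d x\<bar>) \<in> borel_measurable borel"
      by (rule borel_measurable_continuous_on_indicator) (use contd in auto)
    then have "(\<lambda>x. ennreal (indicator ?R x *\<^sub>R \<bar>d x\<bar>)) \<in> borel_measurable lborel" by simp
    also have "(\<lambda>x. ennreal (indicator ?R x *\<^sub>R \<bar>d x\<bar>)) = (\<lambda>x. ennreal \<bar>d x\<bar> * indicator ?R x)"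
      by (auto split: split_indicator)
    finally show ?thesis .
  qed
  have eq: "distr (restrict_space lborel ?S) borel T = density lborel (\<lambda>x. ennreal \<bar>d x\<bar> * indicator ?R x)"
  proof (rule measure_eqI)
    fix A assume "A \<in> sets (distr (restrict_space lborel ?S) borel T)"
    then have A: "A \<in> sets borel" by simp
    have "emeasure (distr (restrict_space lborel ?S) borel T) A = emeasure lborel (T -` A \<inter> ?S)"
      using A by (subst emeasure_distr[OF Tm]) (auto simp: emeasure_restrict_space space_restrict_space)
    also have "\<dots> = (\<integral>\<^sup>+x. ennreal \<bar>d x\<bar> * indicator (A \<inter> ?R) x \<partial>lborel)"
      by (rule emeasure_vimage_branch[OF bij inv cont d A])
    also have "\<dots> = emeasure (density lborel (\<lambda>x. ennreal \<bar>d x\<bar> * indicator ?R x)) A"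
      using A dm by (subst emeasure_density) (auto intro!: nn_integral_cong split: split_indicator)
    finally show "emeasure (distr (restrict_space lborel ?S) borel T) A = emeasure (density lborel (\<lambda>x. ennreal \<bar>d x\<bar> * indicator ?R x)) A" .
  qed simp
  have "(\<integral>\<^sup>+y. F (T y) * indicator ?S y \<partial>lborel) = (\<integral>\<^sup>+x. F x \<partial>distr (restrict_space lborel ?S) borel T)"
    using F Tm by (subst nn_integral_distr) (auto simp: nn_integral_restrict_space)
  also have "\<dots> = (\<integral>\<^sup>+x. F x * ennreal \<bar>d x\<bar> * indicator ?R x \<partial>lborel)"
    unfolding eq using F dm by (subst nn_integral_density) (auto intro!: nn_integral_cong simp: mult_ac)
  finally show ?thesis .
qed

text \<open>A Vitali argument in place of Lebesgue density points. Disjoint balls inside an open set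
  \<open>O'\<close> barely larger than \<open>E\<close> cover \<open>E\<close> up to a null set;
  their gaps are disjoint and lie in \<open>O' - E\<close>, so \<epsilon> times the measure of
  \<open>E\<close> is at most the excess of \<open>O'\<close>. The balls only have to contain the
  point \<open>y\<close>; no centring is available for images of cores under inverse
  branches.\<close>

lemma null_of_uniform_gaps:
  fixes E :: "real set"
  assumes E: "E \<in> lmeasurable" and "0 < \<epsilon>"
    and gaps: "\<And>y \<delta>. y \<in> E \<Longrightarrow> 0 < \<delta> \<Longrightarrow>
        \<exists>u r. 0 < r \<and> r < \<delta> \<and> y \<in> cball u r \<and> \<epsilon> * measure lebesgue (cball u r) \<le> measure lebesgue (cball u r - E)"
  shows "negligible E"
proof -
  have "\<epsilon> * measure lebesgue E \<le> \<eta>" if "0 < \<eta>" for \<eta>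
  proof -
    obtain O' where O': "open O'" "E \<subseteq> O'" "O' - E \<in> lmeasurable" "emeasure lebesgue (O' - E) < \<eta>"
      using sets_lebesgue_outer_open[OF fmeasurableD[OF E] \<open>0 < \<eta>\<close>] by blast
    define K where "K = {(u::real, r). 0 < r \<and> cball u r \<subseteq> O' \<and>
       \<epsilon> * measure lebesgue (cball u r) \<le> measure lebesgue (cball u r - E)}"
    have cover: "\<exists>i. i \<in> K \<and> y \<in> cball (fst i) (snd i) \<and> snd i < \<delta>" if "y \<in> E" "0 < \<delta>" for y \<delta>
    proof -
      obtain e where e: "0 < e" "ball y e \<subseteq> O'" using O' \<open>y \<in> E\<close> open_contains_ball by blast
      obtain u r where ur: "0 < r" "r < min \<delta> (e / 2)" "y \<in> cball u r"
        "\<epsilon> * measure lebesgue (cball u r) \<le> measure lebesgue (cball u r - E)"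
        using gaps[OF \<open>y \<in> E\<close>, of "min \<delta> (e / 2)"] e \<open>0 < \<delta>\<close> by auto
      have "cball u r \<subseteq> ball y e" using ur by (auto simp: dist_real_def)
      then have "(u, r) \<in> K" using ur e by (auto simp: K_def)
      then show ?thesis using ur by (intro exI[of _ "(u, r)"]) auto
    qed
    obtain C where C: "countable C" "C \<subseteq> K"
      "pairwise (\<lambda>i j. disjnt (cball (fst i) (snd i)) (cball (fst j) (snd j))) C"
      "negligible (E - (\<Union>i\<in>C. cball (fst i) (snd i)))"
    proof (rule Vitali_covering_theorem_cballs[of K snd E fst])
      show "0 < snd i" if "i \<in> K" for i using that by (auto simp: K_def)
    qed (use cover in blast)+
    let ?B = "\<lambda>i. cball (fst i) (snd i)"
    have disj: "disjoint_family_on ?B C"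
      using C(3) by (auto simp: pairwise_def disjoint_family_on_def disjnt_def)
    have Em: "E \<in> sets lebesgue" using E by auto
    have "ennreal (\<epsilon> * measure lebesgue E) = ennreal \<epsilon> * emeasure lebesgue E"
      using E \<open>0 < \<epsilon>\<close> by (simp add: emeasure_eq_measure2 ennreal_mult)
    also have "emeasure lebesgue E \<le> emeasure lebesgue (\<Union>i\<in>C. ?B i)"
    proof -
      have "emeasure lebesgue E \<le> emeasure lebesgue ((\<Union>i\<in>C. ?B i) \<union> (E - (\<Union>i\<in>C. ?B i)))"
        using C(1) Em by (intro emeasure_mono) (auto intro!: sets.countable_UN')
      also have "\<dots> = emeasure lebesgue (\<Union>i\<in>C. ?B i)"
        using C(1,4) by (intro emeasure_Un_null_set) (auto simp: negligible_iff_null_sets intro!: sets.countable_UN')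
      finally show ?thesis .
    qed
    also have "\<dots> = (\<integral>\<^sup>+i. emeasure lebesgue (?B i) \<partial>count_space C)"
      by (rule emeasure_UN_countable[OF _ C(1) disj]) auto
    also have "ennreal \<epsilon> * \<dots> = (\<integral>\<^sup>+i. ennreal \<epsilon> * emeasure lebesgue (?B i) \<partial>count_space C)"
      by (rule nn_integral_cmult[symmetric]) auto
    also have "\<dots> \<le> (\<integral>\<^sup>+i. emeasure lebesgue (?B i - E) \<partial>count_space C)"
    proof (rule nn_integral_mono)
      fix i assume "i \<in> space (count_space C)"
      then have "\<epsilon> * measure lebesgue (?B i) \<le> measure lebesgue (?B i - E)"
        using C(2) by (auto simp: K_def)
      moreover have "?B i \<in> lmeasurable" "?B i - E \<in> lmeasurable"
        using E by (auto intro: fmeasurable.Diff)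
      ultimately show "ennreal \<epsilon> * emeasure lebesgue (?B i) \<le> emeasure lebesgue (?B i - E)"
        using \<open>0 < \<epsilon>\<close> by (simp add: emeasure_eq_measure2 ennreal_mult[symmetric])
    qed
    also have "\<dots> = emeasure lebesgue (\<Union>i\<in>C. ?B i - E)"
      by (rule emeasure_UN_countable[OF _ C(1), symmetric])
        (use Em disj in \<open>auto simp: disjoint_family_on_def disjoint_iff\<close>)
    also have "\<dots> \<le> emeasure lebesgue (O' - E)"
    proof (rule emeasure_mono)
      have "?B i \<subseteq> O'" if "i \<in> C" for i
        using C(2) that by (cases i) (auto simp: K_def)
      then show "(\<Union>i\<in>C. ?B i - E) \<subseteq> O' - E" by blast
    qed (use O' Em in auto)
    also have "\<dots> \<le> ennreal \<eta>" using O'(4) by simp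
    finally have "ennreal (\<epsilon> * measure lebesgue E) \<le> ennreal \<eta>" by (simp add: mult_left_mono)
    then show ?thesis using that by simp
  qed
  note bound = this
  have "\<epsilon> * measure lebesgue E \<le> 0"
  proof (rule field_le_epsilon)
    fix e :: real assume "0 < e"
    from bound[OF this] show "\<epsilon> * measure lebesgue E \<le> 0 + e" by simp
  qed
  then have "measure lebesgue E = 0" using \<open>0 < \<epsilon>\<close> measure_nonneg[of lebesgue E] by (auto simp only: mult_le_0_iff)
  then show ?thesis using E by (simp add: negligible_iff_measure0)
qed

text \<open>The constant is the infimum \<open>a\<close> of the almost sure upper bounds: any number
  below \<open>a\<close> is not such a bound, so by the dichotomy it is an almost sure strict lower
  bound.\<close>

lemma AE_const_of_zero_one:
  fixes \<phi> :: "'a \<Rightarrow> real"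
  assumes nonneg: "AE x in M. 0 \<le> \<phi> x" and nontriv: "\<not> (AE x in M. False)"
    and dich: "\<And>a. (AE x in M. a < \<phi> x) \<or> (AE x in M. \<phi> x \<le> a)"
  shows "\<exists>a\<ge>0. AE x in M. \<phi> x = a"
proof -
  define A where "A = {a. AE x in M. \<phi> x \<le> a}"
  have below: "0 \<le> a" if "a \<in> A" for a
  proof (rule ccontr)
    assume "\<not> 0 \<le> a"
    then have "AE x in M. False" using that nonneg by (auto simp: A_def elim!: AE_mp)
    with nontriv show False by simp
  qed
  \<comment> \<open>Without an almost sure upper bound, \<phi> would exceed every natural number
    almost everywhere.\<close>
  have ne: "A \<noteq> {}"
  proof
    assume "A = {}"
    then have "AE x in M. real n < \<phi> x" for n using dich[of "real n"] by (auto simp: A_def)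
    then have "AE x in M. \<forall>n. real n < \<phi> x" by (simp add: AE_all_countable)
    then have "AE x in M. False" 
      by (rule AE_mp) (auto intro!: AE_I2 simp: not_less intro: real_nat_ceiling_ge)
    with nontriv show False by simp
  qed
  have bdd: "bdd_below A" by (rule bdd_belowI[OF below])
  define a where "a = Inf A"
  have "AE x in M. \<phi> x \<le> a + inverse (Suc n)" for n
  proof -
    have "\<exists>b\<in>A. b < a + inverse (Suc n)"
      unfolding a_def by (subst cInf_less_iff[OF ne bdd, symmetric]) auto
    then obtain b where "b \<in> A" "b < a + inverse (Suc n)" by blast
    then show ?thesis by (auto simp: A_def elim!: AE_mp)
  qed
  then have up: "AE x in M. \<forall>n. \<phi> x \<le> a + inverse (Suc n)" by (simp add: AE_all_countable)
  have "AE x in M. a - inverse (Suc n) < \<phi> x" for n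
  proof -
    have "a - inverse (Suc n) \<notin> A" using cInf_lower[OF _ bdd, of "a - inverse (Suc n)"] by (auto simp: a_def)
    then show ?thesis using dich[of "a - inverse (Suc n)"] by (auto simp: A_def)
  qed
  then have lo: "AE x in M. \<forall>n. a - inverse (Suc n) < \<phi> x" by (simp add: AE_all_countable)
  have "AE x in M. \<phi> x = a"
    using up lo
  proof eventually_elim
    case (elim x)
    have "\<phi> x \<le> a"
    proof (rule ccontr)
      assume "\<not> \<phi> x \<le> a"
      then obtain n where "inverse (real (Suc n)) < \<phi> x - a" using reals_Archimedean[of "\<phi> x - a"] by auto
      moreover have "\<phi> x \<le> a + inverse (real (Suc n))" using elim(1) by blast
      ultimately show False by linarith
    qed
    moreover have "a \<le> \<phi> x"
    proof (rule ccontr)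
      assume "\<not> a \<le> \<phi> x"
      then obtain n where "inverse (real (Suc n)) < a - \<phi> x" using reals_Archimedean[of "a - \<phi> x"] by auto
      moreover have "a - inverse (real (Suc n)) < \<phi> x" using elim(2) by blast
      ultimately show False by linarith
    qed
    ultimately show ?case by simp
  qed
  moreover have "0 \<le> a" unfolding a_def by (rule cInf_greatest[OF ne below])
  ultimately show ?thesis by blast
qed

section \<open>Good and bad maps\<close>

text \<open>Replaces iterated one-sided derivatives by ordinary ones. \<open>deriv f\<close> agrees
  with the first of them only on the open set \<open>U\<close>, which suffices for differentiating
  once more at points of \<open>U\<close>.\<close>

lemma nonpos_schwarzian_interior:
  assumes f: "nonpos_schwarzian_on f S" and U: "open U" "U \<subseteq> S"
  obtains f2 f3 where
    "\<And>y. y \<in> U \<Longrightarrow> (f has_real_derivative deriv f y) (at y)"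
    "\<And>y. y \<in> U \<Longrightarrow> (deriv f has_real_derivative f2 y) (at y)"
    "\<And>y. y \<in> U \<Longrightarrow> (f2 has_real_derivative f3 y) (at y)"
    "\<And>y. y \<in> U \<Longrightarrow> deriv f y \<noteq> 0"
    "\<And>y. y \<in> U \<Longrightarrow> f3 y / deriv f y - 3 / 2 * (f2 y / deriv f y)\<^sup>2 \<le> 0"
proof -
  define D where "D = (\<lambda>j. (deriv_within S ^^ j) f)"
  have DD: "(D j has_real_derivative D (Suc j) y) (at y)" if "y \<in> U" "j < 3" for y j
  proof -
    have "D j differentiable (at y within S)"
      using f that U unfolding nonpos_schwarzian_on_def times_differentiable_on_def D_def differentiable_on_def by auto
    moreover have at: "at y within S = at y" by (rule at_within_open_subset[OF \<open>y \<in> U\<close> U])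
    ultimately have "(D j has_vector_derivative vector_derivative (D j) (at y within S)) (at y)"
      by (simp add: vector_derivative_works)
    then show ?thesis by (simp add: D_def deriv_within_def has_real_derivative_iff_has_vector_derivative)
  qed
  have d1: "deriv f y = D 1 y" if "y \<in> U" for y
    using DD[OF that, of 0] by (simp add: D_def DERIV_imp_deriv)
  show thesis
  proof (rule that[of "D 2" "D 3"])
    fix y assume y: "y \<in> U"
    show "(f has_real_derivative deriv f y) (at y)"
      using DD[OF y, of 0] d1[OF y] by (simp add: D_def)
    show "(deriv f has_real_derivative D 2 y) (at y)"
      by (rule has_field_derivative_transform_within_open[OF _ U(1) y, of "D 1"])
        (use DD[OF y, of 1] d1 in \<open>auto simp: numeral_2_eq_2\<close>)
    show "(D 2 has_real_derivative D 3 y) (at y)"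
      using DD[OF y, of 2] by (simp add: numeral_3_eq_3)
    show "deriv f y \<noteq> 0"
      using f y U d1[OF y] unfolding nonpos_schwarzian_on_def D_def by auto
    show "D 3 y / deriv f y - 3 / 2 * (D 2 y / deriv f y)\<^sup>2 \<le> 0"
      using f y U d1[OF y] unfolding nonpos_schwarzian_on_def D_def schwarzian_def by auto
  qed
qed

section \<open>Branches, ranges and weights on the two sides of \<open>c\<close>\<close>

locale good_bad_system =
  fixes c :: real and N :: nat and p :: "nat \<Rightarrow> real" and T :: "nat \<Rightarrow> real \<Rightarrow> real"
  assumes c0: "0 < c" and c1: "c < 1"
    and maps: "\<And>j. j \<in> {1..N} \<Longrightarrow> T j \<in> good_maps c \<union> bad_maps c"
    and good_ne: "{j \<in> {1..N}. T j \<in> good_maps c} \<noteq> {}"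
    and bad_ne: "{j \<in> {1..N}. T j \<in> bad_maps c} \<noteq> {}"
    and p_pos: "\<And>j. j \<in> {1..N} \<Longrightarrow> p j > 0"
    and p_sum: "(\<Sum>j\<in>{1..N}. p j) = 1"
begin

definition lo :: "bool \<Rightarrow> real" where "lo b = (if b then c else 0)"
definition hi :: "bool \<Rightarrow> real" where "hi b = (if b then 1 else c)"

abbreviation side :: "bool \<Rightarrow> real set" where "side b \<equiv> {lo b<..<hi b}"

definition X :: "real set" where "X = {0<..<1} - {c}"

definition good :: "nat set" where "good = {j \<in> {1..N}. T j \<in> good_maps c}"

text \<open>Reading the range off the image lets full branches of good maps and one-sided branches
  of bad maps share one notation.\<close>

definition rlo :: "nat \<Rightarrow> bool \<Rightarrow> real" where "rlo j b = Inf (T j ` side b)"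
definition rhi :: "nat \<Rightarrow> bool \<Rightarrow> real" where "rhi j b = Sup (T j ` side b)"

abbreviation rng :: "nat \<Rightarrow> bool \<Rightarrow> real set" where "rng j b \<equiv> {rlo j b<..<rhi j b}"

definition \<psi> :: "nat \<Rightarrow> bool \<Rightarrow> real \<Rightarrow> real" where "\<psi> j b = inv_into (side b) (T j)"

text \<open>The value 0 off the range allows the transfer operator to be one sum over all branches
  at every point.\<close>

definition wt :: "nat \<Rightarrow> bool \<Rightarrow> real \<Rightarrow> real" where
  "wt j b x = (if x \<in> rng j b then 1 / \<bar>deriv (T j) (\<psi> j b x)\<bar> else 0)"

lemma side_bounds: "lo b < hi b" "0 \<le> lo b" "hi b \<le> 1" "side b \<subseteq> X"
  using c0 c1 by (auto simp: lo_def hi_def X_def)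

lemma X_side: "X = side False \<union> side True" "x \<in> X \<longleftrightarrow> (\<exists>b. x \<in> side b)"
proof -
  show "X = side False \<union> side True" using c0 c1 by (auto simp: lo_def hi_def X_def)
  then show "x \<in> X \<longleftrightarrow> (\<exists>b. x \<in> side b)" unfolding ex_bool_eq by blast
qed

lemma good_subset: "good \<subseteq> {1..N}" "good \<noteq> {}"
  using good_ne by (auto simp: good_def)

lemma not_good_imp_bad: "j \<in> {1..N} \<Longrightarrow> j \<notin> good \<Longrightarrow> T j \<in> bad_maps c"
  using maps by (auto simp: good_def)

lemma branch_range:
  assumes j: "j \<in> {1..N}"
  shows "bij_betw (T j) (side b) (rng j b) \<and>
    (if j \<in> good then rlo j b = 0 \<and> rhi j b = 1 else (\<exists>b'. rlo j b = lo b' \<and> rhi j b = hi b'))"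
proof -
  have eq: "rlo j b = l \<and> rhi j b = h" if "bij_betw (T j) (side b) {l<..<h}" "l < h" for l h
    using that by (simp add: rlo_def rhi_def bij_betw_imp_surj_on)
  show ?thesis
  proof (cases "j \<in> good")
    case True
    then have "bij_betw (T j) (side b) {0<..<1}"
      by (auto simp: good_def good_maps_def C_diffeo_def lo_def hi_def)
    with eq[OF this] True show ?thesis by auto
  next
    case False
    then have "T j \<in> bad_maps c" using not_good_imp_bad j by auto
    then have "\<exists>J\<in>{{0<..<c}, {c<..<1}}. bij_betw (T j) (side b) J"
      by (auto simp: bad_maps_def C_diffeo_def lo_def hi_def)
    then have "\<exists>b'. bij_betw (T j) (side b) (side b')"
    proof
      fix J assume J: "J \<in> {{0<..<c}, {c<..<1}}" "bij_betw (T j) (side b) J"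
      then have "J = side False \<or> J = side True" by (auto simp: lo_def hi_def)
      with J(2) show ?thesis by blast
    qed
    then obtain b' where "bij_betw (T j) (side b) (side b')" by blast
    with eq[OF this] side_bounds(1)[of b'] False show ?thesis by auto
  qed
qed

text \<open>A range is \<open>(0, 1)\<close> or a side, so a side never straddles the end of a
  range. This is why the cone on the two sides is preserved by every branch.\<close>

lemma rng_cases:
  assumes "j \<in> {1..N}"
  shows "rlo j b < rhi j b" "rng j b \<subseteq> {0<..<1}" "0 \<le> rlo j b" "rhi j b \<le> 1"
    and "side i \<subseteq> rng j b \<or> side i \<inter> rng j b = {}"
    and "side i \<subseteq> rng j b \<Longrightarrow> rlo j b \<le> lo i \<and> hi i \<le> rhi j b"
  using branch_range[OF assms, of b] c0 c1
  by (auto simp: lo_def hi_def greaterThanLessThan_subseteq_greaterThanLessThan split: if_splits)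

lemma map_facts:
  assumes j: "j \<in> {1..N}"
  shows "T j ` {0..1} \<subseteq> {0..1}" "nonpos_schwarzian_on (T j) {0..<c}" "nonpos_schwarzian_on (T j) {c<..1}"
    and "T j 0 \<in> {0, 1}" "T j 1 \<in> {0, 1}"
    and "\<bar>deriv_within {0..1} (T j) 0\<bar> > 1" "\<bar>deriv_within {0..1} (T j) 1\<bar> > 1"
  using maps[OF j] by (auto simp: good_maps_def bad_maps_def)

lemma T_derivs:
  assumes j: "j \<in> {1..N}"
  obtains f2 f3 where
    "\<And>y. y \<in> side b \<Longrightarrow> (T j has_real_derivative deriv (T j) y) (at y)"
    "\<And>y. y \<in> side b \<Longrightarrow> (deriv (T j) has_real_derivative f2 y) (at y)"
    "\<And>y. y \<in> side b \<Longrightarrow> (f2 has_real_derivative f3 y) (at y)"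
    "\<And>y. y \<in> side b \<Longrightarrow> deriv (T j) y \<noteq> 0"
    "\<And>y. y \<in> side b \<Longrightarrow> f3 y / deriv (T j) y - 3 / 2 * (f2 y / deriv (T j) y)\<^sup>2 \<le> 0"
proof (cases b)
  case True
  have o: "open (side b)" "side b \<subseteq> {c<..1}" using True by (auto simp: lo_def hi_def)
  show thesis
    by (rule nonpos_schwarzian_interior[OF map_facts(3)[OF j] o]) (rule that)
next
  case False
  have o: "open (side b)" "side b \<subseteq> {0..<c}" using False by (auto simp: lo_def hi_def)
  show thesis
    by (rule nonpos_schwarzian_interior[OF map_facts(2)[OF j] o]) (rule that)
qed

lemma T_deriv:
  assumes "j \<in> {1..N}" "y \<in> X"
  shows "(T j has_real_derivative deriv (T j) y) (at y)" "deriv (T j) y \<noteq> 0" "isCont (deriv (T j)) y"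
proof -
  obtain b where "y \<in> side b" using assms X_side by blast
  with T_derivs[OF assms(1), of b] show "(T j has_real_derivative deriv (T j) y) (at y)"
    "deriv (T j) y \<noteq> 0" "isCont (deriv (T j)) y"
    by (metis DERIV_isCont)+
qed

lemma T_cont: "j \<in> {1..N} \<Longrightarrow> continuous_on (side b) (T j)"
  using T_deriv(1) side_bounds(4) by (meson DERIV_isCont continuous_at_imp_continuous_on subsetD)

lemma psi_inverse_branch:
  assumes j: "j \<in> {1..N}"
  shows "\<exists>f1 f2 s. inverse_branch (\<psi> j b) (\<lambda>x. sqrt \<bar>deriv (T j) (\<psi> j b x)\<bar>) f1 f2 s (rlo j b) (rhi j b) (lo b) (hi b)"
proof -
  obtain f2 f3 where
    "\<And>y. y \<in> side b \<Longrightarrow> (T j has_real_derivative deriv (T j) y) (at y)"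
    "\<And>y. y \<in> side b \<Longrightarrow> (deriv (T j) has_real_derivative f2 y) (at y)"
    "\<And>y. y \<in> side b \<Longrightarrow> (f2 has_real_derivative f3 y) (at y)"
    "\<And>y. y \<in> side b \<Longrightarrow> deriv (T j) y \<noteq> 0"
    "\<And>y. y \<in> side b \<Longrightarrow> f3 y / deriv (T j) y - 3 / 2 * (f2 y / deriv (T j) y)\<^sup>2 \<le> 0"
    using T_derivs[OF j, of b] by blast
  then show ?thesis unfolding \<psi>_def
    by (intro inverse_branch_inv_into[OF conjunct1[OF branch_range[OF j]] rng_cases(1)[OF j]])
qed

lemma psi_inverse:
  assumes j: "j \<in> {1..N}"
  shows "x \<in> rng j b \<Longrightarrow> \<psi> j b x \<in> side b" "x \<in> rng j b \<Longrightarrow> T j (\<psi> j b x) = x"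
    and "y \<in> side b \<Longrightarrow> T j y \<in> rng j b" "y \<in> side b \<Longrightarrow> \<psi> j b (T j y) = y"
proof -
  note bij = conjunct1[OF branch_range[OF j, of b]]
  show "\<psi> j b x \<in> side b" if "x \<in> rng j b"
    unfolding \<psi>_def using bij that by (metis bij_betw_def inv_into_into)
  show "T j (\<psi> j b x) = x" if "x \<in> rng j b"
    unfolding \<psi>_def using bij that by (metis bij_betw_inv_into_right)
  show "T j y \<in> rng j b" if "y \<in> side b"
    using bij that by (metis bij_betwE)
  show "\<psi> j b (T j y) = y" if "y \<in> side b"
    unfolding \<psi>_def using bij that by (metis bij_betw_inv_into_left)
qed

lemma psi_has_derivative:
  assumes j: "j \<in> {1..N}" and x: "x \<in> rng j b"
  shows "\<exists>d. (\<psi> j b has_real_derivative d) (at x) \<and> \<bar>d\<bar> = wt j b x"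
proof -
  obtain f1 f2 s where B: "inverse_branch (\<psi> j b) (\<lambda>x. sqrt \<bar>deriv (T j) (\<psi> j b x)\<bar>) f1 f2 s (rlo j b) (rhi j b) (lo b) (hi b)"
    using psi_inverse_branch[OF j] by blast
  then interpret inverse_branch "\<psi> j b" "\<lambda>x. sqrt \<bar>deriv (T j) (\<psi> j b x)\<bar>" f1 f2 s "rlo j b" "rhi j b" "lo b" "hi b" .
  show ?thesis using deriv_psi[OF x] sign x
    by (intro exI conjI) (auto simp: wt_def abs_divide)
qed

lemma wt_nonneg: "0 \<le> wt j b x"
  by (simp add: wt_def)

lemma wt_pos: "j \<in> {1..N} \<Longrightarrow> x \<in> rng j b \<Longrightarrow> 0 < wt j b x"
  using psi_inverse(1)[of j x b] T_deriv(2)[of j "\<psi> j b x"] side_bounds(4)[of b] by (simp add: wt_def subset_iff)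

lemma psi_isCont:
  assumes "j \<in> {1..N}" "x \<in> rng j b"
  shows "isCont (\<psi> j b) x"
  using psi_has_derivative[OF assms] DERIV_isCont by blast

lemma wt_cont:
  assumes j: "j \<in> {1..N}"
  shows "continuous_on (rng j b) (wt j b)"
proof -
  have "continuous_on (rng j b) (\<lambda>x. 1 / \<bar>deriv (T j) (\<psi> j b x)\<bar>)"
  proof (rule continuous_at_imp_continuous_on, safe)
    fix x assume x: "x \<in> rng j b"
    then have y: "\<psi> j b x \<in> X" using psi_inverse(1)[OF j x] side_bounds(4) by blast
    have "isCont (\<lambda>x. deriv (T j) (\<psi> j b x)) x"
      by (rule isCont_o2[OF psi_isCont[OF j x] T_deriv(3)[OF j y]])
    then show "isCont (\<lambda>x. 1 / \<bar>deriv (T j) (\<psi> j b x)\<bar>) x"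
      using T_deriv(2)[OF j y] by (intro continuous_intros) auto
  qed
  then show ?thesis by (rule continuous_on_cong[THEN iffD1, rotated 2]) (auto simp: wt_def)
qed

lemma koebe_cone_branch:
  assumes j: "j \<in> {1..N}" and g: "koebe_cone (lo b) (hi b) g"
  shows "koebe_cone (lo i) (hi i) (\<lambda>x. wt j b x * g (\<psi> j b x))"
proof -
  obtain f1 f2 s where B: "inverse_branch (\<psi> j b) (\<lambda>x. sqrt \<bar>deriv (T j) (\<psi> j b x)\<bar>) f1 f2 s (rlo j b) (rhi j b) (lo b) (hi b)"
    using psi_inverse_branch[OF j] by blast
  consider "side i \<subseteq> rng j b" | "side i \<inter> rng j b = {}" using rng_cases(5)[OF j] by blast
  then show ?thesis
  proof cases
    case 1
    have "koebe_cone (lo i) (hi i) (\<lambda>x. g (\<psi> j b x) / (sqrt \<bar>deriv (T j) (\<psi> j b x)\<bar>)\<^sup>2)"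
      using koebe_cone_subinterval[OF inverse_branch.koebe_cone_pullback[OF B g]] rng_cases(6)[OF j 1] by auto
    then show ?thesis
      by (rule koebe_cone_cong) (use 1 in \<open>auto simp: wt_def subset_iff\<close>)
  next
    case 2
    have "koebe_cone (lo i) (hi i) (\<lambda>_. 0)" by (rule koebe_cone_const) simp
    then show ?thesis by (rule koebe_cone_cong) (use 2 in \<open>auto simp: wt_def\<close>)
  qed
qed

lemma T_in_unit: "j \<in> {1..N} \<Longrightarrow> y \<in> X \<Longrightarrow> T j y \<in> {0<..<1}"
  using psi_inverse(3) rng_cases(2) X_side(2) by blast

lemma bad_T_in_X:
  assumes j: "j \<in> {1..N}" "j \<notin> good" and y: "y \<in> X"
  shows "T j y \<in> X"
proof -
  obtain b where b: "y \<in> side b" using y X_side(2) by blast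
  obtain i where "rlo j b = lo i" "rhi j b = hi i" using branch_range[OF j(1), of b] j(2) by auto
  then have "T j y \<in> side i" using psi_inverse(3)[OF j(1) b] by simp
  then show ?thesis using X_side(2) by blast
qed

text \<open>The density of the hyperbolic metric on the two components of \<open>X\<close>.\<close>

definition \<rho> :: "real \<Rightarrow> real" where
  "\<rho> x = (if x < c then c / (x * (c - x)) else (1 - c) / ((x - c) * (1 - x)))"

section \<open>Expansion of the hyperbolic metric\<close>

lemma rho_side: "x \<in> side b \<Longrightarrow> \<rho> x = (hi b - lo b) / ((x - lo b) * (hi b - x))"
  by (auto simp: \<rho>_def lo_def hi_def split: if_splits)

lemma rho_pos: "x \<in> X \<Longrightarrow> 0 < \<rho> x"
  using rho_side side_bounds(1) X_side(2) by (auto intro!: divide_pos_pos mult_pos_pos)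

text \<open>Expansion from the metric of the side to the metric of the range of the branch: the
  contraction estimate for the inverse branch, read at \<open>T j y\<close>.\<close>

lemma rho_expansion:
  assumes j: "j \<in> {1..N}" and y: "y \<in> side b"
  shows "\<rho> y * ((T j y - rlo j b) * (rhi j b - T j y)) \<le> (rhi j b - rlo j b) * \<bar>deriv (T j) y\<bar>"
proof -
  obtain f1 f2 s where B: "inverse_branch (\<psi> j b) (\<lambda>x. sqrt \<bar>deriv (T j) (\<psi> j b x)\<bar>) f1 f2 s (rlo j b) (rhi j b) (lo b) (hi b)"
    using psi_inverse_branch[OF j] by blast
  have pos: "0 < (y - lo b) * (hi b - y)" using y by auto
  have "(hi b - lo b) * ((T j y - rlo j b) * (rhi j b - T j y))
     \<le> (rhi j b - rlo j b) * (\<bar>deriv (T j) y\<bar> * ((y - lo b) * (hi b - y)))"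
    using inverse_branch.poincare_contraction[OF B psi_inverse(3)[OF j y]] psi_inverse(4)[OF j y] by simp
  then have "(hi b - lo b) * ((T j y - rlo j b) * (rhi j b - T j y)) / ((y - lo b) * (hi b - y))
      \<le> (rhi j b - rlo j b) * \<bar>deriv (T j) y\<bar>"
    using pos by (simp add: pos_divide_le_eq mult.assoc)
  then show ?thesis using rho_side[OF y] by simp
qed

text \<open>The density of an interval is the sum of the reciprocal distances to its two ends, so it
  grows when the range is cut down to the side containing the image point.\<close>

lemma rho_weak_expansion:
  assumes j: "j \<in> {1..N}" and y: "y \<in> X" and Ty: "T j y \<in> X"
  shows "\<rho> y \<le> \<bar>deriv (T j) y\<bar> * \<rho> (T j y)"
proof -
  obtain b i where b: "y \<in> side b" and i: "T j y \<in> side i" using y Ty X_side(2) by blast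
  have sub: "rlo j b \<le> lo i" "hi i \<le> rhi j b"
    using rng_cases(5,6)[OF j, of i b] i psi_inverse(3)[OF j b] by blast+
  let ?x = "T j y" and ?l = "rlo j b" and ?h = "rhi j b"
  have pos: "0 < (?x - ?l) * (?h - ?x)" using psi_inverse(3)[OF j b] by auto
  have "\<rho> y \<le> \<bar>deriv (T j) y\<bar> * ((?h - ?l) / ((?x - ?l) * (?h - ?x)))"
    using rho_expansion[OF j b] pos by (simp add: pos_le_divide_eq mult_ac)
  also have "(?h - ?l) / ((?x - ?l) * (?h - ?x)) = 1 / (?x - ?l) + 1 / (?h - ?x)"
  proof -
    have "?x - ?l \<noteq> 0" "?h - ?x \<noteq> 0" using pos by auto
    then show ?thesis by (simp add: add_frac_eq)
  qed
  also have "\<dots> \<le> 1 / (?x - lo i) + 1 / (hi i - ?x)"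
    using i sub by (intro add_mono divide_left_mono) auto
  also have "\<dots> = \<rho> ?x" using i rho_side[OF i] by (auto simp: field_simps)
  finally show ?thesis by (simp add: mult_left_mono)
qed

text \<open>For a good map the range metric is that of \<open>(0, 1)\<close>, and passing to the
  smaller side gains a definite factor. The gain degenerates only at 0 and 1, hence the bound
  \<open>d\<close>; closeness to \<open>c\<close> does no harm.\<close>

lemma rho_strict_expansion:
  assumes j: "j \<in> good" and y: "y \<in> X" and Ty: "T j y \<in> X" and d: "0 < d" "d \<le> T j y" "T j y \<le> 1 - d"
  shows "(1 + d * min c (1 - c)) * \<rho> y \<le> \<bar>deriv (T j) y\<bar> * \<rho> (T j y)"
proof -
  obtain b i where b: "y \<in> side b" and i: "T j y \<in> side i" using y Ty X_side(2) by blast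
  have jN: "j \<in> {1..N}" using j good_subset by auto
  have lh: "rlo j b = 0" "rhi j b = 1" using branch_range[OF jN, of b] j by auto
  let ?x = "T j y"
  have x01: "0 < ?x" "?x < 1" using d by auto
  have a: "\<rho> y \<le> \<bar>deriv (T j) y\<bar> * (1 / (?x * (1 - ?x)))"
    using rho_expansion[OF jN b] lh x01 by (simp add: pos_le_divide_eq mult_ac)
  \<comment> \<open>The ratio of the two densities is 1 + x (1 - c) / (c - x) to the left of
    \<open>c\<close> and 1 + c (1 - x) / (x - c) to the right.\<close>
  have "(1 + d * min c (1 - c)) * (1 / (?x * (1 - ?x))) \<le> \<rho> ?x"
  proof (cases i)
    case False
    then have xc: "?x < c" using i by (auto simp: hi_def)
    have "(1 + d * min c (1 - c)) * (c - ?x) \<le> c * (1 - ?x)"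
    proof -
      have "d * min c (1 - c) * (c - ?x) \<le> ?x * (1 - c) * 1"
        using d xc x01 c0 c1 by (intro mult_mono) auto
      then show ?thesis by (simp add: algebra_simps)
    qed
    then show ?thesis using xc x01 by (simp add: \<rho>_def divide_simps mult_ac)
  next
    case True
    then have xc: "c < ?x" using i by (auto simp: lo_def)
    have "(1 + d * min c (1 - c)) * (?x - c) \<le> (1 - c) * ?x"
    proof -
      have "d * min c (1 - c) * (?x - c) \<le> (1 - ?x) * c * 1"
        using d xc x01 c0 c1 by (intro mult_mono) auto
      then show ?thesis by (simp add: algebra_simps)
    qed
    then show ?thesis using xc x01 by (simp add: \<rho>_def divide_simps mult_ac)
  qed
  then have "\<bar>deriv (T j) y\<bar> * ((1 + d * min c (1 - c)) * (1 / (?x * (1 - ?x)))) \<le> \<bar>deriv (T j) y\<bar> * \<rho> ?x"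
    by (rule mult_left_mono) simp
  moreover have "(1 + d * min c (1 - c)) * \<rho> y \<le> (1 + d * min c (1 - c)) * (\<bar>deriv (T j) y\<bar> * (1 / (?x * (1 - ?x))))"
    using a d c0 c1 by (intro mult_left_mono) auto
  ultimately show ?thesis by (simp add: mult_ac)
qed

end

section \<open>Behaviour near the endpoints and near \<open>c\<close>\<close>

context good_bad_system begin

definition end_dist :: "real \<Rightarrow> real" where "end_dist x = min x (1 - x)"

lemma end_dist_X: "0 < end_dist x \<longleftrightarrow> x \<in> {0<..<1}"
  by (auto simp: end_dist_def)

text \<open>Differentiability at \<open>e\<close> comes from the Schwarzian condition on
  \<open>[0, c)\<close> or \<open>(c, 1]\<close>, the bound on the derivative refers to
  \<open>[0, 1]\<close>; near \<open>e\<close> these sets coincide.\<close>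

lemma repelling_endpoint:
  assumes j: "j \<in> {1..N}" and e: "e \<in> {0, 1}" and "0 < \<eta>"
  shows "\<exists>\<Lambda>>1. \<forall>\<^sub>F x in at e within {0..1}. \<Lambda> * \<bar>x - e\<bar> \<le> \<bar>T j x - T j e\<bar> \<and> \<bar>T j x - T j e\<bar> < \<eta>"
proof -
  have diff: "T j differentiable (at e within {0..1})"
  proof (cases "e = 0")
    case True
    have "T j differentiable (at 0 within {0..<c})"
      using map_facts(2)[OF j] c0 by (auto simp: nonpos_schwarzian_on_def times_differentiable_on_def differentiable_on_def
          dest!: spec[of _ 0])
    also have "at 0 within {0..<c} = at 0 within {0..1}"
      by (rule at_within_nhd[of _ "{..<c}"]) (use c0 c1 in auto)
    finally show ?thesis using True by simp
  next
    case False
    then have e1: "e = 1" using e by simp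
    have "T j differentiable (at 1 within {c<..1})"
      using map_facts(3)[OF j] c1 by (auto simp: nonpos_schwarzian_on_def times_differentiable_on_def differentiable_on_def
          dest!: spec[of _ 0])
    also have "at 1 within {c<..1} = at 1 within {0..1}"
      by (rule at_within_nhd[of _ "{c<..}"]) (use c0 c1 in auto)
    finally show ?thesis using e1 by simp
  qed
  define D where "D = deriv_within {0..1} (T j) e"
  have D: "(T j has_real_derivative D) (at e within {0..1})"
    using diff unfolding D_def deriv_within_def has_real_derivative_iff_has_vector_derivative
    by (simp add: vector_derivative_works)
  have D1: "1 < \<bar>D\<bar>" using map_facts(6,7)[OF j] e by (auto simp: D_def)
  define \<Lambda> where "\<Lambda> = (1 + \<bar>D\<bar>) / 2"
  have \<Lambda>: "1 < \<Lambda>" "\<Lambda> < \<bar>D\<bar>" using D1 by (auto simp: \<Lambda>_def)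
  have "((\<lambda>x. \<bar>(T j x - T j e) / (x - e)\<bar>) \<longlongrightarrow> \<bar>D\<bar>) (at e within {0..1})"
    using D by (intro tendsto_rabs) (simp add: has_field_derivative_iff)
  from order_tendstoD(1)[OF this \<Lambda>(2)]
  have ev1: "\<forall>\<^sub>F x in at e within {0..1}. \<Lambda> < \<bar>(T j x - T j e) / (x - e)\<bar>" .
  have "continuous (at e within {0..1}) (T j)" using D by (rule DERIV_continuous)
  then have "(T j \<longlongrightarrow> T j e) (at e within {0..1})" by (simp add: continuous_within)
  from tendstoD[OF this \<open>0 < \<eta>\<close>]
  have ev2: "\<forall>\<^sub>F x in at e within {0..1}. \<bar>T j x - T j e\<bar> < \<eta>" by (simp add: dist_real_def)
  have ev3: "\<forall>\<^sub>F x in at e within {0..1}. x \<noteq> e" by (simp add: eventually_at_filter)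
  have "\<forall>\<^sub>F x in at e within {0..1}. \<Lambda> * \<bar>x - e\<bar> \<le> \<bar>T j x - T j e\<bar> \<and> \<bar>T j x - T j e\<bar> < \<eta>"
    using ev1 ev2 ev3
  proof eventually_elim
    case (elim x)
    then have "\<Lambda> * \<bar>x - e\<bar> \<le> \<bar>T j x - T j e\<bar>" by (simp add: abs_divide field_simps)
    with elim show ?case by simp
  qed
  with \<Lambda> show ?thesis by blast
qed

text \<open>The image of an endpoint is an endpoint. Staying within \<eta> of it turns
  \<open>|T j x - T j e|\<close> into the end distance of \<open>T j x\<close> and keeps
  \<open>T j x\<close> at distance at least \<eta> from \<open>c\<close>.\<close>

lemma near_endpoints:
  assumes j: "j \<in> {1..N}"
  shows "\<exists>\<Lambda>>1. \<exists>\<delta>>0. \<forall>x. 0 < end_dist x \<longrightarrow> end_dist x < \<delta> \<longrightarrow>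
     T j x \<in> X \<and> min c (1 - c) / 2 \<le> \<bar>T j x - c\<bar> \<and> \<Lambda> * end_dist x \<le> end_dist (T j x)"
proof -
  define \<eta> where "\<eta> = min c (1 - c) / 2"
  have \<eta>: "0 < \<eta>" using c0 c1 by (auto simp: \<eta>_def)
  have one: "\<exists>\<Lambda>>1. \<exists>\<delta>>0. \<forall>x\<in>{0<..<1}. \<bar>x - e\<bar> < \<delta> \<longrightarrow>
     T j x \<in> X \<and> \<eta> \<le> \<bar>T j x - c\<bar> \<and> \<Lambda> * \<bar>x - e\<bar> \<le> end_dist (T j x)" if e: "e \<in> {0, 1}" for e
  proof -
    obtain \<Lambda> where \<Lambda>: "1 < \<Lambda>"
      and ev: "\<forall>\<^sub>F x in at e within {0..1}. \<Lambda> * \<bar>x - e\<bar> \<le> \<bar>T j x - T j e\<bar> \<and> \<bar>T j x - T j e\<bar> < \<eta>"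
      using repelling_endpoint[OF j e \<eta>] by blast
    obtain \<delta> where \<delta>: "0 < \<delta>" and near: "\<And>x. x \<in> {0..1} \<Longrightarrow> x \<noteq> e \<Longrightarrow> dist x e < \<delta> \<Longrightarrow>
        \<Lambda> * \<bar>x - e\<bar> \<le> \<bar>T j x - T j e\<bar> \<and> \<bar>T j x - T j e\<bar> < \<eta>"
      using ev unfolding eventually_at by blast
    have "T j x \<in> X \<and> \<eta> \<le> \<bar>T j x - c\<bar> \<and> \<Lambda> * \<bar>x - e\<bar> \<le> end_dist (T j x)"
      if x: "x \<in> {0<..<1}" "\<bar>x - e\<bar> < \<delta>" for x
    proof -
      have xe: "x \<noteq> e" using x e by auto
      note n = near[of x] 
      have n1: "\<Lambda> * \<bar>x - e\<bar> \<le> \<bar>T j x - T j e\<bar>" and n2: "\<bar>T j x - T j e\<bar> < \<eta>"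
        using n x xe by (auto simp: dist_real_def)
      have "0 < \<Lambda> * \<bar>x - e\<bar>" using xe \<Lambda> by simp
      then have ne: "0 < \<bar>T j x - T j e\<bar>" using n1 by linarith
      have Te: "T j e = 0 \<or> T j e = 1" using map_facts(4,5)[OF j] e by auto
      have "x \<in> {0..1}" using x by auto
      then have "T j x \<in> {0..1}" using map_facts(1)[OF j] by blast
      then have Tx: "0 \<le> T j x" "T j x \<le> 1" by auto
      have "\<bar>T j x - T j e\<bar> = end_dist (T j x) \<and> \<eta> \<le> \<bar>T j x - c\<bar> \<and> T j x \<in> {0<..<1}"
        using Te
      proof
        assume "T j e = 0"
        then show ?thesis using Tx n2 ne c0 c1 unfolding \<eta>_def end_dist_def by auto
      next
        assume "T j e = 1"
        then show ?thesis using Tx n2 ne c0 c1 unfolding \<eta>_def end_dist_def by auto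
      qed
      then show ?thesis using n1 \<eta> by (auto simp: X_def)
    qed
    with \<Lambda> \<delta> show ?thesis by blast
  qed
  obtain \<Lambda>0 \<delta>0 where 0: "1 < \<Lambda>0" "0 < \<delta>0" "\<And>x. x\<in>{0<..<1} \<Longrightarrow> \<bar>x - 0\<bar> < \<delta>0 \<Longrightarrow>
     T j x \<in> X \<and> \<eta> \<le> \<bar>T j x - c\<bar> \<and> \<Lambda>0 * \<bar>x - 0\<bar> \<le> end_dist (T j x)" using one[of 0] by auto
  obtain \<Lambda>1 \<delta>1 where 1: "1 < \<Lambda>1" "0 < \<delta>1" "\<And>x. x\<in>{0<..<1} \<Longrightarrow> \<bar>x - 1\<bar> < \<delta>1 \<Longrightarrow>
     T j x \<in> X \<and> \<eta> \<le> \<bar>T j x - c\<bar> \<and> \<Lambda>1 * \<bar>x - 1\<bar> \<le> end_dist (T j x)" using one[of 1] by auto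
  show ?thesis
  proof (intro exI conjI allI impI)
    show "1 < min \<Lambda>0 \<Lambda>1" using 0 1 by simp
    show "0 < min \<delta>0 \<delta>1" using 0 1 by simp
    fix x assume x: "0 < end_dist x" "end_dist x < min \<delta>0 \<delta>1"
    then have x01: "x \<in> {0<..<1}" by (simp add: end_dist_X)
    have *: "T j x \<in> X \<and> \<eta> \<le> \<bar>T j x - c\<bar> \<and> min \<Lambda>0 \<Lambda>1 * end_dist x \<le> end_dist (T j x)"
    proof (cases "x \<le> 1 - x")
      case True
      then have "end_dist x = \<bar>x - 0\<bar>" using x01 by (auto simp: end_dist_def)
      moreover have "min \<Lambda>0 \<Lambda>1 * end_dist x \<le> \<Lambda>0 * end_dist x" using x by (intro mult_right_mono) auto
      ultimately show ?thesis using 0(3)[OF x01] x by (smt (verit))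
    next
      case False
      then have "end_dist x = \<bar>x - 1\<bar>" using x01 by (auto simp: end_dist_def)
      moreover have "min \<Lambda>0 \<Lambda>1 * end_dist x \<le> \<Lambda>1 * end_dist x" using x by (intro mult_right_mono) auto
      ultimately show ?thesis using 1(3)[OF x01] x by (smt (verit))
    qed
    then show "T j x \<in> X" "min c (1 - c) / 2 \<le> \<bar>T j x - c\<bar>" "min \<Lambda>0 \<Lambda>1 * end_dist x \<le> end_dist (T j x)"
      by (auto simp: \<eta>_def)
  qed
qed

lemma T_monotone:
  assumes j: "j \<in> {1..N}"
  shows "strict_mono_on (side b) (T j) \<or> (\<forall>x\<in>side b. \<forall>y\<in>side b. x < y \<longrightarrow> T j y < T j x)"
proof -
  have "inj_on (T j) (side b)" using branch_range[OF j, of b] by (auto simp: bij_betw_def)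
  then have "strict_mono_on (side b) (T j) \<or> strict_antimono_on (side b) (T j)"
    using injective_eq_monotone_map[OF _ T_cont[OF j, of b]] is_interval_oo by blast
  then show ?thesis by (auto simp: monotone_on_def)
qed

text \<open>Monotonicity replaces one-sided limits at \<open>c\<close>: a point closer to
  \<open>c\<close> than the preimages \<open>u\<close> of \<open>e\<close> and \<open>v\<close> of
  \<open>1 - e\<close> lies beyond both, so its value falls outside
  \<open>[e, 1 - e]\<close>.\<close>

lemma good_near_critical:
  assumes j: "j \<in> good" and "0 < \<epsilon>"
  shows "\<exists>\<delta>>0. \<forall>x\<in>X. \<bar>x - c\<bar> < \<delta> \<longrightarrow> end_dist (T j x) < \<epsilon>"
proof -
  have jN: "j \<in> {1..N}" using j good_subset by auto
  have one: "\<exists>\<delta>>0. \<forall>x\<in>side b. \<bar>x - c\<bar> < \<delta> \<longrightarrow> end_dist (T j x) < \<epsilon>" for b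
  proof -
    have r: "rlo j b = 0" "rhi j b = 1" using branch_range[OF jN, of b] j by auto
    define e where "e = min \<epsilon> 1 / 2"
    have e: "0 < e" "e < \<epsilon>" "e < 1" "1 - e \<in> rng j b" "e \<in> rng j b"
      using \<open>0 < \<epsilon>\<close> unfolding r by (auto simp: e_def min_def)
    define u v where "u = \<psi> j b e" and "v = \<psi> j b (1 - e)"
    have uv: "u \<in> side b" "v \<in> side b" "T j u = e" "T j v = 1 - e"
      unfolding u_def v_def using psi_inverse(1,2)[OF jN] e by auto
    define \<delta> where "\<delta> = min \<bar>u - c\<bar> \<bar>v - c\<bar>"
    have "0 < \<delta>" using uv by (auto simp: \<delta>_def lo_def hi_def split: if_splits)
    have "end_dist (T j x) < \<epsilon>" if x: "x \<in> side b" "\<bar>x - c\<bar> < \<delta>" for x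
    proof -
      have *: "(u < x \<and> v < x) \<or> (x < u \<and> x < v)"
        using x uv unfolding \<delta>_def by (cases b) (auto simp: lo_def hi_def)
      then have "T j x < e \<or> 1 - e < T j x"
        using T_monotone[OF jN, of b]
      proof (elim disjE conjE, goal_cases)
        case 1 then show ?case using uv x by (metis strict_mono_onD)
      next case 2 then show ?case using uv x by metis
      next case 3 then show ?case using uv x by (metis strict_mono_onD)
      next case 4 then show ?case using uv x by metis
      qed
      then show ?thesis using e by (auto simp: end_dist_def)
    qed
    with \<open>0 < \<delta>\<close> show ?thesis by blast
  qed
  obtain d0 d1 where "0 < d0" "0 < d1" "\<forall>x\<in>side False. \<bar>x - c\<bar> < d0 \<longrightarrow> end_dist (T j x) < \<epsilon>"
    "\<forall>x\<in>side True. \<bar>x - c\<bar> < d1 \<longrightarrow> end_dist (T j x) < \<epsilon>" using one by meson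
  then show ?thesis by (intro exI[of _ "min d0 d1"]) (auto simp: X_side(1))
qed

text \<open>The order of choice matters: \<delta> comes from the repulsion at the ends, then
  \<delta>' is taken so small that good maps send the \<delta>'-neighbourhood of \<open>c\<close>
  into the \<delta>-neighbourhood of the ends. The factor 1/4 keeps these neighbourhoods apart and
  leaves room for a set between them.\<close>

lemma trapping_constants_exist:
  obtains \<delta> \<delta>' \<Lambda> where "0 < \<delta>" "0 < \<delta>'" "1 < \<Lambda>"
    "\<delta> \<le> min c (1 - c) / 4" "\<delta>' \<le> min c (1 - c) / 4"
    "\<And>j x. j \<in> {1..N} \<Longrightarrow> 0 < end_dist x \<Longrightarrow> end_dist x < \<delta> \<Longrightarrow>
       T j x \<in> X \<and> \<delta>' \<le> \<bar>T j x - c\<bar> \<and> \<Lambda> * end_dist x \<le> end_dist (T j x)"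
    "\<And>j x. j \<in> good \<Longrightarrow> x \<in> X \<Longrightarrow> \<bar>x - c\<bar> < \<delta>' \<Longrightarrow> T j x \<in> X \<and> \<delta>' \<le> \<bar>T j x - c\<bar>"
proof -
  have ex: "\<exists>\<Lambda> \<delta>. 1 < \<Lambda> \<and> 0 < \<delta> \<and> (\<forall>x. 0 < end_dist x \<longrightarrow> end_dist x < \<delta> \<longrightarrow>
     T j x \<in> X \<and> min c (1 - c) / 2 \<le> \<bar>T j x - c\<bar> \<and> \<Lambda> * end_dist x \<le> end_dist (T j x))" if "j \<in> {1..N}" for j
    using near_endpoints[OF that] by blast
  obtain L D where LD: "\<And>j. j \<in> {1..N} \<Longrightarrow> 1 < L j \<and> 0 < D j \<and> (\<forall>x. 0 < end_dist x \<longrightarrow> end_dist x < D j \<longrightarrow>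
     T j x \<in> X \<and> min c (1 - c) / 2 \<le> \<bar>T j x - c\<bar> \<and> L j * end_dist x \<le> end_dist (T j x))"
    using ex by metis
  have ne: "{1..N} \<noteq> {}" using good_subset by blast
  define \<Lambda> \<delta> where "\<Lambda> = Min (L ` {1..N})" and "\<delta> = min (min c (1 - c) / 4) (Min (D ` {1..N}))"
  have \<Lambda>: "1 < \<Lambda>" "\<And>j. j \<in> {1..N} \<Longrightarrow> \<Lambda> \<le> L j"
    unfolding \<Lambda>_def using LD ne by (auto simp: Min_gr_iff)
  have \<delta>: "0 < \<delta>" "\<And>j. j \<in> {1..N} \<Longrightarrow> \<delta> \<le> D j" 
    unfolding \<delta>_def using LD ne c0 c1 by (auto simp: Min_gr_iff min.coboundedI2)
  have \<delta>3: "\<delta> \<le> min c (1 - c) / 4" unfolding \<delta>_def by (rule min.cobounded1)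
  have fin: "finite good" using good_subset finite_subset by blast
  obtain C where C: "\<And>j. j \<in> good \<Longrightarrow> 0 < C j \<and> (\<forall>x\<in>X. \<bar>x - c\<bar> < C j \<longrightarrow> end_dist (T j x) < \<delta>)"
    using good_near_critical[OF _ \<delta>(1)] by metis
  define \<delta>' where "\<delta>' = min (min c (1 - c) / 4) (Min (C ` good))"
  have \<delta>'3: "\<delta>' \<le> min c (1 - c) / 4" unfolding \<delta>'_def by (rule min.cobounded1)
  have \<delta>': "0 < \<delta>'" "\<And>j. j \<in> good \<Longrightarrow> \<delta>' \<le> C j"
    unfolding \<delta>'_def using C fin good_subset c0 c1 by (auto simp: Min_gr_iff min.coboundedI2)
  show thesis
  proof (rule that[OF \<delta>(1) \<delta>'(1) \<Lambda>(1) \<delta>3 \<delta>'3])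
    fix j x assume j: "j \<in> {1..N}" and x: "0 < end_dist x" "end_dist x < \<delta>"
    have "T j x \<in> X \<and> min c (1 - c) / 2 \<le> \<bar>T j x - c\<bar> \<and> L j * end_dist x \<le> end_dist (T j x)"
      using LD[OF j] x \<delta>(2)[OF j] by auto
    moreover have "\<Lambda> * end_dist x \<le> L j * end_dist x" using \<Lambda>(2)[OF j] x by (intro mult_right_mono) auto
    ultimately show "T j x \<in> X \<and> \<delta>' \<le> \<bar>T j x - c\<bar> \<and> \<Lambda> * end_dist x \<le> end_dist (T j x)"
      using \<delta>'3 c0 c1 by linarith
  next
    fix j x assume j: "j \<in> good" and x: "x \<in> X" "\<bar>x - c\<bar> < \<delta>'"
    then have d: "end_dist (T j x) < \<delta>" using C[OF j] \<delta>'(2)[OF j] by auto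
    have "T j x \<in> {0<..<1}" using T_in_unit j x good_subset by blast
    moreover have "\<delta>' \<le> \<bar>T j x - c\<bar>" using d \<delta>3 \<delta>'3 by (auto simp: end_dist_def)
    ultimately show "T j x \<in> X \<and> \<delta>' \<le> \<bar>T j x - c\<bar>" using \<delta>'(1) by (auto simp: X_def)
  qed
qed

text \<open>A branch of a bad map sends its outer endpoint into \<open>{0, 1}\<close>, hence to the outer endpoint of its image;
  being monotone it then maps points closer to \<open>c\<close> to points closer to \<open>c\<close>.\<close>

lemma bad_toward:
  assumes j: "j \<in> {1..N}" "j \<notin> good" and y: "y \<in> side b" and z: "z \<in> side b" and zy: "\<bar>z - c\<bar> < \<bar>y - c\<bar>"
  shows "\<bar>T j z - c\<bar> < \<bar>T j y - c\<bar>"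
proof (rule ccontr)
  assume contra: "\<not> \<bar>T j z - c\<bar> < \<bar>T j y - c\<bar>"
  obtain i where i: "rlo j b = lo i" "rhi j b = hi i" using branch_range[OF j(1), of b] j(2) by auto
  have Ti: "T j u \<in> side i" if "u \<in> side b" for u using psi_inverse(3)[OF j(1) that] i by simp
  define e where "e = (if b then 1 else (0::real))"
  define e' where "e' = (if i then 1 else (0::real))"
  \<comment> \<open>If the images of \<open>y\<close> and \<open>z\<close> were in the wrong order,
    monotonicity would keep the images of all points beyond \<open>y\<close> no farther from
    \<open>c\<close> than \<open>T j y\<close>, although they approach the outer end
    \<open>e'\<close> of the range.\<close>
  have away: "\<bar>T j u - c\<bar> \<le> \<bar>T j y - c\<bar>" if u: "u \<in> side b" "\<bar>y - c\<bar> < \<bar>u - c\<bar>" for u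
    using T_monotone[OF j(1), of b]
  proof
    assume m: "strict_mono_on (side b) (T j)"
    have m': "T j v < T j w" if "v \<in> side b" "w \<in> side b" "v < w" for v w
      using strict_mono_onD[OF m that] .
    show ?thesis
      using m'[of y u] m'[of u y] m'[of y z] m'[of z y] u y z zy contra Ti[OF u(1)] Ti[OF y] Ti[OF z]
      by (cases b; cases i) (auto simp: lo_def hi_def)
  next
    assume m: "\<forall>x\<in>side b. \<forall>y\<in>side b. x < y \<longrightarrow> T j y < T j x"
    have m': "T j w < T j v" if "v \<in> side b" "w \<in> side b" "v < w" for v w
      using m that by blast
    show ?thesis
      using m'[of y u] m'[of u y] m'[of y z] m'[of z y] u y z zy contra Ti[OF u(1)] Ti[OF y] Ti[OF z]
      by (cases b; cases i) (auto simp: lo_def hi_def)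
  qed
  have e01: "e \<in> {0, 1}" by (simp add: e_def)
  have Te: "T j e = 0 \<or> T j e = 1" using map_facts(4,5)[OF j(1)] e01 by auto
  \<comment> \<open>The first term puts \<open>T j u\<close> farther from \<open>c\<close> than
    \<open>T j y\<close> when \<open>T j e = e'\<close>; the second excludes that
    \<open>T j e\<close> is the other endpoint.\<close>
  define \<eta> where "\<eta> = min (\<bar>e' - c\<bar> - \<bar>T j y - c\<bar>) (min c (1 - c))"
  have \<eta>: "0 < \<eta>" using Ti[OF y] c0 c1 by (auto simp: \<eta>_def e'_def lo_def hi_def split: if_splits)
  have "\<forall>\<^sub>F x in at e within {0..1}. \<bar>T j x - T j e\<bar> < \<eta>"
    using repelling_endpoint[OF j(1) e01 \<eta>] by (auto elim: eventually_mono)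
  then obtain \<delta> where \<delta>: "0 < \<delta>" "\<And>x. x \<in> {0..1} \<Longrightarrow> x \<noteq> e \<Longrightarrow> dist x e < \<delta> \<Longrightarrow> \<bar>T j x - T j e\<bar> < \<eta>"
    unfolding eventually_at by blast
  define t where "t = min \<delta> \<bar>y - e\<bar> / 2"
  define u where "u = (if b then 1 - t else t)"
  have t: "0 < t" "t < \<delta>" "t < \<bar>y - e\<bar>" using \<delta> y by (auto simp: t_def e_def lo_def hi_def min_def split: if_splits)
  have u: "u \<in> side b" "\<bar>y - c\<bar> < \<bar>u - c\<bar>" "u \<in> {0..1}" "u \<noteq> e" "dist u e < \<delta>"
    using t y c0 c1 by (auto simp: u_def e_def lo_def hi_def dist_real_def split: if_splits)
  have "\<bar>T j u - T j e\<bar> < \<eta>" by (rule \<delta>(2)[OF u(3-5)])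
  then show False using away[OF u(1,2)] Ti[OF u(1)] Te c0 c1
    unfolding \<eta>_def e'_def by (cases i) (auto simp: lo_def hi_def)
qed

end

section \<open>The transfer operator and recurrence\<close>

lemma sum_bool: "(\<Sum>b\<in>UNIV. g b) = g False + g True"
  for g :: "bool \<Rightarrow> 'a::comm_monoid_add"
  by (simp add: UNIV_bool add.commute)

context good_bad_system begin

text \<open>The weight \<open>wt j b\<close> vanishes outside \<open>rng j b\<close>, where \<open>\<psi> j b\<close> is junk; \<open>\<psi>0\<close> makes the branch Borel measurable on the whole line.\<close>

definition \<psi>0 :: "nat \<Rightarrow> bool \<Rightarrow> real \<Rightarrow> real" where
  "\<psi>0 j b x = indicator (rng j b) x *\<^sub>R \<psi> j b x"

text \<open>The averaged Perron-Frobenius operator. Values in \<open>ennreal\<close> avoid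
  integrability conditions and admit the divergent sum \<open>G\<close>.\<close>

definition P :: "(real \<Rightarrow> ennreal) \<Rightarrow> real \<Rightarrow> ennreal" where
  "P f x = (\<Sum>j\<in>{1..N}. \<Sum>b\<in>UNIV. ennreal (p j * wt j b x) * f (\<psi>0 j b x))"

text \<open>The Koopman (Markov) operator of the random map, dual to \<open>P\<close>.\<close>

definition U :: "(real \<Rightarrow> ennreal) \<Rightarrow> real \<Rightarrow> ennreal" where
  "U u y = (\<Sum>j\<in>{1..N}. ennreal (p j) * u (T j y))"

definition L :: "real measure" where "L = lebesgue01"

lemma space_L [simp]: "space L = {0..1}" by (simp add: L_def space_restrict_space)

lemma sets_L: "A \<in> sets L \<longleftrightarrow> A \<subseteq> {0..1} \<and> A \<in> sets borel"
  by (auto simp add: L_def sets_restrict_space_iff)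

lemma measurable_L_borel: "f \<in> measurable borel M \<Longrightarrow> f \<in> measurable L M"
  by (simp add: L_def measurable_restrict_space1)

lemma emeasure_L: "A \<in> sets L \<Longrightarrow> emeasure L A = emeasure lborel A"
  unfolding sets_L unfolding L_def by (rule emeasure_restrict_space) auto

lemma nn_integral_L: "(\<integral>\<^sup>+x. f x \<partial>L) = (\<integral>\<^sup>+x. f x * indicator {0..1} x \<partial>lborel)"
  unfolding L_def by (rule nn_integral_restrict_space) simp

lemma measurable_into_L: "f \<in> borel_measurable M \<Longrightarrow> f \<in> space M \<rightarrow> {0..1} \<Longrightarrow> f \<in> measurable M L"
  unfolding L_def by (rule measurable_restrict_space2) auto

lemma finite_L: "finite_measure L"
  by (rule finite_measureI) (simp add: emeasure_L sets_L)

lemma AE_X: "AE x in L. x \<in> X"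
proof -
  have "AE x in lborel. x \<noteq> 0 \<and> x \<noteq> c \<and> x \<noteq> (1::real)"
    by (intro AE_conjI AE_lborel_singleton)
  then show ?thesis unfolding L_def by (subst AE_restrict_space_iff) (auto simp: X_def elim!: AE_mp)
qed

lemma psi0_eq: "x \<in> rng j b \<Longrightarrow> \<psi>0 j b x = \<psi> j b x"
  by (simp add: \<psi>0_def)

lemma wt_measurable_borel: "j \<in> {1..N} \<Longrightarrow> wt j b \<in> borel_measurable borel"
proof -
  assume "j \<in> {1..N}"
  then have "(\<lambda>x. indicator (rng j b) x *\<^sub>R wt j b x) \<in> borel_measurable borel"
    by (intro borel_measurable_continuous_on_indicator wt_cont) auto
  also have "(\<lambda>x. indicator (rng j b) x *\<^sub>R wt j b x) = wt j b" by (auto simp: wt_def fun_eq_iff)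
  finally show ?thesis .
qed

lemma wt_measurable [measurable]: "j \<in> {1..N} \<Longrightarrow> wt j b \<in> borel_measurable L"
  by (rule measurable_L_borel[OF wt_measurable_borel])

lemma psi0_measurable: "j \<in> {1..N} \<Longrightarrow> \<psi>0 j b \<in> borel_measurable borel"
  unfolding \<psi>0_def[abs_def]
  by (rule borel_measurable_continuous_on_indicator)
    (auto intro!: continuous_at_imp_continuous_on psi_isCont)

lemma psi0_unit: "j \<in> {1..N} \<Longrightarrow> \<psi>0 j b x \<in> {0..1}"
  using psi_inverse(1)[of j x b] side_bounds(2,3)[of b] by (auto simp: \<psi>0_def indicator_def)

lemma psi0_measurable_L [measurable]: "j \<in> {1..N} \<Longrightarrow> \<psi>0 j b \<in> measurable L L"
  using psi0_measurable[of j b] psi0_unit[of j b]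
  by (intro measurable_into_L) (auto simp: measurable_L_borel)

lemma T_measurable_L [measurable]:
  assumes j: "j \<in> {1..N}"
  shows "T j \<in> measurable L L"
proof (rule measurable_into_L)
  show "T j \<in> space L \<rightarrow> {0..1}" using map_facts(1)[OF j] by auto
  have m: "(\<lambda>x. indicator (side b) x *\<^sub>R T j x) \<in> borel_measurable borel" for b
    by (rule borel_measurable_continuous_on_indicator) (auto intro!: T_cont j)
  have "(\<lambda>x. indicator (side False) x *\<^sub>R T j x + indicator (side True) x *\<^sub>R T j x
      + (if x = 0 then T j 0 else 0) + (if x = c then T j c else 0) + (if x = 1 then T j 1 else 0))
      \<in> borel_measurable borel"
    by (intro borel_measurable_add m) auto
  then have "(\<lambda>x. indicator (side False) x *\<^sub>R T j x + indicator (side True) x *\<^sub>R T j x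
      + (if x = 0 then T j 0 else 0) + (if x = c then T j c else 0) + (if x = 1 then T j 1 else 0))
      \<in> borel_measurable L" by (simp add: measurable_L_borel)
  then show "T j \<in> borel_measurable L"
    by (rule measurable_cong[THEN iffD1, rotated])
      (use c0 c1 in \<open>auto simp: lo_def hi_def indicator_def\<close>)
qed

lemma P_measurable [measurable]:
  assumes [measurable]: "f \<in> borel_measurable L"
  shows "P f \<in> borel_measurable L"
  unfolding P_def[abs_def] by measurable

lemma U_measurable [measurable]:
  assumes [measurable]: "u \<in> borel_measurable L"
  shows "U u \<in> borel_measurable L"
  unfolding U_def[abs_def] by measurable

lemma P_add: "P (\<lambda>x. f x + g x) x = P f x + P g x"
  by (simp add: P_def distrib_left sum.distrib)

lemma P_cmult: "P (\<lambda>x. k * f x) x = k * P f x"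
  by (simp add: P_def sum_distrib_left mult_ac)

lemma P_suminf: "P (\<lambda>x. \<Sum>n. f n x) x = (\<Sum>n. P (f n) x)"
  by (simp add: P_def suminf_sum[OF summableI])

lemma nn_integral_side:
  assumes f: "f \<in> borel_measurable L"
  shows "(\<integral>\<^sup>+y. f y * indicator (side b) y \<partial>L) = (\<integral>\<^sup>+y. f y * indicator (side b) y \<partial>lborel)"
  using side_bounds(2,3)[of b] unfolding nn_integral_L by (auto intro!: nn_integral_cong split: split_indicator)

lemma nn_integral_sides:
  assumes f[measurable]: "f \<in> borel_measurable L"
  shows "(\<Sum>b\<in>UNIV. \<integral>\<^sup>+y. f y * indicator (side b) y \<partial>L) = (\<integral>\<^sup>+y. f y \<partial>L)"
proof -
  have s[measurable]: "side b \<in> sets L" for b using side_bounds(2,3)[of b] by (auto simp: sets_L)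
  have "(\<Sum>b\<in>UNIV. \<integral>\<^sup>+y. f y * indicator (side b) y \<partial>L) = (\<integral>\<^sup>+y. (\<Sum>b\<in>UNIV. f y * indicator (side b) y) \<partial>L)"
    by (rule nn_integral_sum[symmetric]) auto
  also have "\<dots> = (\<integral>\<^sup>+y. f y \<partial>L)"
  proof (rule nn_integral_cong_AE)
    show "AE y in L. (\<Sum>b\<in>UNIV. f y * indicator (side b) y) = f y"
      using AE_X
    proof eventually_elim
      case (elim y)
      have "(\<Sum>b\<in>UNIV. f y * indicator (side b) y) = f y * indicator (side False) y + f y * indicator (side True) y"
        by (rule sum_bool)
      then show ?case using elim c0 c1 by (auto simp: X_side(1) lo_def hi_def split: split_indicator)
    qed
  qed
  finally show ?thesis .
qed

text \<open>Change of variables on each branch separately; the domains of the two branches of a map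
  fill \<open>[0, 1]\<close> up to the null set of 0, \<open>c\<close> and 1.\<close>

lemma P_U_duality:
  assumes f[measurable]: "f \<in> borel_measurable L" and u[measurable]: "u \<in> borel_measurable L"
  shows "(\<integral>\<^sup>+x. P f x * u x \<partial>L) = (\<integral>\<^sup>+y. f y * U u y \<partial>L)"
proof -
  have one: "(\<integral>\<^sup>+x. ennreal (p j * wt j b x) * f (\<psi>0 j b x) * u x \<partial>L)
     = (\<integral>\<^sup>+y. (f y * (ennreal (p j) * u (T j y))) * indicator (side b) y \<partial>L)" if j[measurable]: "j \<in> {1..N}" for j b
  proof -
    obtain d where d: "\<And>x. x \<in> rng j b \<Longrightarrow> (\<psi> j b has_real_derivative d x) (at x)"
      "\<And>x. x \<in> rng j b \<Longrightarrow> \<bar>d x\<bar> = wt j b x"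
    proof -
      have "\<forall>x\<in>rng j b. \<exists>d. (\<psi> j b has_real_derivative d) (at x) \<and> \<bar>d\<bar> = wt j b x"
        using psi_has_derivative[OF j] by blast
      from bchoice[OF this] show thesis using that by blast
    qed
    \<comment> \<open>The change of variables works on the whole line, while \<open>f\<close> and
      \<open>u\<close> are measurable only on \<open>[0, 1]\<close>; extension by 0 bridges the
      two.\<close>
    define F where "F = (\<lambda>x. if x \<in> {0..1} then f (\<psi>0 j b x) * u x else 0)"
    have F: "F \<in> borel_measurable borel"
    proof -
      have "(\<lambda>x. f (\<psi>0 j b x) * u x) \<in> borel_measurable L" by measurable
      then show ?thesis unfolding F_def L_def
        by (subst (asm) measurable_restrict_space_iff[where c=0]) auto
    qed
    have "(\<integral>\<^sup>+x. ennreal (p j * wt j b x) * f (\<psi>0 j b x) * u x \<partial>L) = (\<integral>\<^sup>+x. ennreal (p j) * (ennreal (wt j b x) * f (\<psi>0 j b x) * u x) \<partial>L)"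
      using p_pos[OF j] wt_nonneg by (simp add: ennreal_mult mult_ac)
    also have "\<dots> = ennreal (p j) * (\<integral>\<^sup>+x. ennreal (wt j b x) * f (\<psi>0 j b x) * u x \<partial>L)"
      by (rule nn_integral_cmult) measurable
    also have "(\<integral>\<^sup>+x. ennreal (wt j b x) * f (\<psi>0 j b x) * u x \<partial>L) = (\<integral>\<^sup>+x. F x * ennreal \<bar>d x\<bar> * indicator (rng j b) x \<partial>lborel)"
      unfolding nn_integral_L using d(2) rng_cases(2)[OF j, of b]
      by (intro nn_integral_cong) (auto simp: F_def wt_def mult_ac subset_iff split: split_indicator)
    also have "\<dots> = (\<integral>\<^sup>+y. F (T j y) * indicator (side b) y \<partial>lborel)"
    proof (rule nn_integral_branch[symmetric, where \<psi>="\<psi> j b"])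
      show "bij_betw (T j) (side b) (rng j b)" using branch_range[OF j] by blast
      show "continuous_on (rng j b) (\<lambda>x. \<bar>d x\<bar>)"
        by (rule continuous_on_eq[OF wt_cont[OF j]]) (simp add: d(2))
    qed (use psi_inverse(1,2)[OF j] d F T_cont[OF j] in blast)+
    also have "\<dots> = (\<integral>\<^sup>+y. (f y * u (T j y)) * indicator (side b) y \<partial>lborel)"
    proof (intro nn_integral_cong)
      fix y
      show "F (T j y) * indicator (side b) y = (f y * u (T j y)) * indicator (side b) y"
        using psi_inverse(3,4)[OF j, of y b] rng_cases(2)[OF j, of b]
        by (auto simp: F_def \<psi>0_def subset_iff split: split_indicator)
    qed
    also have "\<dots> = (\<integral>\<^sup>+y. (f y * u (T j y)) * indicator (side b) y \<partial>L)"
      by (rule nn_integral_side[symmetric]) measurable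
    also have "ennreal (p j) * \<dots> = (\<integral>\<^sup>+y. ennreal (p j) * ((f y * u (T j y)) * indicator (side b) y) \<partial>L)"
    proof -
      have [measurable]: "side b \<in> sets L" using side_bounds(2,3)[of b] by (auto simp: sets_L)
      show ?thesis by (rule nn_integral_cmult[symmetric]) measurable
    qed
    finally show ?thesis by (simp add: mult_ac)
  qed
  have "(\<integral>\<^sup>+x. P f x * u x \<partial>L) = (\<integral>\<^sup>+x. (\<Sum>j\<in>{1..N}. \<Sum>b\<in>UNIV. ennreal (p j * wt j b x) * f (\<psi>0 j b x) * u x) \<partial>L)"
    by (simp add: P_def sum_distrib_right)
  also have "\<dots> = (\<Sum>j\<in>{1..N}. \<integral>\<^sup>+x. (\<Sum>b\<in>UNIV. ennreal (p j * wt j b x) * f (\<psi>0 j b x) * u x) \<partial>L)"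
    by (rule nn_integral_sum) measurable
  also have "\<dots> = (\<Sum>j\<in>{1..N}. \<Sum>b\<in>UNIV. \<integral>\<^sup>+x. ennreal (p j * wt j b x) * f (\<psi>0 j b x) * u x \<partial>L)"
    by (intro sum.cong refl nn_integral_sum) measurable
  also have "\<dots> = (\<Sum>j\<in>{1..N}. \<integral>\<^sup>+y. f y * (ennreal (p j) * u (T j y)) \<partial>L)"
  proof (rule sum.cong[OF refl])
    fix j assume j[measurable]: "j \<in> {1..N}"
    show "(\<Sum>b\<in>UNIV. \<integral>\<^sup>+x. ennreal (p j * wt j b x) * f (\<psi>0 j b x) * u x \<partial>L) = (\<integral>\<^sup>+y. f y * (ennreal (p j) * u (T j y)) \<partial>L)"
      unfolding one[OF j] by (rule nn_integral_sides) measurable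
  qed
  also have "\<dots> = (\<integral>\<^sup>+y. (\<Sum>j\<in>{1..N}. f y * (ennreal (p j) * u (T j y))) \<partial>L)"
    by (rule nn_integral_sum[symmetric]) measurable
  finally show ?thesis by (simp add: U_def sum_distrib_left)
qed

lemma sum_p_ennreal: "(\<Sum>j\<in>{1..N}. ennreal (p j)) = 1"
  using p_pos p_sum by (subst sum_ennreal) (auto intro: less_imp_le)

lemma U_const: "U (\<lambda>_. k) y = k"
  using sum_p_ennreal by (simp add: U_def sum_distrib_right[symmetric])

lemma nn_integral_P:
  assumes "f \<in> borel_measurable L"
  shows "(\<integral>\<^sup>+x. P f x \<partial>L) = (\<integral>\<^sup>+x. f x \<partial>L)"
  using P_U_duality[OF assms, of "\<lambda>_. 1"] by (simp add: U_const)

text \<open>Nonsingularity of every \<open>T j\<close>: by duality the integral of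
  \<open>U (indicator Z)\<close> is that of \<open>P 1\<close> over the null set
  \<open>Z\<close>.\<close>

lemma AE_T:
  assumes "AE y in L. Q y"
  shows "AE y in L. \<forall>j\<in>{1..N}. Q (T j y)"
proof -
  obtain Z where Z: "{y \<in> space L. \<not> Q y} \<subseteq> Z" "Z \<in> sets L" "emeasure L Z = 0"
    using assms by (auto elim!: AE_E)
  note Z(2)[measurable]
  have "(\<integral>\<^sup>+y. U (indicator Z) y \<partial>L) = (\<integral>\<^sup>+x. P (\<lambda>_. 1) x * indicator Z x \<partial>L)"
    using P_U_duality[of "\<lambda>_. 1" "indicator Z"] by simp
  also have "\<dots> = 0"
    using Z by (subst nn_integral_0_iff_AE) (auto intro!: AE_I'[of Z] simp: null_sets_def split: split_indicator)
  finally have "AE y in L. U (indicator Z) y = 0"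
    by (subst (asm) nn_integral_0_iff_AE) measurable
  then show ?thesis using AE_space
  proof eventually_elim
    case (elim y)
    show ?case
    proof
      fix j assume j: "j \<in> {1..N}"
      have "ennreal (p j) = 0" if "T j y \<in> Z"
        using elim(1) j that by (auto simp: U_def)
      then have "T j y \<notin> Z" using p_pos[OF j] by auto
      moreover have "T j y \<in> space L" using measurable_space[OF T_measurable_L[OF j] elim(2)] .
      ultimately show "Q (T j y)" using Z(1) by auto
    qed
  qed
qed

text \<open>Nonsingularity of the inverse branches: \<open>P\<close> preserves integrals, so
  \<open>P (indicator Z)\<close> vanishes almost everywhere, and all weights are positive on their
  ranges.\<close>

lemma AE_psi:
  assumes "AE y in L. Q y"
  shows "AE x in L. \<forall>j\<in>{1..N}. \<forall>b. x \<in> rng j b \<longrightarrow> Q (\<psi>0 j b x)"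
proof -
  obtain Z where Z: "{y \<in> space L. \<not> Q y} \<subseteq> Z" "Z \<in> sets L" "emeasure L Z = 0"
    using assms by (auto elim!: AE_E)
  note Z(2)[measurable]
  have "(\<integral>\<^sup>+x. P (indicator Z) x \<partial>L) = 0" using Z by (subst nn_integral_P) auto
  then have "AE x in L. P (indicator Z) x = 0"
    by (subst (asm) nn_integral_0_iff_AE) measurable
  then show ?thesis
  proof eventually_elim
    case (elim x)
    show ?case
    proof (intro ballI allI impI)
      fix j b assume j: "j \<in> {1..N}" and x: "x \<in> rng j b"
      have "0 < p j * wt j b x" using p_pos[OF j] wt_pos[OF j x] by simp
      moreover have "ennreal (p j * wt j b x) = 0" if "\<psi>0 j b x \<in> Z"
        using elim j that by (auto simp: P_def)
      ultimately have "\<psi>0 j b x \<notin> Z" by auto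
      moreover have "\<psi>0 j b x \<in> space L" using psi0_unit[OF j] by simp
      ultimately show "Q (\<psi>0 j b x)" using Z(1) by auto
    qed
  qed
qed

lemma P_mono_AE:
  assumes "AE x in L. f x \<le> g x"
  shows "AE x in L. P f x \<le> P g x"
  using AE_psi[OF assms]
proof eventually_elim
  case (elim x)
  show ?case unfolding P_def
  proof (intro sum_mono)
    fix j b assume "j \<in> {1..N}"
    then show "ennreal (p j * wt j b x) * f (\<psi>0 j b x) \<le> ennreal (p j * wt j b x) * g (\<psi>0 j b x)"
      using elim by (cases "x \<in> rng j b") (auto intro!: mult_left_mono simp: wt_def)
  qed
qed

end

section \<open>Recurrence to the core \<open>K\<close>\<close>

locale trapped_system = good_bad_system +
  fixes \<delta> \<delta>' \<Lambda> :: real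
  assumes trap_pos: "0 < \<delta>" "0 < \<delta>'" "1 < \<Lambda>"
    and trap_small: "\<delta> \<le> min c (1 - c) / 4" "\<delta>' \<le> min c (1 - c) / 4"
    and trap_end: "\<And>j x. j \<in> {1..N} \<Longrightarrow> 0 < end_dist x \<Longrightarrow> end_dist x < \<delta> \<Longrightarrow>
       T j x \<in> X \<and> \<delta>' \<le> \<bar>T j x - c\<bar> \<and> \<Lambda> * end_dist x \<le> end_dist (T j x)"
    and trap_crit: "\<And>j x. j \<in> good \<Longrightarrow> x \<in> X \<Longrightarrow> \<bar>x - c\<bar> < \<delta>' \<Longrightarrow> T j x \<in> X \<and> \<delta>' \<le> \<bar>T j x - c\<bar>"
begin

definition K :: "real set" where "K = {x. \<delta> \<le> end_dist x \<and> \<delta>' \<le> \<bar>x - c\<bar>}"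

lemma K_sub: "K \<subseteq> X" "K \<subseteq> {0..1}"
  using trap_pos by (auto simp: K_def X_def end_dist_def)

lemma K_sets [measurable]: "K \<in> sets L"
proof -
  have "K \<in> sets borel" unfolding K_def end_dist_def by measurable
  then show ?thesis using K_sub by (simp add: sets_L)
qed

lemma K_side: "x \<in> K \<Longrightarrow> x \<in> side b \<Longrightarrow> lo b + min \<delta> \<delta>' \<le> x \<and> x \<le> hi b - min \<delta> \<delta>'"
  by (cases b) (auto simp: K_def end_dist_def lo_def hi_def)

lemma K_pos: "0 < emeasure L K"
proof -
  have sub: "{c / 4..3 * c / 4} \<subseteq> K"
    using trap_small c0 c1 by (auto simp: K_def end_dist_def)
  have "0 < emeasure lborel {c / 4..3 * c / 4}" using c0 by simp
  also have "\<dots> = emeasure L {c / 4..3 * c / 4}" using c0 c1 by (intro emeasure_L[symmetric]) (auto simp: sets_L)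
  also have "\<dots> \<le> emeasure L K" by (rule emeasure_mono[OF sub K_sets])
  finally show ?thesis .
qed

text \<open>\<open>hit n x\<close> is the probability that the random orbit of \<open>x\<close> visits \<open>K\<close> at one of the times \<open>0..n\<close>.\<close>

primrec hit :: "nat \<Rightarrow> real \<Rightarrow> real" where
  "hit 0 x = indicator K x"
| "hit (Suc n) x = (if x \<in> K then 1 else \<Sum>j\<in>{1..N}. p j * hit n (T j x))"

lemma sum_p_le: "(\<And>j. j \<in> {1..N} \<Longrightarrow> f j \<le> k) \<Longrightarrow> (\<Sum>j\<in>{1..N}. p j * f j) \<le> k"
  and sum_p_ge: "(\<And>j. j \<in> {1..N} \<Longrightarrow> k \<le> f j) \<Longrightarrow> k \<le> (\<Sum>j\<in>{1..N}. p j * f j)"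
proof -
  have k: "(\<Sum>j\<in>{1..N}. p j * k) = k" using p_sum by (simp add: sum_distrib_right[symmetric])
  show "(\<Sum>j\<in>{1..N}. p j * f j) \<le> k" if "\<And>j. j \<in> {1..N} \<Longrightarrow> f j \<le> k"
    by (subst k[symmetric], intro sum_mono mult_left_mono) (use that p_pos in \<open>auto intro: less_imp_le\<close>)
  show "k \<le> (\<Sum>j\<in>{1..N}. p j * f j)" if "\<And>j. j \<in> {1..N} \<Longrightarrow> k \<le> f j"
    by (subst k[symmetric], intro sum_mono mult_left_mono) (use that p_pos in \<open>auto intro: less_imp_le\<close>)
qed

lemma hit_bounds: "0 \<le> hit n x" "hit n x \<le> 1"
proof -
  have "0 \<le> hit n x \<and> hit n x \<le> 1"
  proof (induction n arbitrary: x)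
    case (Suc n)
    then show ?case
      using sum_p_ge[of 0 "\<lambda>j. hit n (T j x)"] sum_p_le[of "\<lambda>j. hit n (T j x)" 1] by simp
  qed simp
  then show "0 \<le> hit n x" "hit n x \<le> 1" by auto
qed

lemma hit_K: "x \<in> K \<Longrightarrow> hit n x = 1"
  by (cases n) auto

lemma hit_Suc_mono: "hit n x \<le> hit (Suc n) x"
proof (induction n arbitrary: x)
  case 0
  then show ?case using sum_p_ge[of 0 "\<lambda>j. indicator K (T j x)"] by (auto split: split_indicator)
next
  case (Suc n)
  then have "(\<Sum>j\<in>{1..N}. p j * hit n (T j x)) \<le> (\<Sum>j\<in>{1..N}. p j * hit (Suc n) (T j x))"
    using p_pos by (intro sum_mono mult_left_mono) (auto intro: less_imp_le)
  then show ?case by simp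
qed

lemma hit_incseq: "incseq (\<lambda>n. hit n x)"
  by (rule incseq_SucI) (rule hit_Suc_mono)

lemma hit_measurable [measurable]: "hit n \<in> borel_measurable L"
proof (induction n)
  case 0
  have "hit 0 = indicator K" by auto
  then show ?case by simp
next
  case (Suc n)
  note [measurable] = Suc
  have "hit (Suc n) = (\<lambda>x. if x \<in> K then 1 else \<Sum>j\<in>{1..N}. p j * hit n (T j x))" by auto
  moreover have "\<dots> \<in> borel_measurable L" by measurable
  ultimately show ?case by simp
qed

text \<open>Off the \<delta>'-neighbourhood of \<open>c\<close>, a point outside \<open>K\<close> is
  close to an end. Whatever symbol is drawn, its image is again off that neighbourhood and its end
  distance has grown by the factor \<Lambda>, so the time to reach \<open>K\<close> is bounded for
  all symbol sequences.\<close>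

lemma hit_eq_one_away_from_c:
  assumes "x \<in> X" "\<delta>' \<le> \<bar>x - c\<bar>" "\<delta> \<le> \<Lambda> ^ n * end_dist x"
  shows "hit n x = 1"
  using assms
proof (induction n arbitrary: x)
  case 0
  then show ?case by (simp add: K_def)
next
  case (Suc n)
  have d: "0 < end_dist x" using Suc.prems by (simp add: end_dist_X X_def)
  show ?case
  proof (cases "x \<in> K")
    case False
    then have small: "end_dist x < \<delta>" using Suc.prems by (auto simp: K_def)
    have "hit n (T j x) = 1" if j: "j \<in> {1..N}" for j
    proof (rule Suc.IH)
      note t = trap_end[OF j d small]
      then show "T j x \<in> X" "\<delta>' \<le> \<bar>T j x - c\<bar>" by auto
      have "\<delta> \<le> \<Lambda> ^ n * (\<Lambda> * end_dist x)" using Suc.prems by (simp add: mult_ac)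
      also have "\<dots> \<le> \<Lambda> ^ n * end_dist (T j x)" using t trap_pos by (intro mult_left_mono) auto
      finally show "\<delta> \<le> \<Lambda> ^ n * end_dist (T j x)" .
    qed
    then show ?thesis using False p_sum by simp
  qed simp
qed

text \<open>The infimum \<open>s\<close> of the hitting probabilities over \<open>X\<close>
  satisfies \<open>pg + pb * s \<le> s\<close>, where \<open>pg > 0\<close> and
  \<open>pb = 1 - pg\<close> are the probabilities of a good and of another symbol; this forces
  \<open>s = 1\<close>.\<close>

lemma hit_tendsto:
  assumes x: "x \<in> X"
  shows "(\<lambda>n. hit n x) \<longlonglongrightarrow> 1"
proof -
  define h where "h x = lim (\<lambda>n. hit n x)" for x
  have lim: "(\<lambda>n. hit n x) \<longlonglongrightarrow> h x" for x
    unfolding h_def using hit_bounds hit_incseq[of x]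
    by (intro convergent_LIMSEQ_iff[THEN iffD1] Bseq_monoseq_convergent BseqI'[of _ 1])
      (auto simp: incseq_def monoseq_def)
  have h01: "0 \<le> h x" "h x \<le> 1" for x
    using LIMSEQ_le_const[OF lim] LIMSEQ_le_const2[OF lim] hit_bounds by blast+
  have away: "h x = 1" if "x \<in> X" "\<delta>' \<le> \<bar>x - c\<bar>" for x
  proof -
    have d: "0 < end_dist x" using that by (simp add: end_dist_X X_def)
    obtain m where m: "\<delta> / end_dist x < \<Lambda> ^ m" using real_arch_pow[OF trap_pos(3)] by blast
    have "hit n x = 1" if "m \<le> n" for n
    proof (rule hit_eq_one_away_from_c)
      have "\<delta> < \<Lambda> ^ m * end_dist x" using m d by (simp add: pos_divide_less_eq)
      also have "\<dots> \<le> \<Lambda> ^ n * end_dist x" using that trap_pos d by (intro mult_right_mono power_increasing) auto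
      finally show "\<delta> \<le> \<Lambda> ^ n * end_dist x" by simp
    qed fact+
    then have "(\<lambda>n. hit n x) \<longlonglongrightarrow> 1"
      by (intro tendsto_eventually) (auto simp: eventually_sequentially)
    then show ?thesis using LIMSEQ_unique[OF lim] by blast
  qed
  define s where "s = (INF x\<in>X. h x)"
  have bdd: "bdd_below (h ` X)" by (rule bdd_belowI2[of _ 0]) (use h01 in auto)
  have ne: "X \<noteq> {}" using x by blast
  define pg where "pg = (\<Sum>j\<in>good. p j)"
  define pb where "pb = (\<Sum>j\<in>{1..N} - good. p j)"
  have sum: "pg + pb = 1"
    using sum.subset_diff[OF good_subset(1), of p] p_sum by (simp add: pg_def pb_def)
  have "finite good" using good_subset finite_subset by blast
  then have pg: "0 < pg" unfolding pg_def using good_subset p_pos by (intro sum_pos) auto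
  have pb: "0 \<le> pb" unfolding pb_def using p_pos by (intro sum_nonneg) (auto intro: less_imp_le)
  have s1: "s \<le> 1" using cINF_lower[OF bdd x] h01[of x] by (simp add: s_def)
  \<comment> \<open>Near \<open>c\<close> a good symbol leads to where \<open>K\<close> is hit
    surely, and any other symbol leads to a point of \<open>X\<close>, where the probability is at
    least \<open>s\<close>.\<close>
  have rec: "pg + pb * s \<le> h y" if y: "y \<in> X" for y
  proof (cases "\<delta>' \<le> \<bar>y - c\<bar>")
    case True
    have "pb * s \<le> pb" using s1 pb by (simp add: mult_left_le)
    then show ?thesis using away[OF y True] sum by simp
  next
    case False
    then have nK: "y \<notin> K" by (simp add: K_def)
    have "(\<lambda>n. hit (Suc n) y) \<longlonglongrightarrow> (\<Sum>j\<in>{1..N}. p j * h (T j y))"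
      using nK by (auto intro!: tendsto_intros lim)
    then have hy: "h y = (\<Sum>j\<in>{1..N}. p j * h (T j y))"
      using LIMSEQ_unique LIMSEQ_Suc[OF lim] by blast
    also have "\<dots> = (\<Sum>j\<in>{1..N} - good. p j * h (T j y)) + (\<Sum>j\<in>good. p j * h (T j y))"
      using sum.subset_diff[OF good_subset(1)] by blast
    also have "(\<Sum>j\<in>good. p j * h (T j y)) = pg"
      unfolding pg_def using trap_crit[OF _ y] False away by (intro sum.cong) auto
    finally have "h y = (\<Sum>j\<in>{1..N} - good. p j * h (T j y)) + pg" .
    moreover have "pb * s \<le> (\<Sum>j\<in>{1..N} - good. p j * h (T j y))"
      unfolding pb_def sum_distrib_right
    proof (intro sum_mono mult_left_mono)
      fix j assume j: "j \<in> {1..N} - good"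
      then show "s \<le> h (T j y)" unfolding s_def using bad_T_in_X[of j y] y by (intro cINF_lower[OF bdd]) auto
      show "0 \<le> p j" using p_pos[of j] j by auto
    qed
    ultimately show ?thesis by simp
  qed
  have "pg + pb * s \<le> s" unfolding s_def[symmetric] by (subst (2) s_def) (rule cINF_greatest[OF ne rec])
  moreover have "pb = 1 - pg" using sum by simp
  ultimately have "pg + (1 - pg) * s \<le> s" by simp
  then have "pg * (1 - s) \<le> 0" by (simp add: algebra_simps)
  then have "1 \<le> s" using pg by (simp add: mult_le_0_iff)
  then have "h x = 1" using cINF_lower[OF bdd x] h01(2)[of x] by (simp add: s_def)
  then show ?thesis using lim[of x] by simp
qed

lemma hit_SUP: "x \<in> X \<Longrightarrow> (SUP n. ennreal (hit n x)) = 1"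
proof (rule LIMSEQ_unique)
  show "(\<lambda>n. ennreal (hit n x)) \<longlonglongrightarrow> (SUP n. ennreal (hit n x))"
    using hit_incseq[of x] by (intro LIMSEQ_SUP) (auto simp: incseq_def intro: ennreal_leI)
  assume "x \<in> X"
  then show "(\<lambda>n. ennreal (hit n x)) \<longlonglongrightarrow> 1" using tendsto_ennrealI[OF hit_tendsto] by simp
qed

lemma U_hit: "U (\<lambda>x. ennreal (hit n x)) y = ennreal (\<Sum>j\<in>{1..N}. p j * hit n (T j y))"
proof -
  have "U (\<lambda>x. ennreal (hit n x)) y = (\<Sum>j\<in>{1..N}. ennreal (p j * hit n (T j y)))"
    unfolding U_def using p_pos hit_bounds by (intro sum.cong) (auto simp: ennreal_mult less_imp_le)
  also have "\<dots> = ennreal (\<Sum>j\<in>{1..N}. p j * hit n (T j y))"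
    using p_pos hit_bounds by (intro sum_ennreal) (auto simp: less_imp_le)
  finally show ?thesis .
qed

lemma U_hit_SUP:
  assumes "\<forall>j\<in>{1..N}. T j y \<in> X"
  shows "(SUP n. U (\<lambda>x. ennreal (hit n x)) y) = 1" "incseq (\<lambda>n. U (\<lambda>x. ennreal (hit n x)) y)"
proof -
  show inc: "incseq (\<lambda>n. U (\<lambda>x. ennreal (hit n x)) y)"
    unfolding U_def using hit_incseq
    by (auto simp: incseq_def intro!: sum_mono mult_left_mono ennreal_leI)
  show "(SUP n. U (\<lambda>x. ennreal (hit n x)) y) = 1"
  proof (rule LIMSEQ_unique[OF LIMSEQ_SUP[OF inc]])
    have "(\<lambda>n. \<Sum>j\<in>{1..N}. p j * hit n (T j y)) \<longlonglongrightarrow> (\<Sum>j\<in>{1..N}. p j * 1)"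
      using assms by (intro tendsto_intros hit_tendsto) auto
    then have "(\<lambda>n. ennreal (\<Sum>j\<in>{1..N}. p j * hit n (T j y))) \<longlonglongrightarrow> ennreal 1"
      using p_sum by (intro tendsto_ennrealI) simp
    then show "(\<lambda>n. U (\<lambda>x. ennreal (hit n x)) y) \<longlonglongrightarrow> 1" by (simp add: U_hit)
  qed
qed

text \<open>With \<open>d = s - P s\<close>, the mass balance for \<open>hit\<close> bounds \<open>\<integral> d * hit n + \<integral>\<^sub>K s * U (hit n)\<close> by \<open>\<integral>\<^sub>K s\<close>; since \<open>hit n\<close>
  increases to \<open>1\<close>, the defect \<open>d\<close> vanishes.\<close>

lemma subinvariant_imp_invariant:
  assumes s[measurable]: "s \<in> borel_measurable L" and sub: "AE x in L. P s x \<le> s x"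
    and fin: "(\<integral>\<^sup>+x. s x * indicator K x \<partial>L) < \<infinity>"
  shows "AE x in L. P s x = s x"
proof -
  define d where "d x = s x - P s x" for x
  have d[measurable]: "d \<in> borel_measurable L" unfolding d_def[abs_def] by measurable
  have sd: "AE x in L. s x = d x + P s x" using sub
    by eventually_elim (simp add: d_def diff_add_cancel_ennreal)
  define f where "f n x = ennreal (hit n x)" for n x
  have f[measurable]: "f n \<in> borel_measurable L" for n unfolding f_def[abs_def] by measurable
  define k where "k = (\<integral>\<^sup>+x. s x * indicator K x \<partial>L)"
  define a where "a n = (\<integral>\<^sup>+x. s x * (f n x * indicator (- K) x) \<partial>L)" for n
  have [measurable]: "Measurable.pred L (\<lambda>x. x \<in> K)" by measurable
  have [measurable]: "(\<lambda>x. indicator (- K) x :: ennreal) \<in> borel_measurable L"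
    unfolding indicator_def by measurable
  have fK: "f n x * indicator K x = indicator K x" for n x
    by (auto simp: f_def hit_K split: split_indicator)
  have fS: "f (Suc n) x * indicator (- K) x = U (f n) x * indicator (- K) x" for n x
    unfolding f_def U_hit by (auto split: split_indicator)
  have balance: "k + a n = (\<integral>\<^sup>+x. d x * f n x + s x * indicator K x * U (f n) x \<partial>L) + a (Suc n)" for n
  proof -
    have "k + a n = (\<integral>\<^sup>+x. s x * indicator K x + s x * (f n x * indicator (- K) x) \<partial>L)"
      unfolding k_def a_def by (rule nn_integral_add[symmetric]) measurable
    also have "\<dots> = (\<integral>\<^sup>+x. s x * f n x \<partial>L)"
      by (intro nn_integral_cong) (auto simp: f_def hit_K split: split_indicator)
    also have "\<dots> = (\<integral>\<^sup>+x. d x * f n x + P s x * f n x \<partial>L)"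
      using sd by (intro nn_integral_cong_AE) (auto simp: distrib_right elim!: AE_mp)
    also have "\<dots> = (\<integral>\<^sup>+x. d x * f n x \<partial>L) + (\<integral>\<^sup>+x. P s x * f n x \<partial>L)"
      by (rule nn_integral_add) measurable
    also have "(\<integral>\<^sup>+x. P s x * f n x \<partial>L) = (\<integral>\<^sup>+x. s x * U (f n) x \<partial>L)"
      by (rule P_U_duality) measurable
    also have "\<dots> = (\<integral>\<^sup>+x. s x * indicator K x * U (f n) x + s x * (f (Suc n) x * indicator (- K) x) \<partial>L)"
      unfolding fS by (intro nn_integral_cong) (auto split: split_indicator)
    also have "\<dots> = (\<integral>\<^sup>+x. s x * indicator K x * U (f n) x \<partial>L) + a (Suc n)"
      unfolding a_def by (rule nn_integral_add) measurable
    also have "(\<integral>\<^sup>+x. d x * f n x \<partial>L) + ((\<integral>\<^sup>+x. s x * indicator K x * U (f n) x \<partial>L) + a (Suc n))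
       = (\<integral>\<^sup>+x. d x * f n x + s x * indicator K x * U (f n) x \<partial>L) + a (Suc n)"
      by (subst nn_integral_add) (auto simp: add.assoc)
    finally show ?thesis .
  qed
  \<comment> \<open>Finiteness is what permits cancelling \<open>a n\<close> in
    \<open>ennreal\<close>. The induction starts from \<open>a 0 = 0\<close>, because
    \<open>hit 0\<close> vanishes off \<open>K\<close>.\<close>
  have afin: "a n < \<infinity>" for n
  proof (induction n)
    case 0
    have "a 0 = 0" unfolding a_def f_def by (simp add: nn_integral_0_iff_AE indicator_def)
    then show ?case by simp
  next
    case (Suc n)
    have "a (Suc n) \<le> k + a n" unfolding balance by simp
    also have "\<dots> < \<infinity>" using Suc fin by (simp add: k_def)
    finally show ?case .
  qed
  have amono: "a n \<le> a (Suc n)" for n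
    unfolding a_def f_def using hit_Suc_mono by (intro nn_integral_mono mult_left_mono mult_right_mono ennreal_leI) auto
  have bound: "(\<integral>\<^sup>+x. d x * f n x + s x * indicator K x * U (f n) x \<partial>L) \<le> k" for n
  proof -
    have "(\<integral>\<^sup>+x. d x * f n x + s x * indicator K x * U (f n) x \<partial>L) + a n \<le> k + a n"
      unfolding balance using amono by (intro add_left_mono)
    then show ?thesis using afin[of n] by (auto simp: ennreal_add_left_cancel_le add.commute)
  qed
  have inc: "incseq (\<lambda>n x. d x * f n x + s x * indicator K x * U (f n) x)"
    unfolding f_def U_def incseq_def le_fun_def using hit_incseq
    by (auto simp: incseq_def intro!: add_mono mult_left_mono sum_mono ennreal_leI)
  have "(\<integral>\<^sup>+x. d x \<partial>L) + k = (\<integral>\<^sup>+x. d x + s x * indicator K x \<partial>L)"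
    unfolding k_def by (rule nn_integral_add[symmetric]) measurable
  also have "\<dots> = (\<integral>\<^sup>+x. (SUP n. d x * f n x + s x * indicator K x * U (f n) x) \<partial>L)"
  proof (rule nn_integral_cong_AE)
    show "AE x in L. d x + s x * indicator K x = (SUP n. d x * f n x + s x * indicator K x * U (f n) x)"
      using AE_X AE_T[OF AE_X]
    proof eventually_elim
      case (elim x)
      have "(SUP n. d x * f n x + s x * indicator K x * U (f n) x)
          = (SUP n. d x * f n x) + (SUP n. s x * indicator K x * U (f n) x)"
        unfolding f_def using hit_incseq[of x] U_hit_SUP(2)[OF elim(2)]
        by (intro ennreal_SUP_add) (auto simp: incseq_def intro!: mult_left_mono ennreal_leI)
      also have "(SUP n. d x * f n x) = d x"
        unfolding f_def using hit_SUP[OF elim(1)] by (simp add: SUP_mult_left_ennreal[symmetric])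
      also have "(SUP n. s x * indicator K x * U (f n) x) = s x * indicator K x"
        unfolding f_def using U_hit_SUP(1)[OF elim(2)] by (simp add: SUP_mult_left_ennreal[symmetric])
      finally show ?case by simp
    qed
  qed
  also have "\<dots> = (SUP n. \<integral>\<^sup>+x. d x * f n x + s x * indicator K x * U (f n) x \<partial>L)"
    by (rule nn_integral_monotone_convergence_SUP[OF inc]) measurable
  also have "\<dots> \<le> k" using bound by (rule SUP_least)
  finally have "(\<integral>\<^sup>+x. d x \<partial>L) + k \<le> 0 + k" by simp
  then have "(\<integral>\<^sup>+x. d x \<partial>L) = 0" using fin by (auto simp: k_def[symmetric] ennreal_add_left_cancel_le add.commute)
  then have "AE x in L. d x = 0" by (subst (asm) nn_integral_0_iff_AE) auto
  with sd show ?thesis by eventually_elim simp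
qed

end

section \<open>The invariant density\<close>

text \<open>Tychonoff's theorem for the product of the intervals \<open>[- B x, B x]\<close>. In an
  uncountable product a cluster point need not be a limit of a subsequence, hence the filter.
  Measurability is not inherited by such limits; for the density it will come from continuity on
  each side.\<close>

lemma pointwise_cluster:
  fixes f :: "nat \<Rightarrow> 'a \<Rightarrow> real"
  assumes "\<And>x. \<exists>B. \<forall>n. \<bar>f n x\<bar> \<le> B"
  shows "\<exists>F l. F \<noteq> bot \<and> F \<le> sequentially \<and> (\<forall>x. ((\<lambda>n. f n x) \<longlongrightarrow> l x) F)"
proof -
  obtain B where B: "\<And>n x. \<bar>f n x\<bar> \<le> B x" using assms by metis
  define C where "C = PiE UNIV (\<lambda>x. {- B x..B x})"
  have "compactin (product_topology (\<lambda>_. euclidean) UNIV) C"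
    unfolding C_def by (subst compactin_PiE) auto
  then have C: "compact C" by (simp add: euclidean_product_topology)
  have "f n \<in> C" for n using B[of n] by (auto simp: C_def abs_le_iff minus_le_iff)
  then have "eventually (\<lambda>h. h \<in> C) (filtermap f sequentially)" by (simp add: eventually_filtermap)
  moreover have "filtermap f sequentially \<noteq> bot" by (simp add: filtermap_bot_iff)
  ultimately obtain l where l: "inf (nhds l) (filtermap f sequentially) \<noteq> bot"
    using C unfolding compact_filter by blast
  define F where "F = inf sequentially (filtercomap f (nhds l))"
  have "F \<noteq> bot"
  proof
    assume "F = bot"
    then have "eventually (\<lambda>_. False) F" by simp
    then obtain P Q where PQ: "eventually P sequentially" "eventually Q (filtercomap f (nhds l))"
      "\<And>n. P n \<Longrightarrow> Q n \<Longrightarrow> False"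
      unfolding F_def eventually_inf by blast
    then obtain R where R: "eventually R (nhds l)" "\<And>n. R (f n) \<Longrightarrow> Q n"
      by (auto simp: eventually_filtercomap)
    have "eventually (\<lambda>h. \<not> R h) (filtermap f sequentially)"
      unfolding eventually_filtermap by (rule eventually_mono[OF PQ(1)]) (use PQ R in blast)
    then have "eventually (\<lambda>_. False) (inf (nhds l) (filtermap f sequentially))"
      unfolding eventually_inf using R(1) by blast
    with l show False by (simp add: trivial_limit_def)
  qed
  moreover have "F \<le> sequentially" by (simp add: F_def)
  moreover have "((\<lambda>n. f n x) \<longlongrightarrow> l x) F" for x
  proof -
    have "filterlim f (nhds l) F"
      unfolding F_def filterlim_def by (meson filtermap_filtercomap filtermap_mono inf_le2 order_trans)
    then show ?thesis
      using continuous_on_tendsto_compose[OF continuous_on_product_coordinates[of x], of f l F] by simp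
  qed
  ultimately show ?thesis by blast
qed

context trapped_system begin

text \<open>The real-valued form of \<open>P\<close>, in which cone conditions and limits are
  expressed.\<close>

definition Pr :: "(real \<Rightarrow> real) \<Rightarrow> real \<Rightarrow> real" where
  "Pr f x = (\<Sum>j\<in>{1..N}. \<Sum>b\<in>UNIV. p j * wt j b x * f (\<psi>0 j b x))"

lemma psi0_side: "j \<in> {1..N} \<Longrightarrow> x \<in> rng j b \<Longrightarrow> \<psi>0 j b x \<in> side b"
  by (simp add: psi0_eq psi_inverse(1) del: greaterThanLessThan_iff)

lemma psi0_X: "j \<in> {1..N} \<Longrightarrow> x \<in> rng j b \<Longrightarrow> \<psi>0 j b x \<in> X"
  using psi0_side X_side(2) by blast

lemma wt_zero: "x \<notin> rng j b \<Longrightarrow> wt j b x = 0"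
  by (simp add: wt_def del: greaterThanLessThan_iff)

lemma Pr_nonneg:
  assumes "\<And>y. y \<in> X \<Longrightarrow> 0 \<le> f y"
  shows "0 \<le> Pr f x"
  unfolding Pr_def
proof (intro sum_nonneg)
  fix j b assume j: "j \<in> {1..N}"
  show "0 \<le> p j * wt j b x * f (\<psi>0 j b x)"
  proof (cases "x \<in> rng j b")
    case True
    then show ?thesis using assms[OF psi0_X[OF j True]] p_pos[OF j] wt_nonneg[of j b x] by simp
  next
    case False
    from wt_zero[OF this] show ?thesis by simp
  qed
qed

lemma P_ennreal:
  assumes "\<And>y. y \<in> X \<Longrightarrow> 0 \<le> f y"
  shows "P (\<lambda>x. ennreal (f x)) x = ennreal (Pr f x)"
proof -
  have pos: "0 \<le> p j * wt j b x * f (\<psi>0 j b x)" if j: "j \<in> {1..N}" for j b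
  proof (cases "x \<in> rng j b")
    case True
    then show ?thesis using assms[OF psi0_X[OF j True]] p_pos[OF j] wt_nonneg[of j b x] by simp
  next
    case False
    from wt_zero[OF this] show ?thesis by simp
  qed
  have "ennreal (p j * wt j b x) * ennreal (f (\<psi>0 j b x)) = ennreal (p j * wt j b x * f (\<psi>0 j b x))"
    if j: "j \<in> {1..N}" for j b
    using p_pos[OF j] wt_nonneg[of j b x] by (cases "x \<in> rng j b") (auto simp: ennreal_mult'[symmetric] wt_def)
  then have "P (\<lambda>x. ennreal (f x)) x = (\<Sum>j\<in>{1..N}. \<Sum>b\<in>UNIV. ennreal (p j * wt j b x * f (\<psi>0 j b x)))"
    by (simp add: P_def)
  also have "\<dots> = (\<Sum>j\<in>{1..N}. ennreal (\<Sum>b\<in>UNIV. p j * wt j b x * f (\<psi>0 j b x)))"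
    by (intro sum.cong refl sum_ennreal pos)
  also have "\<dots> = ennreal (Pr f x)"
    unfolding Pr_def by (rule sum_ennreal) (intro sum_nonneg pos)
  finally show ?thesis .
qed

lemma Pr_ge:
  assumes j: "j \<in> {1..N}" and f: "\<And>y. y \<in> X \<Longrightarrow> 0 \<le> f y"
  shows "p j * wt j b x * f (\<psi>0 j b x) \<le> Pr f x"
proof -
  have pos: "0 \<le> p j * wt j b x * f (\<psi>0 j b x)" if j: "j \<in> {1..N}" for j b
  proof (cases "x \<in> rng j b")
    case True
    then show ?thesis using f[OF psi0_X[OF j True]] p_pos[OF j] wt_nonneg[of j b x] by simp
  next
    case False
    from wt_zero[OF this] show ?thesis by simp
  qed
  have "p j * wt j b x * f (\<psi>0 j b x) \<le> (\<Sum>b\<in>UNIV. p j * wt j b x * f (\<psi>0 j b x))"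
    by (rule member_le_sum) (use pos j in auto)
  also have "\<dots> \<le> Pr f x" unfolding Pr_def
    by (rule member_le_sum[where f="\<lambda>j. \<Sum>b\<in>UNIV. p j * wt j b x * f (\<psi>0 j b x)"])
      (use pos j in \<open>auto intro!: sum_nonneg\<close>)
  finally show ?thesis .
qed

lemma Pr_koebe_cone:
  assumes "\<And>b. koebe_cone (lo b) (hi b) f"
  shows "koebe_cone (lo i) (hi i) (Pr f)"
  unfolding Pr_def[abs_def]
proof (intro koebe_cone_sum)
  fix j b assume j: "j \<in> {1..N}"
  have "koebe_cone (lo i) (hi i) (\<lambda>x. p j * (wt j b x * f (\<psi> j b x)))"
    using koebe_cone_scale[OF koebe_cone_branch[OF j assms]] p_pos[OF j] by simp
  then show "koebe_cone (lo i) (hi i) (\<lambda>x. p j * wt j b x * f (\<psi>0 j b x))"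
    by (rule koebe_cone_cong) (auto simp: wt_def psi0_eq mult.assoc)
qed

lemma cone_nonneg: "(\<And>b. koebe_cone (lo b) (hi b) f) \<Longrightarrow> x \<in> X \<Longrightarrow> 0 \<le> f x"
  using X_side(2)[of x] koebe_coneD(1)[OF _ _ order_refl] by (metis greaterThanLessThan_iff)

section \<open>Iterates of the constant density and their divergent sum\<close>

primrec g :: "nat \<Rightarrow> real \<Rightarrow> real" where
  "g 0 = (\<lambda>_. 1)"
| "g (Suc n) = Pr (g n)"

lemma g_nonneg: "0 \<le> g n x"
  by (induction n arbitrary: x) (auto intro: Pr_nonneg)

lemma g_koebe_cone: "koebe_cone (lo i) (hi i) (g n)"
  by (induction n arbitrary: i) (auto intro: koebe_cone_const Pr_koebe_cone)

lemma g_Suc_ennreal: "(\<lambda>x. ennreal (g (Suc n) x)) = P (\<lambda>x. ennreal (g n x))"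
  by (auto simp: P_ennreal g_nonneg)

lemma g_measurable [measurable]: "(\<lambda>x. ennreal (g n x)) \<in> borel_measurable L"
proof (induction n)
  case (Suc n)
  then show ?case unfolding g_Suc_ennreal by measurable
qed simp

lemma g_integral: "(\<integral>\<^sup>+x. ennreal (g n x) \<partial>L) = 1"
proof (induction n)
  case 0
  have "emeasure L {0..1} = 1" by (subst emeasure_L) (auto simp: sets_L)
  then show ?case using emeasure_eq_measure2 by simp
next
  case (Suc n)
  have "(\<integral>\<^sup>+x. ennreal (g (Suc n) x) \<partial>L) = (\<integral>\<^sup>+x. P (\<lambda>x. ennreal (g n x)) x \<partial>L)"
    by (simp only: g_Suc_ennreal)
  also have "\<dots> = (\<integral>\<^sup>+x. ennreal (g n x) \<partial>L)" by (rule nn_integral_P) measurable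
  finally show ?case using Suc by simp
qed

text \<open>By the Harnack inequality a large value at \<open>x\<close> forces large values on an
  interval around \<open>x\<close>, against total mass 1. The bound is uniform in
  \<open>n\<close>.\<close>

lemma g_bounded:
  assumes x: "x \<in> X"
  shows "\<exists>B. \<forall>n. g n x \<le> B"
proof -
  obtain i where i: "x \<in> side i" using x X_side by blast
  define r where "r = min (x - lo i) (hi i - x) / 2"
  have r: "0 < r" "lo i + r \<le> x - r" "x + r \<le> hi i - r" using i by (auto simp: r_def min_def field_simps)
  define k where "k = ((hi i - lo i) / r)\<^sup>2"
  have k: "0 < k" using r side_bounds(1)[of i] by (simp add: k_def)
  have "g n x \<le> k / (2 * r)" for n
  proof -
    have "ennreal (g n x / k * (2 * r)) = (\<integral>\<^sup>+y. ennreal (g n x / k) * indicator {x - r..x + r} y \<partial>lborel)"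
      using r k g_nonneg[of n x] by (simp add: nn_integral_cmult_indicator ennreal_mult[symmetric])
    also have "\<dots> \<le> (\<integral>\<^sup>+y. ennreal (g n y) * indicator {0..1} y \<partial>lborel)"
    proof (intro nn_integral_mono)
      fix y
      show "ennreal (g n x / k) * indicator {x - r..x + r} y \<le> ennreal (g n y) * indicator {0..1} y"
      proof (cases "y \<in> {x - r..x + r}")
        case True
        have "g n x \<le> g n y * k" unfolding k_def
          by (rule koebe_cone_compare[OF g_koebe_cone[of i n] r(1)]) (use r True in auto)
        then have "g n x / k \<le> g n y" using k by (simp add: pos_divide_le_eq)
        moreover have "y \<in> {0..1}" using True r side_bounds(2,3)[of i] by auto
        ultimately show ?thesis using True by (simp add: ennreal_leI)
      qed simp
    qed
    also have "\<dots> = 1" using g_integral[of n] by (simp add: nn_integral_L)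
    finally have "g n x / k * (2 * r) \<le> 1" by simp
    then show ?thesis using r k by (simp add: field_simps)
  qed
  then show ?thesis by blast
qed

text \<open>The Green function of the random map with respect to the constant density 1.\<close>

definition G :: "real \<Rightarrow> ennreal" where "G x = (\<Sum>n. ennreal (g n x))"

lemma G_measurable [measurable]: "G \<in> borel_measurable L"
  unfolding G_def[abs_def] by measurable

lemma G_rec: "G x = 1 + P G x"
proof -
  have "P G x = (\<Sum>n. ennreal (g (Suc n) x))"
    unfolding G_def[abs_def] P_suminf by (simp add: P_ennreal g_nonneg)
  moreover have "G x = ennreal (g 0 x) + (\<Sum>n. ennreal (g (Suc n) x))"
    unfolding G_def using suminf_offset[of "\<lambda>n. ennreal (g n x)" 1] by (simp add: add.commute)
  ultimately show ?thesis by simp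
qed

text \<open>\<open>G = 1 + P G\<close> makes \<open>G\<close> subinvariant. Integrability over
  \<open>K\<close> would make it invariant, so \<open>G = 1 + G\<close> at almost all points of
  \<open>K\<close>, where \<open>G\<close> would also be finite; but \<open>K\<close> has positive
  measure.\<close>

lemma G_K: "(\<integral>\<^sup>+x. G x * indicator K x \<partial>L) = \<infinity>"
proof (rule ccontr)
  assume "\<not> ?thesis"
  then have fin: "(\<integral>\<^sup>+x. G x * indicator K x \<partial>L) < \<infinity>" by (simp add: less_top)
  have "AE x in L. P G x = G x"
    by (rule subinvariant_imp_invariant[OF _ _ fin]) (auto simp: G_rec[symmetric] intro!: AE_I2, subst (2) G_rec, simp)
  moreover have "AE x in L. G x * indicator K x \<noteq> \<infinity>"
    by (rule nn_integral_PInf_AE) (use fin in auto)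
  ultimately have "AE x in L. x \<notin> K"
  proof eventually_elim
    case (elim x)
    show ?case
    proof
      assume "x \<in> K"
      then have "G x < \<infinity>" using elim by (simp add: less_top)
      moreover have "G x = 1 + G x" using G_rec[of x] elim by simp
      ultimately show False 
        using ennreal_add_left_cancel[of "G x" 1 0] by (auto simp: add.commute)
    qed
  qed
  moreover have "{x \<in> space L. \<not> x \<notin> K} = K" using K_sub by auto
  ultimately have "emeasure L K = 0" using AE_iff_measurable[OF K_sets, of "\<lambda>x. x \<notin> K"] by blast
  with K_pos show False by simp
qed

definition S :: "nat \<Rightarrow> real \<Rightarrow> real" where "S n x = (\<Sum>k<n. g k x)"

lemma S_koebe_cone: "koebe_cone (lo i) (hi i) (S n)"
  unfolding S_def[abs_def] by (intro koebe_cone_sum g_koebe_cone)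

lemma S_nonneg: "0 \<le> S n x"
  unfolding S_def by (intro sum_nonneg g_nonneg)

lemma G_SUP: "G x = (SUP n. ennreal (S n x))"
  unfolding G_def S_def suminf_eq_SUP by (simp add: sum_ennreal g_nonneg)

lemma Pr_S: "1 + Pr (S n) x = S (Suc n) x"
proof -
  have "Pr (S n) x = (\<Sum>k<n. Pr (g k) x)"
    unfolding Pr_def S_def sum_distrib_left
    by (subst sum.swap, rule sum.cong[OF refl], subst sum.swap, simp add: sum_distrib_left) 
  moreover have "S (Suc n) x = g 0 x + (\<Sum>k<n. g (Suc k) x)"
    unfolding S_def by (rule sum.lessThan_Suc_shift)
  ultimately show ?thesis by simp
qed

text \<open>Divergence on \<open>K\<close> within one side spreads to every point of that side by
  the Harnack inequality, and from there to all of \<open>(0, 1)\<close>, including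
  \<open>c\<close>, by one branch of a good map.\<close>

lemma G_infinite:
  assumes x: "x \<in> {0<..<1}"
  shows "G x = \<infinity>"
proof -
  have "(\<Sum>b\<in>UNIV. \<integral>\<^sup>+y. (G y * indicator K y) * indicator (side b) y \<partial>L) = \<infinity>"
    using nn_integral_sides[of "\<lambda>x. G x * indicator K x"] G_K by simp
  then obtain i where i: "(\<integral>\<^sup>+y. (G y * indicator K y) * indicator (side i) y \<partial>L) = \<infinity>"
    unfolding sum_bool by (auto simp: ennreal_add_eq_top)
  have side: "G y = \<infinity>" if y: "y \<in> side i" for y
  proof (rule ccontr)
    assume "G y \<noteq> \<infinity>"
    then have fin: "G y < \<infinity>" by (simp add: less_top)
    \<comment> \<open>Small enough that \<open>y\<close> and the part of \<open>K\<close> in this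
      side lie in a common core.\<close>
    define d where "d = Min {\<delta>, \<delta>', y - lo i, hi i - y}"
    have d: "0 < d" "d \<le> \<delta>" "d \<le> \<delta>'" "lo i + d \<le> y" "y \<le> hi i - d"
      using trap_pos y by (auto simp: d_def min_def)
    define k where "k = ((hi i - lo i) / d)\<^sup>2"
    have "G z * indicator K z * indicator (side i) z \<le> G y * ennreal k" for z
    proof (cases "z \<in> K \<and> z \<in> side i")
      case True
      then have "lo i + min \<delta> \<delta>' \<le> z \<and> z \<le> hi i - min \<delta> \<delta>'" using K_side by blast
      then have z: "lo i + d \<le> z" "z \<le> hi i - d" using d by (auto simp: min_def split: if_splits)
      have "S n z \<le> S n y * k" for n
        unfolding k_def by (rule koebe_cone_compare[OF S_koebe_cone d(1) z d(4,5)])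
      then have "ennreal (S n z) \<le> ennreal (S n y) * ennreal k" for n
        using S_nonneg[of n y] by (subst ennreal_mult[symmetric]) (auto simp: k_def intro: ennreal_leI)
      also have "ennreal (S n y) * ennreal k \<le> G y * ennreal k" for n
        unfolding G_SUP[of y] by (intro mult_right_mono SUP_upper) auto
      finally have "G z \<le> G y * ennreal k" unfolding G_SUP[of z] by (intro SUP_least)
      then show ?thesis using True by simp
    qed (auto split: split_indicator)
    then have "(\<integral>\<^sup>+z. (G z * indicator K z) * indicator (side i) z \<partial>L) \<le> (\<integral>\<^sup>+z. G y * ennreal k \<partial>L)"
      by (intro nn_integral_mono)
    also have "\<dots> = G y * ennreal k * emeasure L {0..1}" by simp
    also have "\<dots> < \<infinity>"
      using fin finite_measure.emeasure_finite[OF finite_L, of "{0..1}"]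
      by (simp add: ennreal_mult_less_top less_top)
    finally show False using i by simp
  qed
  obtain j where j: "j \<in> good" using good_subset by blast
  then have jN: "j \<in> {1..N}" using good_subset by blast
  have xr: "x \<in> rng j i" using branch_range[OF jN, of i] j x by auto
  have "ennreal (p j * wt j i x) * G (\<psi>0 j i x) \<le> P G x"
    unfolding P_def using jN
    by (intro order_trans[OF _ member_le_sum[where i=j]] member_le_sum[where i=i]) auto
  moreover have "0 < p j * wt j i x" using p_pos[OF jN] wt_pos[OF jN xr] by simp
  moreover have "G (\<psi>0 j i x) = \<infinity>" by (rule side[OF psi0_side[OF jN xr]])
  ultimately have "P G x = \<infinity>" by (auto simp: ennreal_mult_top top_unique split: if_splits)
  then show ?thesis using G_rec[of x] by simp
qed

lemma S_filterlim:
  assumes x: "x \<in> {0<..<1}"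
  shows "filterlim (\<lambda>n. S n x) at_top sequentially"
  unfolding filterlim_at_top
proof
  fix Z :: real
  have "(SUP n. ennreal (S n x)) = \<top>" using G_infinite[OF x] G_SUP[of x] by (simp del: SUP_eq_top_iff)
  then have "\<exists>n. ennreal \<bar>Z\<bar> < ennreal (S n x)" by auto
  then obtain n where n: "ennreal \<bar>Z\<bar> < ennreal (S n x)" by blast
  then have n': "Z \<le> S n x" by (auto simp: ennreal_less_iff)
  have "Z \<le> S m x" if "n \<le> m" for m
  proof -
    have "S n x \<le> S m x" unfolding S_def by (intro sum_mono2) (use that g_nonneg in auto)
    then show ?thesis using n' by simp
  qed
  then show "\<forall>\<^sub>F n in sequentially. Z \<le> S n x" by (auto simp: eventually_sequentially)
qed

text \<open>The two sides are linked through a good branch: \<open>x0\<close> has a preimage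
  \<open>y\<close> in the side of \<open>x\<close>, so \<open>w * S y\<close> is part of
  \<open>Pr S\<close> at \<open>x0\<close>. That exceeds \<open>S\<close> at \<open>x0\<close> by at
  most one bounded term, and \<open>x\<close> is compared with \<open>y\<close> by the Harnack
  inequality.\<close>

lemma S_ratio_bounded:
  assumes x0: "x0 \<in> X" and x: "x \<in> X"
  shows "\<exists>B. \<forall>n. S (Suc n) x / S (Suc n) x0 \<le> B"
proof -
  obtain i where i: "x \<in> side i" using x X_side by blast
  obtain j where j: "j \<in> good" using good_subset by blast
  then have jN: "j \<in> {1..N}" using good_subset by blast
  have xr: "x0 \<in> rng j i" using branch_range[OF jN, of i] j x0 by (auto simp: X_def)
  define y where "y = \<psi>0 j i x0"
  define w where "w = p j * wt j i x0"
  have y: "y \<in> side i" unfolding y_def by (rule psi0_side[OF jN xr])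
  have w: "0 < w" using p_pos[OF jN] wt_pos[OF jN xr] by (simp add: w_def)
  obtain B where B: "\<And>n. g n x0 \<le> B" using g_bounded[OF x0] by blast
  have B1: "1 \<le> B" using B[of 0] by simp
  define d where "d = Min {x - lo i, hi i - x, y - lo i, hi i - y}"
  have d: "0 < d" "lo i + d \<le> y" "y \<le> hi i - d" "lo i + d \<le> x" "x \<le> hi i - d"
    using i y by (auto simp: d_def min_def)
  define k where "k = ((hi i - lo i) / d)\<^sup>2"
  have k0: "0 \<le> k" by (simp add: k_def)
  have "S (Suc n) x / S (Suc n) x0 \<le> k * (2 * B / w)" for n
  proof -
    have S1: "1 \<le> S (Suc n) x0"
      using member_le_sum[of 0 "{..<Suc n}" "\<lambda>k. g k x0"] g_nonneg by (simp add: S_def del: sum.lessThan_Suc)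
    have "w * S (Suc n) y \<le> Pr (S (Suc n)) x0"
      unfolding w_def y_def by (rule Pr_ge[OF jN]) (rule S_nonneg)
    also have "\<dots> \<le> S (Suc (Suc n)) x0" using Pr_S[of "Suc n" x0] by simp
    also have "\<dots> = S (Suc n) x0 + g (Suc n) x0" by (simp add: S_def)
    also have "\<dots> \<le> B * S (Suc n) x0 + B * S (Suc n) x0"
    proof (rule add_mono)
      show "S (Suc n) x0 \<le> B * S (Suc n) x0" using mult_right_mono[of 1 B "S (Suc n) x0"] B1 S1 by simp
      have "B * 1 \<le> B * S (Suc n) x0" using B1 S1 by (intro mult_left_mono) auto
      then show "g (Suc n) x0 \<le> B * S (Suc n) x0" using B[of "Suc n"] by linarith
    qed
    finally have "S (Suc n) y \<le> 2 * B / w * S (Suc n) x0" using w by (simp add: field_simps)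
    moreover have "S (Suc n) x \<le> S (Suc n) y * k"
      unfolding k_def by (rule koebe_cone_compare[OF S_koebe_cone d(1,4,5,2,3)])
    ultimately have "S (Suc n) x \<le> (2 * B / w * S (Suc n) x0) * k" using k0 by (meson mult_right_mono order_trans)
    then show ?thesis using S1 by (simp add: pos_divide_le_eq mult_ac)
  qed
  then show ?thesis by blast
qed

text \<open>The defect of invariance of a partial sum at \<open>x\<close> is
  \<open>g (Suc n) x - 1\<close>, which is bounded in \<open>n\<close>; after division by the
  diverging normalisation it tends to 0, and \<open>Pr\<close> commutes with pointwise limits as a
  finite sum.\<close>

lemma invariant_density:
  "\<exists>l. (\<forall>i. koebe_cone (lo i) (hi i) l) \<and> (\<forall>x\<in>X. Pr l x = l x) \<and> (\<forall>x\<in>X. 0 < l x)"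
proof -
  \<comment> \<open>The midpoint of \<open>(0, c)\<close>, since the lower bound for the cone is in
    terms of the midpoint value, which the normalisation makes 1.\<close>
  define x0 where "x0 = (lo False + hi False) / 2"
  have x0s: "x0 \<in> side False" using c0 by (simp add: x0_def lo_def hi_def)
  then have x0: "x0 \<in> X" using X_side(2) by blast
  have x01: "x0 \<in> {0<..<1}" using x0 by (simp add: X_def)
  \<comment> \<open>The index \<open>Suc n\<close> includes \<open>g 0 = 1\<close> and keeps the
    denominator at least 1; the value 0 off \<open>X\<close> keeps the functions bounded at every
    real.\<close>
  define f where "f n x = (if x \<in> X then S (Suc n) x / S (Suc n) x0 else 0)" for n x
  have f0: "0 \<le> f n x" for n x using S_nonneg by (simp add: f_def)
  have "\<exists>B. \<forall>n. \<bar>f n x\<bar> \<le> B" for x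
  proof (cases "x \<in> X")
    case True
    then obtain B where "\<forall>n. S (Suc n) x / S (Suc n) x0 \<le> B" using S_ratio_bounded[OF x0] by blast
    then have "f n x \<le> B" for n using True by (simp add: f_def)
    then show ?thesis using f0 by (auto intro!: exI[of _ B] simp: abs_of_nonneg)
  qed (auto simp: f_def)
  then obtain F l where F: "F \<noteq> bot" "F \<le> sequentially" and l: "\<And>x. ((\<lambda>n. f n x) \<longlongrightarrow> l x) F"
    using pointwise_cluster[of f] by blast
  have "koebe_cone (lo i) (hi i) (f n)" for i n
  proof -
    have "koebe_cone (lo i) (hi i) (\<lambda>x. (1 / S (Suc n) x0) * S (Suc n) x)"
      by (rule koebe_cone_scale[OF S_koebe_cone]) (simp add: S_nonneg)
    then show ?thesis by (rule koebe_cone_cong) (use X_side(2) in \<open>auto simp: f_def\<close>)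
  qed
  then have cone: "koebe_cone (lo i) (hi i) l" for i
    by (intro koebe_cone_tendsto[OF F(1) l]) auto
  have inv: "Pr l x = l x" if x: "x \<in> X" for x
  proof -
    obtain B where B: "\<And>n. g n x \<le> B" using g_bounded[OF x] by blast
    have top: "filterlim (\<lambda>n. S (Suc n) x0) at_top F"
      using filterlim_mono[OF filterlim_compose[OF S_filterlim[OF x01] filterlim_Suc] order_refl F(2)] .
    have "((\<lambda>n. (g (Suc n) x - 1) / S (Suc n) x0) \<longlongrightarrow> 0) F"
    proof (rule Lim_null_comparison)
      show "\<forall>\<^sub>F n in F. norm ((g (Suc n) x - 1) / S (Suc n) x0) \<le> (B + 1) / S (Suc n) x0"
      proof (rule always_eventually, rule allI)
        fix n
        have "\<bar>g (Suc n) x - 1\<bar> \<le> B + 1" using B[of "Suc n"] g_nonneg[of "Suc n" x] by linarith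
        then show "norm ((g (Suc n) x - 1) / S (Suc n) x0) \<le> (B + 1) / S (Suc n) x0"
          using S_nonneg[of "Suc n" x0] by (simp add: abs_divide divide_right_mono)
      qed
      show "((\<lambda>n. (B + 1) / S (Suc n) x0) \<longlongrightarrow> 0) F"
        by (rule tendsto_divide_0[OF tendsto_const filterlim_at_top_imp_at_infinity[OF top]])
    qed
    moreover have "Pr (f n) x = f n x + (g (Suc n) x - 1) / S (Suc n) x0" for n
    proof -
      have t: "p j * wt j b x * f n (\<psi>0 j b x) = (p j * wt j b x * S (Suc n) (\<psi>0 j b x)) / S (Suc n) x0"
        if "j \<in> {1..N}" for j b
        using psi0_X[OF that, of x b] by (cases "x \<in> rng j b") (auto simp: f_def wt_def)
      have "Pr (f n) x = (\<Sum>j\<in>{1..N}. \<Sum>b\<in>UNIV. (p j * wt j b x * S (Suc n) (\<psi>0 j b x)) / S (Suc n) x0)"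
        unfolding Pr_def by (intro sum.cong refl t)
      also have "\<dots> = Pr (S (Suc n)) x / S (Suc n) x0"
        unfolding Pr_def sum_divide_distrib ..
      also have "Pr (S (Suc n)) x = S (Suc n) x + g (Suc n) x - 1"
        using Pr_S[of "Suc n" x] by (simp add: S_def)
      also have "(S (Suc n) x + g (Suc n) x - 1) / S (Suc n) x0 = S (Suc n) x / S (Suc n) x0 + (g (Suc n) x - 1) / S (Suc n) x0"
        by (simp only: add_divide_distrib[symmetric] add_diff_eq)
      also have "S (Suc n) x / S (Suc n) x0 = f n x" using x by (simp add: f_def)
      finally show ?thesis .
    qed
    ultimately have "((\<lambda>n. Pr (f n) x) \<longlongrightarrow> l x + 0) F"
      using l[of x] by (simp only:) (rule tendsto_add)
    moreover have "((\<lambda>n. Pr (f n) x) \<longlongrightarrow> Pr l x) F"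
      unfolding Pr_def by (intro tendsto_intros l)
    ultimately show ?thesis using tendsto_unique[OF F(1)] by simp
  qed
  have "l x0 = 1"
  proof -
    have "S (Suc n) x0 \<noteq> 0" for n
      using member_le_sum[of 0 "{..<Suc n}" "\<lambda>k. g k x0"] g_nonneg
      by (force simp: S_def simp del: sum.lessThan_Suc)
    then have "f n x0 = 1" for n using x0 by (simp add: f_def)
    then have "((\<lambda>n. f n x0) \<longlongrightarrow> 1) F" by simp
    with l[of x0] show ?thesis by (rule tendsto_unique[OF F(1)])
  qed
  then have pos0: "0 < l x" if "x \<in> side False" for x
    using koebe_cone_lower[OF cone[of False], of x] that by (simp add: x0_def)
  have pos: "0 < l x" if x: "x \<in> X" for x
  proof -
    obtain j where j: "j \<in> good" using good_subset by blast
    then have jN: "j \<in> {1..N}" using good_subset by blast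
    have xr: "x \<in> rng j False" using branch_range[OF jN, of False] j x by (auto simp: X_def)
    have "0 < p j * wt j False x * l (\<psi>0 j False x)"
      using p_pos[OF jN] wt_pos[OF jN xr] pos0[OF psi0_side[OF jN xr]] by simp
    also have "\<dots> \<le> Pr l x" by (rule Pr_ge[OF jN]) (rule cone_nonneg[OF cone])
    finally show ?thesis using inv[OF x] by simp
  qed
  show ?thesis using cone inv pos by blast
qed

end

section \<open>Forward invariant sets\<close>

lemma measure_image_ge:
  fixes \<psi> D :: "real \<Rightarrow> real"
  assumes A: "A \<in> sets lebesgue" "A \<subseteq> {a..b}"
    and D: "\<And>x. x \<in> {a..b} \<Longrightarrow> (\<psi> has_real_derivative D x) (at x)"
    and inj: "inj_on \<psi> {a..b}"
    and cont: "continuous_on {a..b} (\<lambda>x. \<bar>D x\<bar>)"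
    and ge: "\<And>x. x \<in> {a..b} \<Longrightarrow> \<kappa> \<le> \<bar>D x\<bar>"
  shows "\<psi> ` A \<in> lmeasurable" "\<kappa> * measure lebesgue A \<le> measure lebesgue (\<psi> ` A)"
proof -
  have Alm: "A \<in> lmeasurable"
    using A by (intro bounded_set_imp_lmeasurable bounded_subset[OF bounded_closed_interval A(2)]) auto
  have abs: "(\<lambda>x. \<bar>D x\<bar> *\<^sub>R (1::real)) absolutely_integrable_on A"
  proof -
    have "(\<lambda>x. \<bar>D x\<bar>) absolutely_integrable_on {a..b}"
      by (rule absolutely_integrable_continuous_real[OF cont])
    then have "(\<lambda>x. \<bar>D x\<bar>) absolutely_integrable_on A"
      by (rule set_integrable_subset) (use A in auto)
    then show ?thesis by simp
  qed
  have *: "(\<lambda>_. 1::real) absolutely_integrable_on \<psi> ` A \<and>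
     integral (\<psi> ` A) (\<lambda>_. 1::real) = integral A (\<lambda>x. \<bar>D x\<bar> *\<^sub>R (1::real))"
  proof (subst has_absolute_integral_change_of_variables_real[where g=\<psi> and f="\<lambda>_. 1::real" and h=D, symmetric])
    show "(\<psi> has_real_derivative D x) (at x within A)" if "x \<in> A" for x
      using D[OF subsetD[OF A(2) that]] by (rule has_field_derivative_at_within)
    show "inj_on \<psi> A" using inj A inj_on_subset by blast
  qed (use A abs in auto)
  then show lm: "\<psi> ` A \<in> lmeasurable"
    by (simp add: lmeasurable_iff_integrable_on absolutely_integrable_on_def)
  have "\<kappa> * measure lebesgue A = integral A (\<lambda>_. \<kappa> * 1)"
    unfolding integral_mult_right lmeasure_integral[OF Alm] ..
  also have "\<dots> \<le> integral A (\<lambda>x. \<bar>D x\<bar> *\<^sub>R (1::real))"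
  proof (rule integral_le)
    show "(\<lambda>_. \<kappa> * 1) integrable_on A" using integrable_on_const[OF Alm] by simp
    show "(\<lambda>x. \<bar>D x\<bar> *\<^sub>R (1::real)) integrable_on A"
      using abs by (rule set_lebesgue_integral_eq_integral(1))
    show "\<kappa> * 1 \<le> \<bar>D x\<bar> *\<^sub>R (1::real)" if "x \<in> A" for x using ge[of x] that A by auto
  qed
  also have "\<dots> = measure lebesgue (\<psi> ` A)" using * lmeasure_integral[OF lm] by simp
  finally show "\<kappa> * measure lebesgue A \<le> measure lebesgue (\<psi> ` A)" .
qed

section \<open>Words, orbits and their inverse branches\<close>

context trapped_system begin

primrec orb :: "nat list \<Rightarrow> real \<Rightarrow> real" where
  "orb [] y = y"
| "orb (j # w) y = orb w (T j y)"

primrec stays :: "nat list \<Rightarrow> real \<Rightarrow> bool" where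
  "stays [] y \<longleftrightarrow> y \<in> X"
| "stays (j # w) y \<longleftrightarrow> y \<in> X \<and> stays w (T j y)"

primrec dorb :: "nat list \<Rightarrow> real \<Rightarrow> real" where
  "dorb [] y = 1"
| "dorb (j # w) y = \<bar>deriv (T j) y\<bar> * dorb w (T j y)"

definition regular :: "real set" where "regular = {y. \<forall>w\<in>lists {1..N}. stays w y}"

lemma orb_append: "orb (v @ w) y = orb w (orb v y)"
  by (induction v arbitrary: y) auto

lemma dorb_append: "dorb (v @ w) y = dorb v y * dorb w (orb v y)"
  by (induction v arbitrary: y) auto

lemma stays_X: "stays w y \<Longrightarrow> y \<in> X" "stays w y \<Longrightarrow> orb w y \<in> X"
  by (induction w arbitrary: y) auto

lemma regularD: "y \<in> regular \<Longrightarrow> y \<in> X" "y \<in> regular \<Longrightarrow> w \<in> lists {1..N} \<Longrightarrow> stays w y"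
  unfolding regular_def by (force dest: bspec[of _ _ "[]"])+

lemma regular_T: "y \<in> regular \<Longrightarrow> j \<in> {1..N} \<Longrightarrow> T j y \<in> regular"
  unfolding regular_def by (auto dest!: bspec[of _ _ "j # _"])

lemma regular_orb: "y \<in> regular \<Longrightarrow> w \<in> lists {1..N} \<Longrightarrow> orb w y \<in> regular"
proof (induction w arbitrary: y)
  case (Cons j w)
  then have "j \<in> {1..N}" "w \<in> lists {1..N}" by auto
  with Cons.IH regular_T[OF Cons.prems(1)] show ?case by simp
qed simp

text \<open>There are only countably many words, and nonsingularity moves an exceptional null set
  back through one map at a time. \<open>R\<close> carries the information needed along a single
  step.\<close>

lemma AE_words:
  assumes step: "AE y in L. \<forall>j\<in>{1..N}. R y (T j y)" and base: "AE y in L. Q [] y"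
    and Q: "\<And>j w y. j \<in> {1..N} \<Longrightarrow> R y (T j y) \<Longrightarrow> Q [] y \<Longrightarrow> Q w (T j y) \<Longrightarrow> Q (j # w) y"
  shows "AE y in L. \<forall>w\<in>lists {1..N}. Q w y"
proof -
  have one: "w \<in> lists {1..N} \<Longrightarrow> AE y in L. Q w y" for w
  proof (induction w)
    case (Cons j w)
    then have "AE y in L. \<forall>j\<in>{1..N}. Q w (T j y)" by (intro AE_T) auto
    with step base show ?case
    proof eventually_elim
      case (elim y)
      have "j \<in> {1..N}" using Cons.prems by simp
      then show ?case using Q[of j y w] elim by blast
    qed
  qed (use base in simp)
  have "AE y in L. \<forall>w. w \<in> lists {1..N} \<longrightarrow> Q w y"
    unfolding AE_all_countable using one by auto
  then show ?thesis by (rule AE_mp) simp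
qed

lemma AE_regular: "AE y in L. y \<in> regular"
  using AE_words[of "\<lambda>_ _. True" stays] AE_X by (simp add: regular_def)

text \<open>A positive hitting probability yields an actual word, letter by letter.\<close>

lemma reach_K:
  assumes "y \<in> X"
  shows "\<exists>w\<in>lists {1..N}. orb w y \<in> K"
proof -
  have "0 < hit n x \<Longrightarrow> \<exists>w\<in>lists {1..N}. orb w x \<in> K" for n x
  proof (induction n arbitrary: x)
    case 0
    then have "orb [] x \<in> K" by (auto split: split_indicator_asm)
    then show ?case by blast
  next
    case (Suc n)
    show ?case
    proof (cases "x \<in> K")
      case True
      then have "orb [] x \<in> K" by simp
      then show ?thesis by blast
    next
      case False
      then have "0 < (\<Sum>j\<in>{1..N}. p j * hit n (T j x))" using Suc.prems by simp
      then obtain j where j: "j \<in> {1..N}" "0 < p j * hit n (T j x)"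
        by (meson not_le sum_nonpos)
      then have "0 < hit n (T j x)" using p_pos[OF j(1)] by (simp add: zero_less_mult_iff)
      from Suc.IH[OF this] obtain w where "w \<in> lists {1..N}" "orb w (T j x) \<in> K" by blast
      then show ?thesis using j by (intro bexI[of _ "j # w"]) auto
    qed
  qed
  moreover obtain n where "0 < hit n y"
    using order_tendstoD(1)[OF hit_tendsto[OF assms], of 0] by (auto simp: eventually_sequentially)
  ultimately show ?thesis by blast
qed

lemma dorb_nonneg: "0 \<le> dorb w y"
  by (induction w arbitrary: y) auto

lemma rho_word_expansion:
  assumes "w \<in> lists {1..N}" "stays w y"
  shows "\<rho> y \<le> dorb w y * \<rho> (orb w y)"
  using assms
proof (induction w arbitrary: y)
  case (Cons j w)
  then have "\<rho> y \<le> \<bar>deriv (T j) y\<bar> * \<rho> (T j y)"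
    by (intro rho_weak_expansion) (auto dest: stays_X)
  also have "\<dots> \<le> \<bar>deriv (T j) y\<bar> * (dorb w (T j y) * \<rho> (orb w (T j y)))"
    using Cons by (intro mult_left_mono) auto
  finally show ?case by simp
qed simp

text \<open>Compactness: the end distance of the image is continuous and positive on the two closed
  cores that contain \<open>K\<close>. This supplies the \<open>d\<close> in
  \<open>rho_strict_expansion\<close>.\<close>

lemma good_image_of_K_away_from_ends:
  assumes j: "j \<in> good"
  shows "\<exists>d>0. \<forall>y\<in>K. d \<le> T j y \<and> T j y \<le> 1 - d"
proof -
  have jN: "j \<in> {1..N}" using j good_subset by blast
  define m where "m = min \<delta> \<delta>'"
  have m: "0 < m" using trap_pos by (simp add: m_def)
  have one: "\<exists>d>0. \<forall>y\<in>{lo b + m..hi b - m}. d \<le> end_dist (T j y)" for b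
  proof (cases "lo b + m \<le> hi b - m")
    case True
    have sub: "{lo b + m..hi b - m} \<subseteq> side b" using m by auto
    have cont: "continuous_on {lo b + m..hi b - m} (\<lambda>y. end_dist (T j y))"
      unfolding end_dist_def by (intro continuous_intros continuous_on_subset[OF T_cont[OF jN] sub])
    obtain z where z: "z \<in> {lo b + m..hi b - m}" "\<And>y. y \<in> {lo b + m..hi b - m} \<Longrightarrow> end_dist (T j z) \<le> end_dist (T j y)"
      using continuous_attains_inf[OF _ _ cont] True by auto
    have "T j z \<in> {0<..<1}" using T_in_unit[OF jN] z(1) sub X_side(2) by blast
    then have "0 < end_dist (T j z)" by (simp add: end_dist_X)
    with z show ?thesis by blast
  qed (auto intro: exI[of _ 1])
  obtain d0 d1 where d: "0 < d0" "0 < d1" "\<forall>y\<in>{lo False + m..hi False - m}. d0 \<le> end_dist (T j y)"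
    "\<forall>y\<in>{lo True + m..hi True - m}. d1 \<le> end_dist (T j y)" using one by meson
  have "min d0 d1 \<le> end_dist (T j y)" if y: "y \<in> K" for y
  proof -
    have "y \<in> X" using y K_sub by blast
    then obtain b where "y \<in> side b" using X_side(2) by blast
    then have "y \<in> {lo b + m..hi b - m}" using K_side[OF y] by (simp add: m_def)
    then show ?thesis using d by (cases b) (force simp: min_le_iff_disj)+
  qed
  then have "min d0 d1 \<le> T j y \<and> T j y \<le> 1 - min d0 d1" if "y \<in> K" for y
    using that unfolding end_dist_def by fastforce
  then show ?thesis using d by (intro exI[of _ "min d0 d1"]) simp
qed

text \<open>Only good maps applied on \<open>K\<close> give a definite expansion of the hyperbolic metric, and \<open>K\<close> is reached from every regular point.\<close>

lemma expanding_words: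
  obtains \<theta> where "1 < \<theta>" "\<And>y n. y \<in> regular \<Longrightarrow> \<exists>w\<in>lists {1..N}. orb w y \<in> K \<and> \<theta> ^ n * \<rho> y \<le> dorb w y * \<rho> (orb w y)"
proof -
  obtain j where j: "j \<in> good" using good_subset by blast
  then have jN: "j \<in> {1..N}" using good_subset by blast
  obtain d where d: "0 < d" "\<And>y. y \<in> K \<Longrightarrow> d \<le> T j y \<and> T j y \<le> 1 - d"
    using good_image_of_K_away_from_ends[OF j] by blast
  define \<theta> where "\<theta> = 1 + d * min c (1 - c)"
  have \<theta>: "1 < \<theta>" using d c0 c1 by (simp add: \<theta>_def)
  have "\<exists>w\<in>lists {1..N}. orb w y \<in> K \<and> \<theta> ^ n * \<rho> y \<le> dorb w y * \<rho> (orb w y)" if y: "y \<in> regular" for y n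
  proof (induction n)
    case 0
    obtain w where "w \<in> lists {1..N}" "orb w y \<in> K" using reach_K regularD(1)[OF y] by blast
    then show ?case using rho_word_expansion regularD(2)[OF y] by (intro bexI[of _ w]) auto
  next
    case (Suc n)
    then obtain w where w: "w \<in> lists {1..N}" "orb w y \<in> K" "\<theta> ^ n * \<rho> y \<le> dorb w y * \<rho> (orb w y)" by blast
    define z where "z = orb w y"
    have z: "z \<in> regular" "z \<in> K" using regular_orb[OF y w(1)] w by (auto simp: z_def)
    have Tz: "T j z \<in> regular" by (rule regular_T[OF z(1) jN])
    obtain v where v: "v \<in> lists {1..N}" "orb v (T j z) \<in> K" using reach_K regularD(1)[OF Tz] by blast
    have "\<theta> * \<rho> z \<le> \<bar>deriv (T j) z\<bar> * \<rho> (T j z)"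
      unfolding \<theta>_def using rho_strict_expansion[OF j] regularD(1) z Tz d by blast
    also have "\<dots> \<le> \<bar>deriv (T j) z\<bar> * (dorb v (T j z) * \<rho> (orb v (T j z)))"
      using rho_word_expansion[OF v(1)] regularD(2)[OF Tz v(1)] by (intro mult_left_mono) auto
    finally have "\<theta> * \<rho> z \<le> dorb (j # v) z * \<rho> (orb (j # v) z)" by simp
    then have a: "dorb w y * (\<theta> * \<rho> z) \<le> dorb w y * (dorb (j # v) z * \<rho> (orb (j # v) z))"
      by (rule mult_left_mono) (rule dorb_nonneg)
    have "\<theta> ^ Suc n * \<rho> y = \<theta> * (\<theta> ^ n * \<rho> y)" by simp
    also have "\<dots> \<le> \<theta> * (dorb w y * \<rho> z)" using w(3) \<theta> by (intro mult_left_mono) (auto simp: z_def)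
    also have "\<dots> \<le> dorb (w @ j # v) y * \<rho> (orb (w @ j # v) y)"
      using a by (simp add: orb_append dorb_append z_def mult_ac)
    finally show ?case using w v jN by (intro bexI[of _ "w @ j # v"]) (auto simp: orb_append z_def)
  qed
  with \<theta> show thesis using that by blast
qed

text \<open>The side that contains \<open>T j y\<close> lies entirely in the range of the branch
  used at \<open>y\<close>, so the inverse of a word of any length is defined on a whole side. The
  last clause, with the constant 1 for \<open>g\<close>, puts \<open>|D|\<close> in the cone and so
  bounds the distortion independently of the length.\<close>

lemma inverse_word:
  assumes "w \<in> lists {1..N}" "stays w y" "orb w y \<in> side i"
  shows "\<exists>f D i'. y \<in> side i' \<and> f (orb w y) = y \<and> \<bar>D (orb w y)\<bar> * dorb w y = 1 \<and>
     (\<forall>x\<in>side i. (f has_real_derivative D x) (at x) \<and> f x \<in> side i' \<and> orb w (f x) = x) \<and>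
     (\<forall>g. (\<forall>b. koebe_cone (lo b) (hi b) g) \<longrightarrow> koebe_cone (lo i) (hi i) (\<lambda>x. \<bar>D x\<bar> * g (f x)))"
  using assms
proof (induction w arbitrary: y)
  case Nil
  then show ?case by (intro exI[of _ "\<lambda>x. x"] exI[of _ "\<lambda>_. 1"] exI[of _ i]) auto
next
  case (Cons j w)
  then have jN: "j \<in> {1..N}" and w: "w \<in> lists {1..N}" and y: "y \<in> X" "stays w (T j y)" and o: "orb w (T j y) \<in> side i"
    by auto
  obtain f D i' where IH: "T j y \<in> side i'" "f (orb w (T j y)) = T j y" "\<bar>D (orb w (T j y))\<bar> * dorb w (T j y) = 1"
    "\<And>x. x \<in> side i \<Longrightarrow> (f has_real_derivative D x) (at x)" "\<And>x. x \<in> side i \<Longrightarrow> f x \<in> side i'"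
    "\<And>x. x \<in> side i \<Longrightarrow> orb w (f x) = x"
    "\<And>g. (\<And>b. koebe_cone (lo b) (hi b) g) \<Longrightarrow> koebe_cone (lo i) (hi i) (\<lambda>x. \<bar>D x\<bar> * g (f x))"
    using Cons.IH[OF y(2) o] by blast
  obtain b where b: "y \<in> side b" using y X_side(2) by blast
  have sub: "side i' \<subseteq> rng j b" using rng_cases(5)[OF jN, of i' b] IH(1) psi_inverse(3)[OF jN b] by blast
  have "\<forall>x\<in>rng j b. \<exists>d. (\<psi> j b has_real_derivative d) (at x) \<and> \<bar>d\<bar> = wt j b x"
    using psi_has_derivative[OF jN] by blast
  from bchoice[OF this] obtain d where d: "\<And>x. x \<in> rng j b \<Longrightarrow> (\<psi> j b has_real_derivative d x) (at x)"
    "\<And>x. x \<in> rng j b \<Longrightarrow> \<bar>d x\<bar> = wt j b x" by blast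
  define f' D' where "f' x = \<psi> j b (f x)" and "D' x = d (f x) * D x" for x
  have absD': "\<bar>D' x\<bar> = wt j b (f x) * \<bar>D x\<bar>" if "x \<in> side i" for x
    using d(2)[of "f x"] IH(5)[OF that] sub by (auto simp: D'_def abs_mult)
  show ?case
  proof (intro exI conjI ballI allI impI)
    show "y \<in> side b" by (rule b)
    show "f' (orb (j # w) y) = y" using IH(2) psi_inverse(4)[OF jN b] by (simp add: f'_def)
    have r: "T j y \<in> rng j b" by (rule psi_inverse(3)[OF jN b])
    have 1: "wt j b (T j y) * \<bar>deriv (T j) y\<bar> = 1"
      using r psi_inverse(4)[OF jN b] T_deriv(2)[OF jN y(1)] by (simp add: wt_def)
    have "\<bar>D' (orb w (T j y))\<bar> * (\<bar>deriv (T j) y\<bar> * dorb w (T j y))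
        = (wt j b (T j y) * \<bar>deriv (T j) y\<bar>) * (\<bar>D (orb w (T j y))\<bar> * dorb w (T j y))"
      unfolding absD'[OF o] IH(2) by (simp only: mult_ac)
    then show "\<bar>D' (orb (j # w) y)\<bar> * dorb (j # w) y = 1" unfolding 1 IH(3) by simp
    fix x assume x: "x \<in> side i"
    have fx: "f x \<in> rng j b" using IH(5)[OF x] sub by blast
    show "(f' has_real_derivative D' x) (at x)"
      unfolding f'_def[abs_def] D'_def using DERIV_chain2[OF d(1)[OF fx] IH(4)[OF x]] by simp
    show "f' x \<in> side b" unfolding f'_def by (rule psi_inverse(1)[OF jN fx])
    show "orb (j # w) (f' x) = x" using psi_inverse(2)[OF jN fx] IH(6)[OF x] by (simp add: f'_def)
  next
    fix g assume g: "\<forall>b. koebe_cone (lo b) (hi b) g"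
    have "koebe_cone (lo i) (hi i) (\<lambda>x. \<bar>D x\<bar> * (wt j b (f x) * g (\<psi> j b (f x))))"
      by (rule IH(7)[of "\<lambda>x. wt j b x * g (\<psi> j b x)"]) (use g in \<open>auto intro: koebe_cone_branch[OF jN]\<close>)
    then show "koebe_cone (lo i) (hi i) (\<lambda>x. \<bar>D' x\<bar> * g (f' x))"
      by (rule koebe_cone_cong) (use absD' in \<open>auto simp: f'_def mult_ac\<close>)
  qed
qed

text \<open>The cores with \<open>m = 1 / (n + 1)\<close> exhaust the side; if \<open>E\<close>
  filled each of them up to a null set, it would fill the side.\<close>

lemma compact_core_of_non_full_side:
  assumes E: "E \<in> sets L" and nonnull: "\<not> (AE y in L. y \<in> side i \<longrightarrow> y \<in> E)"
  shows "\<exists>m>0. 0 < measure lebesgue ({lo i + m..hi i - m} - E)"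
proof (rule ccontr)
  assume contra: "\<not> ?thesis"
  let ?A = "\<lambda>m. {lo i + m..hi i - m} - E"
  have Em: "E \<in> sets borel" using E by (simp add: sets_L)
  have null: "emeasure lborel (?A (inverse (real (Suc n)))) = 0" for n
  proof -
    have lm: "?A (inverse (real (Suc n))) \<in> lmeasurable"
      using Em by (intro bounded_set_imp_lmeasurable bounded_subset[OF bounded_closed_interval]) auto
    have "measure lebesgue (?A (inverse (real (Suc n)))) = 0"
      using contra measure_nonneg[of lebesgue "?A (inverse (real (Suc n)))"]
      by (metis inverse_positive_iff_positive of_nat_0_less_iff order_le_less zero_less_Suc)
    then have "emeasure lebesgue (?A (inverse (real (Suc n)))) = 0"
      using emeasure_eq_measure2[OF lm] by simp
    then show ?thesis using Em by simp
  qed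
  have "AE y in lborel. \<forall>n. y \<notin> ?A (inverse (real (Suc n)))"
    unfolding AE_all_countable
  proof
    fix n
    show "AE y in lborel. y \<notin> ?A (inverse (real (Suc n)))"
      by (rule AE_not_in) (use null Em in \<open>auto simp: null_sets_def\<close>)
  qed
  then have "AE y in lborel. y \<in> side i \<longrightarrow> y \<in> E"
  proof eventually_elim
    case (elim y)
    show ?case
    proof
      assume y: "y \<in> side i"
      obtain n where "inverse (real (Suc n)) < min (y - lo i) (hi i - y)"
        using reals_Archimedean[of "min (y - lo i) (hi i - y)"] y by auto
      then show "y \<in> E" using elim by (auto dest!: spec[of _ n])
    qed
  qed
  then have "AE y in L. y \<in> side i \<longrightarrow> y \<in> E"
    unfolding L_def by (subst AE_restrict_space_iff) auto
  with nonnull show False by simp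
qed

text \<open>If a positive part of both compact cores \<open>I i\<close> avoided \<open>E\<close>, then by bounded distortion arbitrarily small inverse images
  of the cores around every point of \<open>E\<close> would miss \<open>E\<close> in a fixed proportion.\<close>

lemma forward_invariant_zero_one:
  assumes E: "E \<in> sets L" and inv: "AE y in L. y \<in> E \<longrightarrow> (\<forall>j\<in>{1..N}. T j y \<in> E)"
    and pos: "\<not> (AE y in L. y \<notin> E)"
  shows "AE y in L. y \<in> E"
proof -
  have "\<exists>i. AE y in L. y \<in> side i \<longrightarrow> y \<in> E"
  proof (rule ccontr)
    assume "\<not> ?thesis"
    then have "\<exists>m>0. 0 < measure lebesgue ({lo i + m..hi i - m} - E)" for i
      using compact_core_of_non_full_side[OF E] by blast
    then obtain M where M: "\<And>i. 0 < M i" "\<And>i. 0 < measure lebesgue ({lo i + M i..hi i - M i} - E)" by metis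
    define m where "m = Min {\<delta>, \<delta>', M False, M True}"
    have m: "0 < m" "m \<le> \<delta>" "m \<le> \<delta>'" "m \<le> M i" for i
      using M(1)[of False] M(1)[of True] trap_pos by (cases i; auto simp: m_def)+
    define I where "I i = {lo i + m..hi i - m}" for i
    have Em: "E \<in> sets borel" using E by (simp add: sets_L)
    have Ilm: "I i - E \<in> lmeasurable" for i
      unfolding I_def using Em by (intro bounded_set_imp_lmeasurable bounded_subset[OF bounded_closed_interval]) auto
    have gap: "0 < measure lebesgue (I i - E)" for i
    proof -
      have "measure lebesgue ({lo i + M i..hi i - M i} - E) \<le> measure lebesgue (I i - E)"
        using Em m(4)[of i] Ilm by (intro measure_mono_fmeasurable) (auto simp: I_def)
      with M(2)[of i] show ?thesis by simp
    qed
    have Iside: "I i \<subseteq> side i" for i using m by (auto simp: I_def)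
    define C where "C i = ((hi i - lo i) / m)\<^sup>2" for i
    have C: "0 < C i" for i using m side_bounds(1)[of i] by (simp add: C_def)
    \<comment> \<open>One factor \<open>C i\<close> is lost in the upper bound for the length of the
      image of the core, the other in the lower bound for the derivative on the gap.\<close>
    define \<epsilon>' where "\<epsilon>' i = measure lebesgue (I i - E) / (C i)\<^sup>2" for i
    define \<epsilon> where "\<epsilon> = min (\<epsilon>' False) (\<epsilon>' True)"
    have \<epsilon>': "0 < \<epsilon>' i" for i unfolding \<epsilon>'_def by (intro divide_pos_pos zero_less_power gap C)
    have \<epsilon>: "0 < \<epsilon>" "\<epsilon> \<le> \<epsilon>' i" for i using \<epsilon>' by (cases i; simp add: \<epsilon>_def)+
    have inv': "AE y in L. \<forall>j\<in>{1..N}. y \<in> E \<longrightarrow> T j y \<in> E" using inv by (auto elim: AE_mp)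
    have "AE y in L. \<forall>w\<in>lists {1..N}. y \<in> E \<longrightarrow> orb w y \<in> E"
      by (rule AE_words[where R="\<lambda>y z. y \<in> E \<longrightarrow> z \<in> E", OF inv']) auto
    then have "AE y in L. y \<in> regular \<and> (\<forall>w\<in>lists {1..N}. y \<in> E \<longrightarrow> orb w y \<in> E)"
      using AE_regular by (auto elim: AE_mp)
    then obtain Z where Z: "{y \<in> space L. \<not> (y \<in> regular \<and> (\<forall>w\<in>lists {1..N}. y \<in> E \<longrightarrow> orb w y \<in> E))} \<subseteq> Z"
      "emeasure L Z = 0" "Z \<in> sets L"
      by (rule AE_E)
    \<comment> \<open>Discarding a null set leaves points that are regular and whose orbits under
      all words remain in \<open>E\<close>.\<close>
    define E0 where "E0 = E - Z"
    have E0: "E0 \<subseteq> {0..1}" "E0 \<in> sets borel" using E Z by (auto simp: E0_def sets_L)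
    have E0lm: "E0 \<in> lmeasurable"
      using E0 by (intro bounded_set_imp_lmeasurable bounded_subset[OF bounded_closed_interval[of 0 1]]) auto
    have E0D: "y \<in> regular" "w \<in> lists {1..N} \<Longrightarrow> orb w y \<in> E" if "y \<in> E0" for y w
    proof -
      have "y \<in> space L" "y \<in> E" "y \<notin> Z" using that E0(1) by (auto simp: E0_def)
      then have "y \<in> regular \<and> (\<forall>w\<in>lists {1..N}. y \<in> E \<longrightarrow> orb w y \<in> E)" using Z(1) by blast
      with \<open>y \<in> E\<close> show "y \<in> regular" "w \<in> lists {1..N} \<Longrightarrow> orb w y \<in> E" by blast+
    qed
    obtain \<theta> where \<theta>: "1 < \<theta>"
      and words: "\<And>y n. y \<in> regular \<Longrightarrow> \<exists>w\<in>lists {1..N}. orb w y \<in> K \<and> \<theta> ^ n * \<rho> y \<le> dorb w y * \<rho> (orb w y)"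
      using expanding_words by blast
    have "negligible E0"
    proof (rule null_of_uniform_gaps[OF E0lm \<epsilon>(1)])
      fix y r0 :: real assume y: "y \<in> E0" and r0: "0 < r0"
      have yr: "y \<in> regular" by (rule E0D[OF y])
      then have yX: "y \<in> X" by (rule regularD)
      \<comment> \<open>On a core \<rho> is at most \<open>1 / m^2\<close>, so the image of the core
        has length at most \<open>B / \<theta> ^ n\<close>. The sum of both constants is used
        because the side \<open>i\<close> is known only after \<open>n\<close> and the word are
        chosen.\<close>
      define B where "B = (C False + C True) / (m\<^sup>2 * \<rho> y)"
      have B0: "0 < B" using C m rho_pos[OF yX] by (simp add: B_def add_pos_pos)
      obtain n where n: "B / r0 < \<theta> ^ n" using real_arch_pow[OF \<theta>] by blast
      obtain w where w: "w \<in> lists {1..N}" "orb w y \<in> K" "\<theta> ^ n * \<rho> y \<le> dorb w y * \<rho> (orb w y)"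
        using words[OF yr] by blast
      have st: "stays w y" by (rule regularD(2)[OF yr w(1)])
      define x where "x = orb w y"
      obtain i where xs: "x \<in> side i" using stays_X(2)[OF st] X_side(2) by (auto simp: x_def)
      have xI: "x \<in> I i" using K_side[of x i] w(2) xs m by (auto simp: I_def x_def min_def split: if_splits)
      obtain f D i' where f: "f x = y" "\<bar>D x\<bar> * dorb w y = 1"
        "\<And>x. x \<in> side i \<Longrightarrow> (f has_real_derivative D x) (at x)" "\<And>x. x \<in> side i \<Longrightarrow> orb w (f x) = x"
        "\<And>g. (\<And>b. koebe_cone (lo b) (hi b) g) \<Longrightarrow> koebe_cone (lo i) (hi i) (\<lambda>x. \<bar>D x\<bar> * g (f x))"
        using inverse_word[OF w(1) st xs[unfolded x_def]] unfolding x_def[symmetric] by blast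
      have coneD: "koebe_cone (lo i) (hi i) (\<lambda>x. \<bar>D x\<bar>)"
        using f(5)[of "\<lambda>_. 1"] koebe_cone_const[of 1] by simp
      have upper: "\<bar>D u\<bar> \<le> \<bar>D x\<bar> * C i" and lower: "\<bar>D x\<bar> / C i \<le> \<bar>D u\<bar>" if "u \<in> I i" for u
      proof -
        show "\<bar>D u\<bar> \<le> \<bar>D x\<bar> * C i"
          unfolding C_def by (rule koebe_cone_compare[OF coneD m(1)]) (use that xI in \<open>auto simp: I_def\<close>)
        have "\<bar>D x\<bar> \<le> \<bar>D u\<bar> * C i"
          unfolding C_def by (rule koebe_cone_compare[OF coneD m(1)]) (use that xI in \<open>auto simp: I_def\<close>)
        then show "\<bar>D x\<bar> / C i \<le> \<bar>D u\<bar>" using C[of i] by (simp add: pos_divide_le_eq)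
      qed
      have Dx: "0 < \<bar>D x\<bar>" using f(2) by (cases "D x = 0") auto
      have inj: "inj_on f (I i)" by (rule inj_on_inverseI[of _ "orb w"]) (use f(4) Iside in blast)
      have cont: "continuous_on (I i) f"
        by (rule continuous_at_imp_continuous_on) (use f(3) Iside DERIV_isCont in blast)
      have le: "lo i + m < hi i - m"
      proof (rule ccontr)
        assume "\<not> lo i + m < hi i - m"
        then have "I i - E \<subseteq> {lo i + m}" by (auto simp: I_def)
        then have "measure lebesgue (I i - E) = 0"
          by (meson negligible_imp_measure0 negligible_sing negligible_subset)
        with gap[of i] show False by simp
      qed
      obtain s t where st': "f ` I i = {s..t}" "s \<le> t"
        using continuous_image_closed_interval[of "lo i + m" "hi i - m" f] le cont unfolding I_def by auto
      have "lo i + m \<in> I i" "hi i - m \<in> I i" using le by (auto simp: I_def)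
      then have "f (lo i + m) \<noteq> f (hi i - m)" using inj_onD[OF inj, of "lo i + m" "hi i - m"] le by auto
      moreover have "f (lo i + m) \<in> {s..t}" "f (hi i - m) \<in> {s..t}" using st' le unfolding I_def by force+
      ultimately have "s < t" by auto
      have len: "t - s \<le> \<bar>D x\<bar> * C i"
      proof -
        obtain u v where uv: "u \<in> I i" "f u = s" "v \<in> I i" "f v = t"
          using st' by (metis atLeastAtMost_iff imageE order_refl)
        have "norm (f v - f u) \<le> \<bar>D x\<bar> * C i * norm (v - u)"
        proof (rule field_differentiable_bound[of "I i"])
          show "(f has_field_derivative D z) (at z within I i)" if "z \<in> I i" for z
            using f(3)[OF subsetD[OF Iside that]] by (rule has_field_derivative_at_within)
          show "norm (D z) \<le> \<bar>D x\<bar> * C i" if "z \<in> I i" for z using upper[OF that] by simp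
        qed (use uv in \<open>auto simp: I_def\<close>)
        also have "\<dots> \<le> \<bar>D x\<bar> * C i * 1"
          using uv side_bounds(2,3)[of i] m(1) C[of i] by (intro mult_left_mono) (auto simp: I_def)
        finally show ?thesis using uv \<open>s < t\<close> by simp
      qed
      define u where "u = (s + t) / 2"
      define r where "r = (t - s) / 2"
      have ball: "cball u r = {s..t}" unfolding u_def r_def cball_eq_atLeastAtMost by (simp add: field_simps)
      have "0 < r" using \<open>s < t\<close> by (simp add: r_def)
      moreover have "r < r0"
      proof -
        have rx: "\<rho> x \<le> 1 / m\<^sup>2"
        proof -
          have "(hi i - lo i) / ((x - lo i) * (hi i - x)) \<le> 1 / (m * m)"
            using xI m(1) side_bounds[of i] by (intro frac_le mult_mono mult_pos_pos) (auto simp: I_def)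
          then show ?thesis using rho_side[OF xs] by (simp add: power2_eq_square)
        qed
        have "\<theta> ^ n * \<rho> y * \<bar>D x\<bar> \<le> \<bar>D x\<bar> * dorb w y * \<rho> x"
          using mult_right_mono[OF w(3), of "\<bar>D x\<bar>"] by (simp add: x_def mult_ac)
        also have "\<dots> \<le> 1 / m\<^sup>2" using f(2) rx by simp
        finally have "\<bar>D x\<bar> \<le> 1 / (m\<^sup>2 * \<rho> y) / \<theta> ^ n"
          using rho_pos[OF yX] \<theta> m(1) by (simp add: field_simps)
        then have "\<bar>D x\<bar> * C i \<le> 1 / (m\<^sup>2 * \<rho> y) / \<theta> ^ n * (C False + C True)"
          using C[of False] C[of True] rho_pos[OF yX] m(1) \<theta> by (intro mult_mono) (cases i; auto)+
        also have "\<dots> = B / \<theta> ^ n" by (simp add: B_def)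
        also have "\<dots> < r0" using n r0 \<theta> by (simp add: field_simps)
        finally show ?thesis using len \<open>s < t\<close> by (simp add: r_def)
      qed
      moreover have "y \<in> cball u r" unfolding ball st'(1)[symmetric] using f(1) xI by blast
      moreover have "\<epsilon> * measure lebesgue (cball u r) \<le> measure lebesgue (cball u r - E0)"
      proof -
        \<comment> \<open>The word maps such a point back into \<open>I i - E\<close>, whereas it
          maps points of \<open>E0\<close> into \<open>E\<close>.\<close>
        have img: "f ` (I i - E) \<subseteq> cball u r - E0"
        proof
          fix z assume "z \<in> f ` (I i - E)"
          then obtain v where v: "v \<in> I i" "v \<notin> E" "z = f v" by blast
          have "orb w z = v" using f(4) v Iside by blast
          then have "z \<notin> E0" using E0D(2)[of z w] w(1) v by auto
          moreover have "z \<in> cball u r" unfolding ball st'(1)[symmetric] using v by blast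
          ultimately show "z \<in> cball u r - E0" by blast
        qed
        have contD: "continuous_on (I i) (\<lambda>x. \<bar>D x\<bar>)"
          using koebe_cone_lipschitz[OF coneD m(1)] lipschitz_on_continuous_on unfolding I_def by blast
        have fD: "(f has_real_derivative D z) (at z)" if "z \<in> I i" for z
          using f(3)[OF subsetD[OF Iside that]] .
        have IE: "I i - E \<in> sets lebesgue" "I i - E \<subseteq> I i" using Ilm by auto
        note im = measure_image_ge[of "I i - E" "lo i + m" "hi i - m" f D "\<bar>D x\<bar> / C i", folded I_def,
            OF IE fD inj contD lower]
        note im1 = im(1) and im2 = im(2)
        have "\<epsilon> * measure lebesgue (cball u r) = \<epsilon> * (t - s)" unfolding ball using \<open>s < t\<close> by simp
        also have "\<dots> \<le> \<epsilon>' i * (t - s)" using \<epsilon>(2) \<open>s < t\<close> by (intro mult_right_mono) auto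
        also have "\<dots> \<le> \<epsilon>' i * (\<bar>D x\<bar> * C i)" using len \<epsilon>' by (intro mult_left_mono) (auto intro: less_imp_le)
        also have "\<epsilon>' i * (\<bar>D x\<bar> * C i) = \<bar>D x\<bar> / C i * measure lebesgue (I i - E)"
          using C[of i] by (simp add: \<epsilon>'_def power2_eq_square)
        also note im2
        also have "measure lebesgue (f ` (I i - E)) \<le> measure lebesgue (cball u r - E0)"
          using img im1 E0lm by (intro measure_mono_fmeasurable) (auto intro: fmeasurable.Diff)
        finally show ?thesis .
      qed
      ultimately show "\<exists>u r. 0 < r \<and> r < r0 \<and> y \<in> cball u r \<and> \<epsilon> * measure lebesgue (cball u r) \<le> measure lebesgue (cball u r - E0)"
        by blast
    qed
    then have "emeasure lborel E0 = 0"
      using E0 by (simp add: negligible_iff_null_sets null_sets_def)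
    then have "AE y in L. y \<notin> E0"
      using E0 by (intro AE_not_in) (auto simp: null_sets_def emeasure_L sets_L)
    moreover have "AE y in L. y \<notin> Z" using Z by (intro AE_not_in) (auto simp: null_sets_def)
    ultimately have "AE y in L. y \<notin> E" by eventually_elim (auto simp: E0_def)
    with pos show False by simp
  qed
  then obtain i where i: "AE y in L. y \<in> side i \<longrightarrow> y \<in> E" by blast
  \<comment> \<open>One full side is enough: a good map sends it onto \<open>(0, 1)\<close>, and
    \<open>E\<close> is forward invariant.\<close>
  obtain j where j: "j \<in> good" using good_subset by blast
  then have jN: "j \<in> {1..N}" using good_subset by blast
  from i inv have "AE y in L. y \<in> side i \<longrightarrow> T j y \<in> E"
    by eventually_elim (use jN in blast)
  from AE_psi[OF this] AE_X show ?thesis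
  proof eventually_elim
    case (elim x)
    have xr: "x \<in> rng j i" using branch_range[OF jN, of i] j elim(2) by (auto simp: X_def)
    then have "T j (\<psi>0 j i x) \<in> E" using elim(1) jN psi0_side[OF jN xr] by blast
    then show "x \<in> E" using psi_inverse(2)[OF jN xr] psi0_eq[OF xr] by simp
  qed
qed

end

section \<open>Uniqueness\<close>

lemma koebe_cone_continuous:
  assumes "koebe_cone a b g"
  shows "continuous_on {a<..<b} g"
proof (rule continuous_at_imp_continuous_on, rule ballI)
  fix x assume x: "x \<in> {a<..<b}"
  define d where "d = min (x - a) (b - x) / 2"
  have d: "0 < d" "x \<in> {a + d<..<b - d}" using x by (auto simp: d_def min_def field_simps)
  obtain M where "M-lipschitz_on {a + d..b - d} g" using koebe_cone_lipschitz[OF assms d(1)] by blast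
  then have "continuous_on {a + d<..<b - d} g"
    by (intro lipschitz_on_continuous_on[OF lipschitz_on_subset]) auto
  then show "isCont g x" using d(2) by (simp add: continuous_on_eq_continuous_at)
qed

text \<open>Positivity is required at every real, so that quotients by \<open>h\<close> and the
  pointwise lower bound on \<open>[0, 1]\<close> make sense also at 0, \<open>c\<close> and
  1.\<close>

locale trapped_density = trapped_system +
  fixes h :: "real \<Rightarrow> real"
  assumes h_koebe_cone: "\<And>i. koebe_cone (lo i) (hi i) h"
    and h_inv: "\<And>x. x \<in> X \<Longrightarrow> Pr h x = h x"
    and h_pos: "\<And>x. 0 < h x"
begin

lemma h_measurable_borel: "h \<in> borel_measurable L"
proof -
  have m: "(\<lambda>x. indicator (side b) x *\<^sub>R h x) \<in> borel_measurable borel" for b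
    by (rule borel_measurable_continuous_on_indicator) (auto intro: koebe_cone_continuous h_koebe_cone)
  have "(\<lambda>x. indicator (side False) x *\<^sub>R h x + indicator (side True) x *\<^sub>R h x
      + (if x = 0 then h 0 else 0) + (if x = c then h c else 0) + (if x = 1 then h 1 else 0))
      \<in> borel_measurable borel"
    by (intro borel_measurable_add m) auto
  then have "(\<lambda>x. indicator (side False) x *\<^sub>R h x + indicator (side True) x *\<^sub>R h x
      + (if x = 0 then h 0 else 0) + (if x = c then h c else 0) + (if x = 1 then h 1 else 0))
      \<in> borel_measurable L" by (rule measurable_L_borel)
  then show ?thesis
    by (rule measurable_cong[THEN iffD1, rotated])
      (use c0 c1 in \<open>auto simp: lo_def hi_def indicator_def\<close>)
qed

lemma h_measurable [measurable]: "(\<lambda>x. ennreal (h x)) \<in> borel_measurable L"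
  using h_measurable_borel by measurable

lemma P_h: "x \<in> X \<Longrightarrow> P (\<lambda>x. ennreal (h x)) x = ennreal (h x)"
  using P_ennreal[of h x] h_inv h_pos by (simp add: less_imp_le)

lemma h_lower: "\<exists>\<epsilon>>0. \<forall>x\<in>{0..1}. \<epsilon> \<le> h x"
proof -
  let ?m = "\<lambda>b. h ((lo b + hi b) / 2) / 4"
  have "Min {?m False, ?m True, h 0, h c, h 1} \<le> h x" if x: "x \<in> {0..1}" for x
  proof (cases "x \<in> X")
    case True
    then obtain b where "x \<in> side b" using X_side by blast
    then have "?m b \<le> h x" using koebe_cone_lower[OF h_koebe_cone[of b], of x] by auto
    then show ?thesis by (cases b) (auto simp: min_le_iff_disj)
  next
    case False
    then have "x = 0 \<or> x = c \<or> x = 1" using x by (auto simp: X_def)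
    then show ?thesis by (auto simp: min_le_iff_disj)
  qed
  then show ?thesis using h_pos by (intro exI[of _ "Min {?m False, ?m True, h 0, h c, h 1}"]) simp
qed

lemma h_bounded_K: "\<exists>B. \<forall>x\<in>K. h x \<le> B"
proof -
  define m where "m = min \<delta> \<delta>'"
  have m: "0 < m" using trap_pos by (simp add: m_def)
  define B where "B b = h (lo b + m) * ((hi b - lo b) / m)\<^sup>2" for b
  have "h x \<le> max (B False) (B True)" if x: "x \<in> K" for x
  proof -
    obtain b where "x \<in> side b" using x K_sub X_side by blast
    then have "lo b + m \<le> x" "x \<le> hi b - m" using K_side[OF x] by (auto simp: m_def)
    then have "h x \<le> B b" unfolding B_def
      by (intro koebe_cone_compare[OF h_koebe_cone m]) auto
    then show ?thesis by (cases b) auto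
  qed
  then show ?thesis by blast
qed

text \<open>The point \<open>y\<close> is a preimage of \<open>T j y\<close> with positive weight,
  so \<open>d y > 0\<close> contributes to \<open>P d\<close> at \<open>T j y\<close>.\<close>

lemma support_invariant:
  assumes d: "AE x in L. P d x = d x"
  shows "AE y in L. 0 < d y \<longrightarrow> (\<forall>j\<in>{1..N}. 0 < d (T j y))"
  using AE_T[OF d] AE_X
proof eventually_elim
  case (elim y)
  show ?case
  proof (intro impI ballI)
    fix j assume dy: "0 < d y" and j: "j \<in> {1..N}"
    obtain b where b: "y \<in> side b" using elim(2) X_side by blast
    have r: "T j y \<in> rng j b" by (rule psi_inverse(3)[OF j b])
    have "0 < ennreal (p j * wt j b (T j y))" using p_pos[OF j] wt_pos[OF j r] by simp
    then have "0 < ennreal (p j * wt j b (T j y)) * d (\<psi>0 j b (T j y))"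
      using dy psi0_eq[OF r] psi_inverse(4)[OF j b] by (simp add: ennreal_zero_less_mult_iff)
    also have "\<dots> \<le> P d (T j y)"
      unfolding P_def using j
      by (intro order_trans[OF _ member_le_sum[where i=j]] member_le_sum[where i=b]) auto
    finally show "0 < d (T j y)" using elim(1) j by simp
  qed
qed

lemma invariant_zero_or_positive:
  assumes [measurable]: "d \<in> borel_measurable L" and d: "AE x in L. P d x = d x"
  shows "(AE x in L. d x = 0) \<or> (AE x in L. 0 < d x)"
proof (rule disjCI)
  assume "\<not> (AE x in L. 0 < d x)"
  define E where "E = {x \<in> space L. 0 < d x}"
  have E: "E \<in> sets L" unfolding E_def by measurable
  have ET: "AE y in L. y \<in> E \<longrightarrow> (\<forall>j\<in>{1..N}. T j y \<in> E)"
    using support_invariant[OF d] AE_space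
  proof eventually_elim
    case (elim y)
    then show ?case using measurable_space[OF T_measurable_L] by (auto simp: E_def)
  qed
  have "AE y in L. y \<notin> E"
  proof (rule ccontr)
    assume "\<not> (AE y in L. y \<notin> E)"
    from forward_invariant_zero_one[OF E ET this] have "AE x in L. 0 < d x" by eventually_elim (simp add: E_def)
    with \<open>\<not> (AE x in L. 0 < d x)\<close> show False by simp
  qed
  then show "AE x in L. d x = 0" using AE_space by eventually_elim (auto simp: E_def)
qed

text \<open>The minimum \<open>s\<close> of two invariant densities is subinvariant and integrable on \<open>K\<close>, hence invariant; so is \<open>f - s\<close>.\<close>

lemma invariant_comparison:
  assumes [measurable]: "f \<in> borel_measurable L" and f: "AE x in L. P f x = f x" and "0 \<le> a"
  shows "(AE x in L. f x \<le> ennreal (a * h x)) \<or> (AE x in L. ennreal (a * h x) < f x)"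
proof -
  have eq: "ennreal (a * h x) = ennreal a * ennreal (h x)" for x
    using \<open>0 \<le> a\<close> h_pos by (simp add: ennreal_mult less_imp_le)
  have [measurable]: "(\<lambda>x. ennreal (a * h x)) \<in> borel_measurable L" unfolding eq by measurable
  define s where "s x = min (f x) (ennreal (a * h x))" for x
  have s[measurable]: "s \<in> borel_measurable L" unfolding s_def[abs_def] by measurable
  have Pah: "P (\<lambda>x. ennreal (a * h x)) x = ennreal (a * h x)" if "x \<in> X" for x
    unfolding eq P_cmult P_h[OF that] ..
  have s1: "AE x in L. P s x \<le> P f x" and s2: "AE x in L. P s x \<le> P (\<lambda>x. ennreal (a * h x)) x"
    by (rule P_mono_AE, simp add: s_def)+
  have sub: "AE x in L. P s x \<le> s x"
    using s1 s2 f AE_X by eventually_elim (simp add: Pah s_def)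
  obtain B where B: "\<And>x. x \<in> K \<Longrightarrow> h x \<le> B" using h_bounded_K by blast
  have "(\<integral>\<^sup>+x. s x * indicator K x \<partial>L) \<le> (\<integral>\<^sup>+x. ennreal (a * B) \<partial>L)"
  proof (intro nn_integral_mono)
    fix x
    show "s x * indicator K x \<le> ennreal (a * B)"
    proof (cases "x \<in> K")
      case True
      have "s x \<le> ennreal (a * h x)" by (simp add: s_def)
      also have "\<dots> \<le> ennreal (a * B)" using B[OF True] \<open>0 \<le> a\<close> by (intro ennreal_leI mult_left_mono)
      finally show ?thesis using True by simp
    qed simp
  qed
  also have "\<dots> < \<infinity>"
    using finite_measure.emeasure_finite[OF finite_L, of "{0..1}"] by (simp add: ennreal_mult_less_top less_top)
  finally have fin: "(\<integral>\<^sup>+x. s x * indicator K x \<partial>L) < \<infinity>" .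
  have Ps: "AE x in L. P s x = s x" by (rule subinvariant_imp_invariant[OF s sub fin])
  define d where "d x = f x - s x" for x
  have d[measurable]: "d \<in> borel_measurable L" unfolding d_def[abs_def] by measurable
  have fd: "f x = s x + d x" for x unfolding d_def s_def by (simp add: add_diff_inverse_ennreal)
  have "AE x in L. P d x = d x"
    using Ps f
  proof eventually_elim
    case (elim x)
    have "P f x = P s x + P d x"
      unfolding P_add[symmetric] by (rule arg_cong[where f="\<lambda>u. P u x"]) (auto simp: fd)
    then have "s x + P d x = s x + d x" using elim fd[of x] by metis
    then have "s x = \<infinity> \<or> P d x = d x" by (simp only: ennreal_add_left_cancel)
    moreover have "s x \<noteq> \<infinity>" unfolding s_def min_def by (auto simp: top_unique)
    ultimately show "P d x = d x" by blast
  qed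
  from invariant_zero_or_positive[OF d this] show ?thesis
  proof
    assume "AE x in L. d x = 0"
    then have "AE x in L. f x \<le> ennreal (a * h x)"
      by eventually_elim (metis add.right_neutral fd min.cobounded2 s_def)
    then show ?thesis ..
  next
    assume "AE x in L. 0 < d x"
    then have "AE x in L. ennreal (a * h x) < f x"
    proof eventually_elim
      case (elim x)
      show ?case
      proof (rule ccontr)
        assume "\<not> ennreal (a * h x) < f x"
        then have "s x = f x" by (simp add: s_def min_def not_less)
        moreover have "f x \<noteq> \<top>" using \<open>\<not> ennreal (a * h x) < f x\<close> by (auto simp: not_less top_unique)
        ultimately have "d x = 0" unfolding d_def by (cases "f x") (auto simp: ennreal_minus)
        with elim show False by simp
      qed
    qed
    then show ?thesis ..
  qed
qed

lemma L_nontrivial: "\<not> (AE x in L. False)"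
proof
  assume "AE x in L. False"
  then have "AE x in L. x \<notin> K" by eventually_elim simp
  moreover have "{x \<in> space L. \<not> x \<notin> K} = K" using K_sub by auto
  ultimately have "emeasure L K = 0" using AE_iff_measurable[OF K_sets, of "\<lambda>x. x \<notin> K"] by blast
  with K_pos show False by simp
qed

text \<open>For each \<open>a \<ge> 0\<close> the comparison of \<open>f\<close> with
  \<open>a * h\<close> decides almost surely on which side of \<open>a\<close> the quotient
  \<open>f / h\<close> lies, so the quotient is almost surely constant.\<close>

lemma unique_invariant:
  assumes f[measurable]: "f \<in> borel_measurable L" and inv: "AE x in L. P f x = f x" and fin: "AE x in L. f x \<noteq> \<infinity>"
    and nz: "\<not> (AE x in L. f x = 0)"
  shows "\<exists>a>0. AE x in L. f x = ennreal (a * h x)"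
proof -
  define \<phi> where "\<phi> x = enn2real (f x) / h x" for x
  have "(AE x in L. a < \<phi> x) \<or> (AE x in L. \<phi> x \<le> a)" for a
  proof (cases "0 \<le> a")
    case False
    then have "a < \<phi> x" for x using h_pos[of x] unfolding \<phi>_def by (smt (verit) divide_nonneg_pos enn2real_nonneg)
    then show ?thesis by simp
  next
    case True
    have *: "(ennreal (a * h x) < f x \<longleftrightarrow> a < \<phi> x) \<and> (f x \<le> ennreal (a * h x) \<longleftrightarrow> \<phi> x \<le> a)" if fx: "f x \<noteq> \<infinity>" for x
    proof -
      obtain r where r: "0 \<le> r" "f x = ennreal r" using fx by (cases "f x") auto
      then show ?thesis using h_pos[of x] True
        by (simp add: \<phi>_def ennreal_less_iff ennreal_le_iff pos_less_divide_eq pos_divide_le_eq)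
    qed
    from invariant_comparison[OF f inv True] show ?thesis
    proof
      assume "AE x in L. f x \<le> ennreal (a * h x)"
      with fin have "AE x in L. \<phi> x \<le> a" by eventually_elim (use * in blast)
      then show ?thesis ..
    next
      assume "AE x in L. ennreal (a * h x) < f x"
      with fin have "AE x in L. a < \<phi> x" by eventually_elim (use * in blast)
      then show ?thesis ..
    qed
  qed
  moreover have "AE x in L. 0 \<le> \<phi> x" using h_pos by (simp add: \<phi>_def less_imp_le)
  ultimately obtain a where a: "0 \<le> a" "AE x in L. \<phi> x = a"
    using AE_const_of_zero_one[where M=L and \<phi>=\<phi>] L_nontrivial by blast
  have fa: "AE x in L. f x = ennreal (a * h x)"
    using a(2) fin
  proof eventually_elim
    case (elim x)
    then obtain r where r: "0 \<le> r" "f x = ennreal r" by (cases "f x") auto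
    then have "r = a * h x" using elim h_pos[of x] by (simp add: \<phi>_def field_simps)
    with r show ?case by simp
  qed
  have "a \<noteq> 0" using nz fa by auto
  with a fa show ?thesis by (intro exI[of _ a]) auto
qed

section \<open>Stationary measures and their densities\<close>

definition \<mu> :: "real measure" where "\<mu> = density L (\<lambda>x. ennreal (h x))"

text \<open>Duality with an indicator: one random step turns the density \<open>f\<close> into
  \<open>P f\<close>, so stationarity becomes \<open>P f = f\<close> almost everywhere.\<close>

lemma stationary_density:
  assumes f[measurable]: "f \<in> borel_measurable L" and A[measurable]: "A \<in> sets L"
  shows "(\<Sum>j\<in>{1..N}. ennreal (p j) * emeasure (density L f) (T j -` A \<inter> {0..1})) = emeasure (density L (P f)) A"
proof -
  have "ennreal (p j) * emeasure (density L f) (T j -` A \<inter> {0..1}) = (\<integral>\<^sup>+y. f y * (ennreal (p j) * indicator A (T j y)) \<partial>L)"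
    if j: "j \<in> {1..N}" for j
  proof -
    have [measurable]: "T j \<in> measurable L L" by (rule T_measurable_L[OF j])
    have "T j -` A \<inter> {0..1} \<in> sets L" using measurable_sets[OF T_measurable_L[OF j] A] by simp
    then have "emeasure (density L f) (T j -` A \<inter> {0..1}) = (\<integral>\<^sup>+y. f y * indicator (T j -` A \<inter> {0..1}) y \<partial>L)"
      by (rule emeasure_density[OF f])
    also have "\<dots> = (\<integral>\<^sup>+y. f y * indicator A (T j y) \<partial>L)"
      by (intro nn_integral_cong) (auto split: split_indicator)
    finally show ?thesis by (simp add: nn_integral_cmult[symmetric] mult_ac)
  qed
  then have "(\<Sum>j\<in>{1..N}. ennreal (p j) * emeasure (density L f) (T j -` A \<inter> {0..1}))
      = (\<Sum>j\<in>{1..N}. \<integral>\<^sup>+y. f y * (ennreal (p j) * indicator A (T j y)) \<partial>L)" by simp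
  also have "\<dots> = (\<integral>\<^sup>+y. (\<Sum>j\<in>{1..N}. f y * (ennreal (p j) * indicator A (T j y))) \<partial>L)"
    by (rule nn_integral_sum[symmetric]) measurable
  also have "\<dots> = (\<integral>\<^sup>+y. f y * U (indicator A) y \<partial>L)" by (simp only: U_def sum_distrib_left)
  also have "\<dots> = (\<integral>\<^sup>+x. P f x * indicator A x \<partial>L)" by (rule P_U_duality[symmetric]) measurable
  also have "\<dots> = emeasure (density L (P f)) A" by (rule emeasure_density[symmetric]) measurable
  finally show ?thesis .
qed

lemma sets_L_eq: "sets L = sets (restrict_space borel {0..1})"
  unfolding L_def by (simp cong: sets_restrict_space_cong)

lemma sigma_finite_L: "sigma_finite_measure L"
  using finite_L by (simp add: finite_measure.axioms(1))

lemma sigma_finite_acsm_mu: "sigma_finite_acsm N p T \<mu>"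
  unfolding sigma_finite_acsm_def stationary_def
proof (intro conjI ballI)
  show "sets \<mu> = sets (restrict_space borel {0..1})" by (simp add: \<mu>_def sets_L_eq)
  fix A assume "A \<in> sets \<mu>"
  then have A: "A \<in> sets L" by (simp add: \<mu>_def)
  have "density L (P (\<lambda>x. ennreal (h x))) = density L (\<lambda>x. ennreal (h x))"
    by (rule density_cong) (use AE_X in \<open>auto simp: P_h elim: AE_mp\<close>)
  then show "(\<Sum>j\<in>{1..N}. ennreal (p j) * emeasure \<mu> (T j -` A \<inter> {0..1})) = emeasure \<mu> A"
    unfolding \<mu>_def stationary_density[OF h_measurable A] by simp
next
  interpret sigma_finite_measure L by (rule sigma_finite_L)
  show "sigma_finite_measure \<mu>"
    unfolding \<mu>_def by (subst sigma_finite_iff_density_finite) auto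
  show "absolutely_continuous lebesgue01 \<mu>"
    unfolding \<mu>_def L_def[symmetric] by (rule absolutely_continuousI_density) measurable
  show "emeasure \<mu> (space \<mu>) \<noteq> 0"
  proof
    assume "emeasure \<mu> (space \<mu>) = 0"
    moreover have "emeasure \<mu> (space L) = (\<integral>\<^sup>+x. ennreal (h x) * indicator (space L) x \<partial>L)"
      unfolding \<mu>_def by (rule emeasure_density) measurable
    ultimately have "(\<integral>\<^sup>+x. ennreal (h x) * indicator (space L) x \<partial>L) = 0" by (simp add: \<mu>_def)
    moreover have "(\<lambda>x. ennreal (h x) * indicator (space L) x) \<in> borel_measurable L" by measurable
    ultimately have "AE x in L. ennreal (h x) * indicator (space L) x = 0"
      by (simp only: nn_integral_0_iff_AE)
    then have "AE x in L. False" using AE_space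
    proof eventually_elim
      case (elim x)
      then have "ennreal (h x) = 0" by simp
      with h_pos[of x] show False by simp
    qed
    with L_nontrivial show False by simp
  qed
qed

lemma unique_acsm:
  assumes \<nu>: "sigma_finite_acsm N p T \<nu>"
  shows "\<exists>a::real. a > 0 \<and> \<nu> = scale_measure (ennreal a) \<mu>"
proof -
  interpret sigma_finite_measure L by (rule sigma_finite_L)
  have sets: "sets \<nu> = sets L" using \<nu> unfolding sigma_finite_acsm_def stationary_def sets_L_eq by blast
  have ac: "absolutely_continuous L \<nu>" and sf: "sigma_finite_measure \<nu>" and nz: "emeasure \<nu> (space \<nu>) \<noteq> 0"
    and st: "\<And>A. A \<in> sets \<nu> \<Longrightarrow> (\<Sum>j\<in>{1..N}. ennreal (p j) * emeasure \<nu> (T j -` A \<inter> {0..1})) = emeasure \<nu> A"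
    using \<nu> unfolding sigma_finite_acsm_def stationary_def L_def by blast+
  define f where "f = RN_deriv L \<nu>"
  have f[measurable]: "f \<in> borel_measurable L" by (simp add: f_def)
  have dens: "density L f = \<nu>" unfolding f_def by (rule density_RN_deriv[OF ac sets])
  have "density L (P f) = density L f"
  proof (rule measure_eqI)
    fix A assume "A \<in> sets (density L (P f))"
    then have A: "A \<in> sets L" by simp
    show "emeasure (density L (P f)) A = emeasure (density L f) A"
      using stationary_density[OF f A] st[of A] A sets unfolding dens by simp
  qed simp
  then have inv: "AE x in L. P f x = f x" by (intro density_unique) auto
  \<comment> \<open>The \<sigma>-finiteness of \<nu> enters here: it excludes densities with
    infinite values on a set of positive measure.\<close>
  have fin: "AE x in L. f x \<noteq> \<infinity>" unfolding f_def by (rule RN_deriv_finite[OF sf ac sets])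
  have "\<not> (AE x in L. f x = 0)"
  proof
    assume "AE x in L. f x = 0"
    then have "AE x in L. f x * indicator (space L) x = 0" by eventually_elim simp
    moreover have "(\<lambda>x. f x * indicator (space L) x) \<in> borel_measurable L" by measurable
    ultimately have "(\<integral>\<^sup>+x. f x * indicator (space L) x \<partial>L) = 0"
      by (simp only: nn_integral_0_iff_AE)
    also have "(\<integral>\<^sup>+x. f x * indicator (space L) x \<partial>L) = emeasure (density L f) (space L)"
      by (rule emeasure_density[symmetric]) measurable
    finally have "emeasure \<nu> (space \<nu>) = 0"
      using sets_eq_imp_space_eq[OF sets] by (simp add: dens)
    with nz show False by simp
  qed
  from unique_invariant[OF f inv fin this] obtain a where a: "0 < a" "AE x in L. f x = ennreal (a * h x)" by blast
  have "\<nu> = scale_measure (ennreal a) \<mu>"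
  proof (rule measure_eqI)
    fix A assume "A \<in> sets \<nu>"
    then have A[measurable]: "A \<in> sets L" using sets by simp
    have "emeasure \<nu> A = (\<integral>\<^sup>+x. f x * indicator A x \<partial>L)" unfolding dens[symmetric] by (rule emeasure_density) measurable
    also have "\<dots> = (\<integral>\<^sup>+x. ennreal a * (ennreal (h x) * indicator A x) \<partial>L)"
      using a by (intro nn_integral_cong_AE) (auto elim!: AE_mp simp: ennreal_mult h_pos less_imp_le mult_ac)
    also have "\<dots> = ennreal a * (\<integral>\<^sup>+x. ennreal (h x) * indicator A x \<partial>L)" by (rule nn_integral_cmult) measurable
    also have "(\<integral>\<^sup>+x. ennreal (h x) * indicator A x \<partial>L) = emeasure \<mu> A"
      unfolding \<mu>_def by (rule emeasure_density[symmetric]) measurable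
    finally show "emeasure \<nu> A = emeasure (scale_measure (ennreal a) \<mu>) A" by simp
  qed (simp add: sets \<mu>_def)
  with a show ?thesis by blast
qed

lemma h_locally_lipschitz: "locally_lipschitz_on h (side b)"
  unfolding locally_lipschitz_on_def
proof
  fix x assume x: "x \<in> side b"
  define u where "u = min (x - lo b) (hi b - x) / 2"
  have u: "0 < u" "lo b + u \<le> x - u" "x + u \<le> hi b - u" using x by (auto simp: u_def min_def field_simps)
  obtain M where "M-lipschitz_on {lo b + u..hi b - u} h" using koebe_cone_lipschitz[OF h_koebe_cone u(1)] by blast
  moreover have "cball x u \<inter> side b \<subseteq> {lo b + u..hi b - u}" using u by (auto simp: cball_eq_atLeastAtMost)
  ultimately have "M-lipschitz_on (cball x u \<inter> side b) h" by (rule lipschitz_on_subset)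
  with u(1) show "\<exists>u>0. \<exists>M. M-lipschitz_on (cball x u \<inter> side b) h" by blast
qed

lemma RN_deriv_mu: "AE x in L. RN_deriv L \<mu> x = ennreal (h x)"
proof -
  interpret sigma_finite_measure L by (rule sigma_finite_L)
  have "AE x in L. ennreal (h x) = RN_deriv L \<mu> x"
    by (rule RN_deriv_unique) (auto simp: \<mu>_def)
  then show ?thesis by eventually_elim simp
qed

end

section \<open>Ergodicity\<close>

context sequence_space begin

text \<open>Conditioning on the first symbol: prepending an independent symbol preserves the product
  measure.\<close>

lemma emeasure_PiM_first:
  assumes V: "V \<in> sets S"
  shows "emeasure S V = (\<integral>\<^sup>+s. emeasure S {\<omega> \<in> space S. case_nat s \<omega> \<in> V} \<partial>M)"
proof -
  have m: "(\<lambda>(s, \<omega>). case_nat s \<omega>) \<in> measurable (M \<Otimes>\<^sub>M S) S" by measurable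
  have "emeasure S V = emeasure (distr (M \<Otimes>\<^sub>M S) S (\<lambda>(s, \<omega>). case_nat s \<omega>)) V"
    by (simp only: PiM_iter)
  also have "\<dots> = emeasure (M \<Otimes>\<^sub>M S) ((\<lambda>(s, \<omega>). case_nat s \<omega>) -` V \<inter> space (M \<Otimes>\<^sub>M S))"
    by (rule emeasure_distr[OF m V])
  also have "\<dots> = (\<integral>\<^sup>+s. emeasure S (Pair s -` ((\<lambda>(s, \<omega>). case_nat s \<omega>) -` V \<inter> space (M \<Otimes>\<^sub>M S))) \<partial>M)"
    by (rule P.emeasure_pair_measure_alt[OF measurable_sets[OF m V]])
  also have "\<dots> = (\<integral>\<^sup>+s. emeasure S {\<omega> \<in> space S. case_nat s \<omega> \<in> V} \<partial>M)"
    by (intro nn_integral_cong arg_cong2[where f=emeasure] refl) (auto simp: space_pair_measure)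
  finally show ?thesis .
qed

end

section \<open>Fibres of invariant sets and the zero-one law\<close>

context trapped_density begin

lemma p_nonneg: "j \<in> {1..N} \<Longrightarrow> 0 \<le> p j"
  using p_pos by (auto intro: less_imp_le)

abbreviation M1 :: "nat measure" where "M1 \<equiv> point_measure {1..N} (\<lambda>j. ennreal (p j))"
abbreviation B :: "(nat \<Rightarrow> nat) measure" where "B \<equiv> bernoulli_measure N p"

lemma prob_M1: "prob_space M1"
  by (rule prob_spaceI) (subst emeasure_point_measure_finite; use sum_p_ennreal in \<open>simp add: space_point_measure\<close>)

lemma sequence_M1: "sequence_space M1"
proof -
  interpret prob_space M1 by (rule prob_M1)
  show ?thesis by unfold_locales
qed

lemma B_eq: "B = (\<Pi>\<^sub>M i\<in>(UNIV::nat set). M1)"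
  by (simp add: bernoulli_measure_def)

lemma prob_B: "prob_space B"
  unfolding B_eq by (rule prob_space_PiM) (rule prob_M1)

lemma space_B: "\<omega> \<in> space B \<longleftrightarrow> (\<forall>n. \<omega> n \<in> {1..N})"
  by (simp add: B_eq space_PiM space_point_measure PiE_UNIV_domain Pi_iff)

lemma case_nat_B: "s \<in> {1..N} \<Longrightarrow> \<omega> \<in> space B \<Longrightarrow> case_nat s \<omega> \<in> space B"
  unfolding space_B by (auto split: nat.split)

lemma emeasure_B_first:
  assumes V: "V \<in> sets B"
  shows "emeasure B V = (\<Sum>s\<in>{1..N}. ennreal (p s) * emeasure B {\<omega> \<in> space B. case_nat s \<omega> \<in> V})"
proof -
  have V': "V \<in> sets (\<Pi>\<^sub>M i\<in>(UNIV::nat set). M1)" using V by (simp add: B_eq)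
  show ?thesis
    unfolding B_eq sequence_space.emeasure_PiM_first[OF sequence_M1 V']
    by (rule nn_integral_point_measure_finite) simp
qed

definition sec :: "((nat \<Rightarrow> nat) \<times> real) set \<Rightarrow> real \<Rightarrow> (nat \<Rightarrow> nat) set" where
  "sec A x = (\<lambda>\<omega>. (\<omega>, x)) -` A"

lemma sets_mu: "sets \<mu> = sets L" "space \<mu> = {0..1}"
  by (simp_all add: \<mu>_def)

lemma sec_sets: "A \<in> sets (B \<Otimes>\<^sub>M \<mu>) \<Longrightarrow> sec A x \<in> sets B"
  unfolding sec_def by (rule sets_Pair2)

text \<open>Invariance of \<open>A\<close> identifies the sequences of the fibre over
  \<open>x\<close> that start with \<open>s\<close> with the fibre over \<open>T s x\<close>.
  Averaging over \<open>s\<close> makes the fibre measure harmonic.\<close>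

lemma sec_shift:
  assumes A: "A \<in> sets (B \<Otimes>\<^sub>M \<mu>)" and inv: "skew_product T -` A \<inter> space (B \<Otimes>\<^sub>M \<mu>) = A"
    and x: "x \<in> {0..1}" and s: "s \<in> {1..N}"
  shows "\<omega> \<in> space B \<Longrightarrow> case_nat s \<omega> \<in> sec A x \<longleftrightarrow> \<omega> \<in> sec A (T s x)"
proof -
  assume \<omega>: "\<omega> \<in> space B"
  then have "(case_nat s \<omega>, x) \<in> space (B \<Otimes>\<^sub>M \<mu>)"
    using case_nat_B[OF s] x by (simp add: space_pair_measure sets_mu)
  then have "(case_nat s \<omega>, x) \<in> A \<longleftrightarrow> skew_product T (case_nat s \<omega>, x) \<in> A"
    using inv by blast
  then show ?thesis by (simp add: sec_def skew_product_def)
qed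

lemma sec_rec:
  assumes A: "A \<in> sets (B \<Otimes>\<^sub>M \<mu>)" and inv: "skew_product T -` A \<inter> space (B \<Otimes>\<^sub>M \<mu>) = A"
    and x: "x \<in> {0..1}" 
  shows "emeasure B (sec A x) = (\<Sum>s\<in>{1..N}. ennreal (p s) * emeasure B (sec A (T s x)))"
proof -
  have "{\<omega> \<in> space B. case_nat s \<omega> \<in> sec A x} = sec A (T s x)" if s: "s \<in> {1..N}" for s
    using sec_shift[OF A inv x s] sets.sets_into_space[OF sec_sets[OF A, of "T s x"]] by blast
  then show ?thesis by (subst emeasure_B_first[OF sec_sets[OF A]]) simp
qed

definition cyl :: "nat \<Rightarrow> (nat \<Rightarrow> nat set) \<Rightarrow> (nat \<Rightarrow> nat) set" where
  "cyl n E = {\<omega> \<in> space B. \<forall>i<n. \<omega> i \<in> E i}"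

lemma cyl_sets: "cyl n E \<in> sets B"
proof -
  have "{\<omega> \<in> space B. \<omega> i \<in> E i} \<in> sets B" for i
  proof -
    have "(\<lambda>\<omega>. \<omega> i) \<in> measurable B M1" unfolding B_eq by measurable
    then have "(\<lambda>\<omega>. \<omega> i) -` (E i \<inter> {1..N}) \<inter> space B \<in> sets B"
      by (rule measurable_sets) (simp add: sets_point_measure)
    also have "(\<lambda>\<omega>. \<omega> i) -` (E i \<inter> {1..N}) \<inter> space B = {\<omega> \<in> space B. \<omega> i \<in> E i}"
      by (auto simp: space_B)
    finally show ?thesis .
  qed
  then have [measurable]: "Measurable.pred B (\<lambda>\<omega>. \<omega> i \<in> E i)" for i by (simp add: pred_def)
  show ?thesis unfolding cyl_def by measurable
qed

lemma cyl_Suc: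
  assumes "s \<in> {1..N}"
  shows "{\<omega> \<in> space B. case_nat s \<omega> \<in> cyl (Suc n) E} = (if s \<in> E 0 then cyl n (\<lambda>i. E (Suc i)) else {})"
  using case_nat_B[OF assms] by (auto simp: cyl_def All_less_Suc2)

text \<open>If the fibre measure is constant along all orbits of \<open>x\<close>, the fibre over \<open>x\<close> is independent of all cylinders, hence of itself.\<close>

lemma sec_cyl:
  assumes A: "A \<in> sets (B \<Otimes>\<^sub>M \<mu>)" and inv: "skew_product T -` A \<inter> space (B \<Otimes>\<^sub>M \<mu>) = A"
    and x: "x \<in> {0..1}" and a: "\<And>w. w \<in> lists {1..N} \<Longrightarrow> emeasure B (sec A (orb w x)) = a"
  shows "emeasure B (sec A x \<inter> cyl n E) = a * emeasure B (cyl n E)"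
  using x a
proof (induction n arbitrary: x E)
  case 0
  interpret prob_space B by (rule prob_B)
  have "cyl 0 E = space B" by (simp add: cyl_def)
  moreover have "sec A x \<inter> space B = sec A x"
    using sets.sets_into_space[OF sec_sets[OF A, of x]] by blast
  ultimately show ?case using 0(2)[of "[]"] emeasure_space_1 by simp
next
  case (Suc n)
  have *: "emeasure B {\<omega> \<in> space B. case_nat s \<omega> \<in> sec A x \<inter> cyl (Suc n) E}
      = a * emeasure B {\<omega> \<in> space B. case_nat s \<omega> \<in> cyl (Suc n) E}" if s: "s \<in> {1..N}" for s
  proof -
    have 1: "{\<omega> \<in> space B. case_nat s \<omega> \<in> sec A x \<inter> cyl (Suc n) E} = sec A (T s x) \<inter> {\<omega> \<in> space B. case_nat s \<omega> \<in> cyl (Suc n) E}"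
      using sec_shift[OF A inv Suc.prems(1) s] by blast
    have 2: "emeasure B (sec A (T s x) \<inter> {\<omega> \<in> space B. case_nat s \<omega> \<in> cyl (Suc n) E}) = a * emeasure B {\<omega> \<in> space B. case_nat s \<omega> \<in> cyl (Suc n) E}"
    proof (cases "s \<in> E 0")
      case True
      have "T s x \<in> {0..1}" using map_facts(1)[OF s] Suc.prems(1) by blast
      moreover have "emeasure B (sec A (orb w (T s x))) = a" if "w \<in> lists {1..N}" for w
        using Suc.prems(2)[of "s # w"] that s by simp
      ultimately have "emeasure B (sec A (T s x) \<inter> cyl n (\<lambda>i. E (Suc i))) = a * emeasure B (cyl n (\<lambda>i. E (Suc i)))"
        by (rule Suc.IH)
      then show ?thesis using True by (simp only: cyl_Suc[OF s] if_True)
    qed (simp add: cyl_Suc[OF s])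
    show ?thesis unfolding 1 by (rule 2)
  qed
  have "emeasure B (sec A x \<inter> cyl (Suc n) E) = (\<Sum>s\<in>{1..N}. ennreal (p s) * (a * emeasure B {\<omega> \<in> space B. case_nat s \<omega> \<in> cyl (Suc n) E}))"
  proof -
    have "sec A x \<inter> cyl (Suc n) E \<in> sets B" by (intro sets.Int sec_sets[OF A] cyl_sets)
    then have "emeasure B (sec A x \<inter> cyl (Suc n) E)
        = (\<Sum>s\<in>{1..N}. ennreal (p s) * emeasure B {\<omega> \<in> space B. case_nat s \<omega> \<in> sec A x \<inter> cyl (Suc n) E})"
      by (rule emeasure_B_first)
    also have "\<dots> = (\<Sum>s\<in>{1..N}. ennreal (p s) * (a * emeasure B {\<omega> \<in> space B. case_nat s \<omega> \<in> cyl (Suc n) E}))"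
      by (intro sum.cong refl) (simp only: *)
    finally show ?thesis .
  qed
  also have "\<dots> = a * emeasure B (cyl (Suc n) E)"
    unfolding emeasure_B_first[OF cyl_sets] by (simp only: sum_distrib_left mult_ac)
  finally show ?case .
qed

text \<open>The restriction of the Bernoulli measure to the fibre and its multiple by
  \<open>a\<close> agree on cylinders, hence on the product \<sigma>-algebra; evaluation at the
  fibre itself gives the equation.\<close>

lemma zero_one:
  assumes A: "A \<in> sets (B \<Otimes>\<^sub>M \<mu>)" and inv: "skew_product T -` A \<inter> space (B \<Otimes>\<^sub>M \<mu>) = A"
    and x: "x \<in> {0..1}" and a: "\<And>w. w \<in> lists {1..N} \<Longrightarrow> emeasure B (sec A (orb w x)) = a"
  shows "a = a * a"
proof -
  interpret B: prob_space B by (rule prob_B)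
  have qa: "emeasure B (sec A x) = a" using a[of "[]"] by simp
  have secA: "sec A x \<in> sets B" by (rule sec_sets[OF A])
  define Q1 where "Q1 = density B (indicator (sec A x))"
  define Q2 where "Q2 = scale_measure a B"
  have Q1: "emeasure Q1 V = emeasure B (sec A x \<inter> V)" if "V \<in> sets B" for V
    unfolding Q1_def using that secA by (subst emeasure_density) (auto simp: nn_integral_indicator[symmetric] indicator_inter_arith[symmetric] simp del: nn_integral_indicator intro!: nn_integral_cong)
  have "Q1 = Q2"
  proof (rule measure_eqI_PiM_infinite[where I=UNIV and M="\<lambda>_. M1"])
    show "sets Q1 = sets (PiM UNIV (\<lambda>_. M1))" "sets Q2 = sets (PiM UNIV (\<lambda>_. M1))"
      by (simp_all add: Q1_def Q2_def B_eq)
    show "finite_measure Q1"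
    proof (rule finite_measureI)
      have "emeasure Q1 (space B) \<le> 1" using Q1[of "space B"] B.measure_le_1 by simp
      then show "emeasure Q1 (space Q1) \<noteq> \<infinity>" by (auto simp: Q1_def top_unique)
    qed
    fix V and J :: "nat set" assume J: "finite J" and V: "\<And>i. i \<in> J \<Longrightarrow> V i \<in> sets M1"
    obtain n where n: "J \<subseteq> {..<n}" using finite_nat_iff_bounded J by blast
    define E where "E i = (if i \<in> J then V i else UNIV)" for i
    have "prod_emb UNIV (\<lambda>_. M1) J (Pi\<^sub>E J V) = cyl n E"
    proof -
      have "i < n" if "i \<in> J" for i using n that by blast
      then have "cyl n E = {\<omega> \<in> space B. \<forall>i\<in>J. \<omega> i \<in> V i}" by (auto simp: cyl_def E_def)
      then show ?thesis by (auto simp: prod_emb_def B_eq space_PiM PiE_iff)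
    qed
    moreover have "emeasure Q1 (cyl n E) = emeasure Q2 (cyl n E)"
      using Q1[OF cyl_sets, of n E] sec_cyl[OF A inv x a, of n E] by (simp add: Q2_def)
    ultimately show "emeasure Q1 (prod_emb UNIV (\<lambda>_. M1) J (Pi\<^sub>E J V)) = emeasure Q2 (prod_emb UNIV (\<lambda>_. M1) J (Pi\<^sub>E J V))"
      by simp
  qed
  then have "emeasure Q1 (sec A x) = emeasure Q2 (sec A x)" by simp
  then show ?thesis using Q1[OF secA] qa by (simp add: Q2_def)
qed

text \<open>The conditional variance \<open>v = U (r\<^sup>2) - r\<^sup>2\<close> satisfies \<open>\<integral> G * v \<le> 1\<close> by telescoping, while \<open>G = \<infinity>\<close>.\<close>

lemma harmonic_imp_invariant:
  assumes rm: "r \<in> borel_measurable L" and r01: "\<And>x. 0 \<le> r x \<and> r x \<le> (1::real)"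
    and harm: "\<And>x. x \<in> {0..1} \<Longrightarrow> r x = (\<Sum>j\<in>{1..N}. p j * r (T j x))"
  shows "AE x in L. \<forall>j\<in>{1..N}. r (T j x) = r x"
proof -
  note rm[measurable]
  define v where "v x = (\<Sum>j\<in>{1..N}. p j * (r (T j x) - r x)\<^sup>2)" for x
  define b where "b x = ennreal ((r x)\<^sup>2)" for x
  have [measurable]: "b \<in> borel_measurable L" unfolding b_def[abs_def] by measurable
  have v0: "0 \<le> v x" for x 
    unfolding v_def by (intro sum_nonneg mult_nonneg_nonneg p_nonneg) auto
  have vm[measurable]: "(\<lambda>x. ennreal (v x)) \<in> borel_measurable L" unfolding v_def[abs_def] by measurable
  have Ub: "U b x = b x + ennreal (v x)" if x: "x \<in> {0..1}" for x
  proof -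
    have "v x = (\<Sum>j\<in>{1..N}. p j * (r (T j x))\<^sup>2 - 2 * r x * (p j * r (T j x)) + (r x)\<^sup>2 * p j)"
      unfolding v_def by (intro sum.cong refl) (simp add: power2_eq_square algebra_simps)
    also have "\<dots> = (\<Sum>j\<in>{1..N}. p j * (r (T j x))\<^sup>2) - 2 * r x * (\<Sum>j\<in>{1..N}. p j * r (T j x)) + (r x)\<^sup>2 * (\<Sum>j\<in>{1..N}. p j)"
      unfolding sum.distrib sum_subtractf sum_distrib_left ..
    also have "\<dots> = (\<Sum>j\<in>{1..N}. p j * (r (T j x))\<^sup>2) - (r x)\<^sup>2"
      unfolding harm[OF x, symmetric] p_sum by (simp add: power2_eq_square)
    finally have "(\<Sum>j\<in>{1..N}. p j * (r (T j x))\<^sup>2) = (r x)\<^sup>2 + v x" by simp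
    moreover have "U b x = ennreal (\<Sum>j\<in>{1..N}. p j * (r (T j x))\<^sup>2)"
    proof -
      have "U b x = (\<Sum>j\<in>{1..N}. ennreal (p j * (r (T j x))\<^sup>2))"
        unfolding U_def b_def using p_pos by (intro sum.cong) (auto simp: ennreal_mult less_imp_le)
      also have "\<dots> = ennreal (\<Sum>j\<in>{1..N}. p j * (r (T j x))\<^sup>2)"
        by (intro sum_ennreal mult_nonneg_nonneg p_nonneg) auto
      finally show ?thesis .
    qed
    ultimately show ?thesis using v0[of x] by (simp add: b_def ennreal_plus)
  qed
  have step: "(\<integral>\<^sup>+x. ennreal (g (Suc n) x) * b x \<partial>L) = (\<integral>\<^sup>+x. ennreal (g n x) * b x \<partial>L) + (\<integral>\<^sup>+x. ennreal (g n x) * ennreal (v x) \<partial>L)" for n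
  proof -
    have "(\<integral>\<^sup>+x. ennreal (g (Suc n) x) * b x \<partial>L) = (\<integral>\<^sup>+x. P (\<lambda>x. ennreal (g n x)) x * b x \<partial>L)"
      by (simp only: g_Suc_ennreal[symmetric])
    also have "\<dots> = (\<integral>\<^sup>+x. ennreal (g n x) * U b x \<partial>L)" by (rule P_U_duality) measurable
    also have "\<dots> = (\<integral>\<^sup>+x. ennreal (g n x) * b x + ennreal (g n x) * ennreal (v x) \<partial>L)"
      by (intro nn_integral_cong) (simp add: Ub distrib_left)
    also have "\<dots> = (\<integral>\<^sup>+x. ennreal (g n x) * b x \<partial>L) + (\<integral>\<^sup>+x. ennreal (g n x) * ennreal (v x) \<partial>L)"
      by (rule nn_integral_add) measurable
    finally show ?thesis .
  qed
  have tel: "(\<Sum>k<n. \<integral>\<^sup>+x. ennreal (g k x) * ennreal (v x) \<partial>L) \<le> (\<integral>\<^sup>+x. ennreal (g n x) * b x \<partial>L)" for n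
  proof (induction n)
    case (Suc n)
    then show ?case unfolding step by (simp add: add_right_mono)
  qed simp
  have "(\<integral>\<^sup>+x. ennreal (g n x) * b x \<partial>L) \<le> 1" for n
  proof -
    have "(\<integral>\<^sup>+x. ennreal (g n x) * b x \<partial>L) \<le> (\<integral>\<^sup>+x. ennreal (g n x) \<partial>L)"
    proof (intro nn_integral_mono)
      fix x
      have "b x \<le> 1" using r01[of x] by (simp add: b_def power_le_one flip: ennreal_1)
      then show "ennreal (g n x) * b x \<le> ennreal (g n x)" using mult_left_mono[of "b x" 1 "ennreal (g n x)"] by simp
    qed
    then show ?thesis using g_integral by simp
  qed
  with tel have sums: "(\<Sum>k<n. \<integral>\<^sup>+x. ennreal (g k x) * ennreal (v x) \<partial>L) \<le> 1" for n by (meson order_trans)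
  have "(\<integral>\<^sup>+x. G x * ennreal (v x) \<partial>L) = (\<integral>\<^sup>+x. (\<Sum>k. ennreal (g k x) * ennreal (v x)) \<partial>L)"
    unfolding G_def by simp
  also have "\<dots> = (\<Sum>k. \<integral>\<^sup>+x. ennreal (g k x) * ennreal (v x) \<partial>L)"
    by (rule nn_integral_suminf) measurable
  also have "\<dots> \<le> 1" unfolding suminf_eq_SUP using sums by (intro SUP_least)
  finally have "(\<integral>\<^sup>+x. G x * ennreal (v x) \<partial>L) \<noteq> \<infinity>" by (auto simp: top_unique)
  then have "AE x in L. G x * ennreal (v x) \<noteq> \<infinity>" by (intro nn_integral_PInf_AE) measurable
  with AE_X show ?thesis
  proof eventually_elim
    case (elim x)
    then have "G x = \<infinity>" by (intro G_infinite) (auto simp: X_def)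
    then have "ennreal (v x) = 0" using elim(2) by (auto simp: ennreal_top_mult split: if_splits)
    then have "v x = 0" using v0[of x] by simp
    then have "\<forall>j\<in>{1..N}. p j * (r (T j x) - r x)\<^sup>2 = 0"
      unfolding v_def using p_nonneg by (subst (asm) sum_nonneg_eq_0_iff) (auto intro!: mult_nonneg_nonneg)
    then show ?case using p_pos by force
  qed
qed

text \<open>The superlevel sets are forward invariant up to null sets, hence null or full.\<close>

lemma invariant_function_const:
  assumes [measurable]: "r \<in> borel_measurable L" and r0: "\<And>x. 0 \<le> r x"
    and inv: "AE x in L. \<forall>j\<in>{1..N}. r (T j x) = (r x :: real)"
  shows "\<exists>a\<ge>0. AE x in L. r x = a"
proof (rule AE_const_of_zero_one[OF _ L_nontrivial])
  show "AE x in L. 0 \<le> r x" using r0 by simp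
  fix a
  define E where "E = {x \<in> space L. a < r x}"
  have E: "E \<in> sets L" unfolding E_def by measurable
  have ET: "AE y in L. y \<in> E \<longrightarrow> (\<forall>j\<in>{1..N}. T j y \<in> E)"
    using inv AE_space
  proof eventually_elim
    case (elim y)
    then show ?case using measurable_space[OF T_measurable_L] by (auto simp: E_def)
  qed
  show "(AE x in L. a < r x) \<or> (AE x in L. r x \<le> a)"
  proof (cases "AE y in L. y \<notin> E")
    case True
    then have "AE x in L. r x \<le> a" using AE_space by eventually_elim (auto simp: E_def)
    then show ?thesis ..
  next
    case False
    from forward_invariant_zero_one[OF E ET this] have "AE x in L. a < r x" by eventually_elim (simp add: E_def)
    then show ?thesis ..
  qed
qed

text \<open>The fibre measure \<open>r\<close> of an invariant set is harmonic, hence invariant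
  under every map, hence almost surely constant. The zero-one law makes the constant 0 or 1, and
  Fubini concludes.\<close>

lemma ergodic_mu: "ergodic_for N p T \<mu>"
  unfolding ergodic_for_def ergodic_def
proof (intro ballI impI)
  fix A assume A: "A \<in> sets (B \<Otimes>\<^sub>M \<mu>)" and inv: "skew_product T -` A \<inter> space (B \<Otimes>\<^sub>M \<mu>) = A"
  interpret B: prob_space B by (rule prob_B)
  interpret mu: sigma_finite_measure \<mu> using sigma_finite_acsm_mu by (simp add: sigma_finite_acsm_def)
  interpret pair: pair_sigma_finite B \<mu> ..
  define r where "r x = measure B (sec A x)" for x
  have qr: "emeasure B (sec A x) = ennreal (r x)" for x
    unfolding r_def by (rule B.emeasure_eq_measure)
  have "(\<lambda>x. emeasure B (sec A x)) \<in> borel_measurable \<mu>"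
    unfolding sec_def by (rule pair.measurable_emeasure_Pair2[OF A])
  then have "(\<lambda>x. emeasure B (sec A x)) \<in> borel_measurable L"
    by (simp add: \<mu>_def)
  then have rm: "r \<in> borel_measurable L" unfolding r_def[abs_def] measure_def by measurable
  have r01: "0 \<le> r x \<and> r x \<le> 1" for x by (simp add: r_def)
  have harm: "r x = (\<Sum>j\<in>{1..N}. p j * r (T j x))" if x: "x \<in> {0..1}" for x
  proof -
    have "ennreal (r x) = (\<Sum>j\<in>{1..N}. ennreal (p j * r (T j x)))"
      unfolding qr[symmetric] sec_rec[OF A inv x] unfolding qr
      using p_pos r01 by (intro sum.cong) (auto simp: ennreal_mult less_imp_le)
    also have "\<dots> = ennreal (\<Sum>j\<in>{1..N}. p j * r (T j x))"
      using r01 by (intro sum_ennreal mult_nonneg_nonneg p_nonneg) auto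
    finally have "ennreal (r x) = ennreal (\<Sum>j\<in>{1..N}. p j * r (T j x))" .
    moreover have "0 \<le> (\<Sum>j\<in>{1..N}. p j * r (T j x))"
      using r01 by (intro sum_nonneg mult_nonneg_nonneg p_nonneg) auto
    ultimately show ?thesis using r01[of x] ennreal_inj by blast
  qed
  obtain a where a: "0 \<le> a" "AE x in L. r x = a"
    using invariant_function_const[OF rm _ harmonic_imp_invariant[OF rm r01 harm]] r01 by blast
  have "AE x in L. \<forall>w\<in>lists {1..N}. r (orb w x) = a"
    by (rule AE_words[where R="\<lambda>_ _. True"]) (use a in auto)
  then have "AE x in L. (\<forall>w\<in>lists {1..N}. r (orb w x) = a) \<and> x \<in> space L" using AE_space by eventually_elim blast
  note ae = this
  have "\<exists>x. (\<forall>w\<in>lists {1..N}. r (orb w x) = a) \<and> x \<in> space L"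
  proof (rule ccontr)
    assume n: "\<nexists>x. (\<forall>w\<in>lists {1..N}. r (orb w x) = a) \<and> x \<in> space L"
    from ae have "AE x in L. False" by eventually_elim (use n in blast)
    with L_nontrivial show False by simp
  qed
  \<comment> \<open>A single point along whose orbits \<open>r\<close> always equals
    \<open>a\<close> is enough for the zero-one law.\<close>
  then obtain x where x: "x \<in> {0..1}" "\<And>w. w \<in> lists {1..N} \<Longrightarrow> r (orb w x) = a" by auto
  have "ennreal a = ennreal a * ennreal a"
    by (rule zero_one[OF A inv x(1)]) (simp add: qr x(2))
  then have "a = a * a" using a(1) by (simp flip: ennreal_mult)
  then have "a = 0 \<or> a = 1" by auto
  have mu_AE: "AE x in \<mu>. r x = a"
    unfolding \<mu>_def using a(2) by (subst AE_density) (auto elim: AE_mp)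
  show "emeasure (B \<Otimes>\<^sub>M \<mu>) A = 0 \<or> emeasure (B \<Otimes>\<^sub>M \<mu>) (space (B \<Otimes>\<^sub>M \<mu>) - A) = 0"
    using \<open>a = 0 \<or> a = 1\<close>
  proof
    assume "a = 0"
    have "emeasure (B \<Otimes>\<^sub>M \<mu>) A = (\<integral>\<^sup>+y. emeasure B (sec A y) \<partial>\<mu>)"
      unfolding sec_def by (rule pair.emeasure_pair_measure_alt2[OF A])
    also have "\<dots> = (\<integral>\<^sup>+y. 0 \<partial>\<mu>)"
      using mu_AE \<open>a = 0\<close> by (intro nn_integral_cong_AE) (auto simp: qr elim: AE_mp)
    finally show ?thesis by simp
  next
    assume "a = 1"
    have C: "space (B \<Otimes>\<^sub>M \<mu>) - A \<in> sets (B \<Otimes>\<^sub>M \<mu>)" using A by auto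
    have "emeasure (B \<Otimes>\<^sub>M \<mu>) (space (B \<Otimes>\<^sub>M \<mu>) - A) = (\<integral>\<^sup>+y. emeasure B (sec (space (B \<Otimes>\<^sub>M \<mu>) - A) y) \<partial>\<mu>)"
      unfolding sec_def by (rule pair.emeasure_pair_measure_alt2[OF C])
    also have "\<dots> = (\<integral>\<^sup>+y. 0 \<partial>\<mu>)"
    proof (rule nn_integral_cong_AE)
      show "AE y in \<mu>. emeasure B (sec (space (B \<Otimes>\<^sub>M \<mu>) - A) y) = 0"
        using mu_AE AE_space
      proof eventually_elim
        case (elim y)
        have "sec (space (B \<Otimes>\<^sub>M \<mu>) - A) y = space B - sec A y"
          using elim(2) by (auto simp: sec_def space_pair_measure)
        then show ?case
          using B.prob_compl[OF sec_sets[OF A, of y]] elim(1) \<open>a = 1\<close>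
          by (simp add: B.emeasure_eq_measure r_def)
      qed
    qed
    finally show ?thesis by simp
  qed
qed

end

context trapped_density begin

section \<open>The density is not in \<open>L^q\<close>\<close>

text \<open>The mean value theorem is applied only between \<open>y\<close> and the midpoint
  \<open>z\<close> of \<open>y\<close> and \<open>c\<close>, where the distance to \<open>c\<close>
  is at least \<open>|y - c| / 2\<close>. As \<open>T j z\<close> is closer to \<open>c\<close> than
  \<open>T j y\<close>, the increment bounds \<open>|T j y - c|\<close> from below.\<close>

lemma bad_inverse_estimate:
  assumes j: "j \<in> {1..N}" "j \<notin> good" and y: "y \<in> side b"
    and K: "0 < \<kappa>" "0 \<le> s" "\<And>z. z \<in> X \<Longrightarrow> \<kappa> * \<bar>z - c\<bar> powr s \<le> \<bar>deriv (T j) z\<bar>"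
  shows "\<kappa> * (\<bar>y - c\<bar> / 2) powr (s + 1) \<le> \<bar>T j y - c\<bar>"
proof -
  define z where "z = (y + c) / 2"
  have z: "z \<in> side b" "\<bar>z - c\<bar> = \<bar>y - c\<bar> / 2" "y \<noteq> z"
    using y by (cases b; auto simp: z_def lo_def hi_def)+
  have yc: "0 < \<bar>y - c\<bar>" using y by (cases b) (auto simp: lo_def hi_def)
  obtain i where i: "rlo j b = lo i" "rhi j b = hi i" using branch_range[OF j(1), of b] j(2) by auto
  have Ti: "T j u \<in> side i" if "u \<in> side b" for u using psi_inverse(3)[OF j(1) that] i by simp
  have "\<bar>T j z - c\<bar> < \<bar>T j y - c\<bar>" 
  proof (rule bad_toward[OF j y z(1)])
    show "\<bar>z - c\<bar> < \<bar>y - c\<bar>" unfolding z(2) using yc by simp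
  qed
  then have "\<bar>T j y - T j z\<bar> \<le> \<bar>T j y - c\<bar>" using Ti[OF y] Ti[OF z(1)] by (cases i) (auto simp: lo_def hi_def)
  moreover have "\<kappa> * (\<bar>y - c\<bar> / 2) powr (s + 1) \<le> \<bar>T j y - T j z\<bar>"
  proof -
    have D: "(T j has_real_derivative deriv (T j) u) (at u)" if "u \<in> side b" for u
      using T_deriv(1)[OF j(1)] that side_bounds(4) by blast
    obtain u where u: "u \<in> side b" "\<bar>y - c\<bar> / 2 \<le> \<bar>u - c\<bar>" "\<bar>T j y - T j z\<bar> = \<bar>y - z\<bar> * \<bar>deriv (T j) u\<bar>"
    proof (cases "y < z")
      case True
      obtain u where "y < u" "u < z" "T j z - T j y = (z - y) * deriv (T j) u"
        using MVT2[OF True, of "T j" "deriv (T j)"] D y z(1) by force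
      note u = this
      show thesis
      proof (rule that[of u])
        show "u \<in> side b" using u y z(1) by auto
        show "\<bar>y - c\<bar> / 2 \<le> \<bar>u - c\<bar>" using u y by (cases b) (auto simp: lo_def hi_def z_def)
        show "\<bar>T j y - T j z\<bar> = \<bar>y - z\<bar> * \<bar>deriv (T j) u\<bar>"
          using u(3) by (metis abs_minus_commute abs_mult)
      qed
    next
      case False
      then have zy: "z < y" using z(3) by simp
      obtain u where "z < u" "u < y" "T j y - T j z = (y - z) * deriv (T j) u"
        using MVT2[OF zy, of "T j" "deriv (T j)"] D y z(1) by force
      note u = this
      show thesis
      proof (rule that[of u])
        show "u \<in> side b" using u y z(1) by auto
        show "\<bar>y - c\<bar> / 2 \<le> \<bar>u - c\<bar>" using u y by (cases b) (auto simp: lo_def hi_def z_def)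
        show "\<bar>T j y - T j z\<bar> = \<bar>y - z\<bar> * \<bar>deriv (T j) u\<bar>"
          using u(3) by (metis abs_minus_commute abs_mult)
      qed
    qed
    have "\<kappa> * (\<bar>y - c\<bar> / 2) powr (s + 1) = (\<bar>y - c\<bar> / 2) * (\<kappa> * (\<bar>y - c\<bar> / 2) powr s)"
      using yc by (simp add: powr_add)
    also have "\<dots> \<le> (\<bar>y - c\<bar> / 2) * \<bar>deriv (T j) u\<bar>"
    proof (rule mult_left_mono)
      have "\<kappa> * (\<bar>y - c\<bar> / 2) powr s \<le> \<kappa> * \<bar>u - c\<bar> powr s"
        using u(2) K yc by (intro mult_left_mono powr_mono2) auto
      also have "\<dots> \<le> \<bar>deriv (T j) u\<bar>" using K(3) u(1) side_bounds(4) by blast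
      finally show "\<kappa> * (\<bar>y - c\<bar> / 2) powr s \<le> \<bar>deriv (T j) u\<bar>" .
    qed simp
    finally have le: "\<kappa> * (\<bar>y - c\<bar> / 2) powr (s + 1) \<le> \<bar>y - c\<bar> / 2 * \<bar>deriv (T j) u\<bar>" .
    have yz: "\<bar>y - z\<bar> = \<bar>y - c\<bar> / 2" by (simp add: z_def field_simps)
    show ?thesis unfolding u(3) yz by (rule le)
  qed
  ultimately show ?thesis by linarith
qed

lemma bad_map_exponents:
  assumes "T j \<in> bad_maps c"
  obtains l \<kappa> M where "1 < l" "0 < \<kappa>" "0 < M"
    "\<And>z. z \<in> X \<Longrightarrow> \<kappa> * \<bar>z - c\<bar> powr (l - 1) \<le> \<bar>deriv (T j) z\<bar> \<and> \<bar>deriv (T j) z\<bar> \<le> M * \<bar>z - c\<bar> powr (l - 1)"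
proof -
  obtain l \<kappa> M where l: "1 < l" "0 < \<kappa>" "l < M" and bd: "\<And>z. z \<in> {0..1} - {c} \<Longrightarrow>
      \<kappa> * \<bar>z - c\<bar> powr (l - 1) \<le> \<bar>deriv_within {0..1} (T j) z\<bar> \<and> \<bar>deriv_within {0..1} (T j) z\<bar> \<le> M * \<bar>z - c\<bar> powr (l - 1)"
    using assms unfolding bad_maps_def by blast
  have "deriv_within {0..1} (T j) z = deriv (T j) z" if z: "z \<in> X" for z
  proof -
    have "at z within {0..1} = at z" by (rule at_within_interior) (use z in \<open>auto simp: X_def\<close>)
    then show ?thesis by (simp add: deriv_within_def field_derivative_eq_vector_derivative)
  qed
  note eq = this
  show thesis
  proof (rule that[of l \<kappa> M])
    fix z assume z: "z \<in> X"
    then have "z \<in> {0..1} - {c}" by (auto simp: X_def)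
    from bd[OF this] show "\<kappa> * \<bar>z - c\<bar> powr (l - 1) \<le> \<bar>deriv (T j) z\<bar> \<and> \<bar>deriv (T j) z\<bar> \<le> M * \<bar>z - c\<bar> powr (l - 1)"
      unfolding eq[OF z] .
  qed (use l in auto)
qed

text \<open>One application of a bad map with critical order \<open>l\<close> turns the exponent \<open>\<alpha>\<close> into \<open>(l - 1 + \<alpha>) / l\<close>.
  The sides \<open>Z\<close> are those on which the bad map acts surjectively, so that the step can be iterated.\<close>

lemma h_blow_up:
  "\<exists>i l. 1 < l \<and> (\<forall>n::nat. \<exists>C>0. \<forall>x\<in>side i. C * \<bar>x - c\<bar> powr (- (1 - 1 / l ^ n)) \<le> h x)"
proof -
  obtain j where j: "j \<in> {1..N}" "T j \<in> bad_maps c" using bad_ne by blast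
  have ng: "j \<notin> good"
  proof
    assume "j \<in> good"
    then have "T j ` {0, c, 1} \<subseteq> {0, 1}" unfolding good_def good_maps_def by blast
    moreover have "T j c = c" using j(2) unfolding bad_maps_def by blast
    ultimately show False using c0 c1 by auto
  qed
  obtain l \<kappa> M where l: "1 < l" "0 < \<kappa>" "0 < M"
    and bd: "\<And>z. z \<in> X \<Longrightarrow> \<kappa> * \<bar>z - c\<bar> powr (l - 1) \<le> \<bar>deriv (T j) z\<bar> \<and> \<bar>deriv (T j) z\<bar> \<le> M * \<bar>z - c\<bar> powr (l - 1)"
    using bad_map_exponents[OF j(2)] by blast
  have "\<exists>i. rlo j b = lo i \<and> rhi j b = hi i" for b using branch_range[OF j(1), of b] ng by auto
  then obtain s where s: "\<And>b. rlo j b = lo (s b)" "\<And>b. rhi j b = hi (s b)" by metis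
  \<comment> \<open>As a self-map of the two sides, \<open>s\<close> may be constant; its eventual
    image is nonempty and mapped onto itself.\<close>
  have "\<exists>Z. Z \<noteq> {} \<and> (\<forall>i\<in>Z. \<exists>b\<in>Z. s b = i)"
  proof (cases "s False"; cases "s True")
    assume "s False" "s True" then show ?thesis by (intro exI[of _ "{True}"]) auto
  next
    assume "s False" "\<not> s True" then show ?thesis by (intro exI[of _ "{True, False}"]) auto
  next
    assume "\<not> s False" "s True" then show ?thesis by (intro exI[of _ "{True, False}"]) auto
  next
    assume "\<not> s False" "\<not> s True" then show ?thesis by (intro exI[of _ "{False}"]) auto
  qed
  then obtain Z where Z: "Z \<noteq> {}" "\<forall>i\<in>Z. \<exists>b\<in>Z. s b = i" by (elim exE conjE)
  have claim: "\<exists>C>0. \<forall>i\<in>Z. \<forall>x\<in>side i. C * \<bar>x - c\<bar> powr (- (1 - 1 / l ^ n)) \<le> h x" for n :: nat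
  proof (induction n)
    case 0
    obtain \<epsilon> where \<epsilon>: "0 < \<epsilon>" "\<And>x. x \<in> {0..1} \<Longrightarrow> \<epsilon> \<le> h x" using h_lower by blast
    have "\<epsilon> * \<bar>x - c\<bar> powr (- (1 - 1 / l ^ 0)) \<le> h x" if "x \<in> side i" for x i
      using \<epsilon>(2)[of x] that side_bounds(2,3)[of i] \<epsilon>(1) by (cases "x = c") auto
    with \<epsilon>(1) show ?case by blast
  next
    case (Suc n)
    then obtain C where C: "0 < C" "\<And>i x. i \<in> Z \<Longrightarrow> x \<in> side i \<Longrightarrow> C * \<bar>x - c\<bar> powr (- (1 - 1 / l ^ n)) \<le> h x" by blast
    define \<alpha> where "\<alpha> = 1 - 1 / l ^ n"
    have \<alpha>: "0 \<le> \<alpha>" using l(1) by (simp add: \<alpha>_def)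
    \<comment> \<open>The weight contributes the exponent \<open>l - 1\<close> and the bound on
      \<open>h\<close> at the preimage contributes \<alpha>, both in terms of
      \<open>|y - c|\<close>. Since \<open>|y - c|\<close> is at most a multiple of
      \<open>|x - c|\<close> to the power \<open>1 / l\<close>, the new exponent is
      \<open>\<beta> / l\<close>.\<close>
    define \<beta> where "\<beta> = l - 1 + \<alpha>"
    have \<beta>: "0 < \<beta>" using l(1) \<alpha> by (simp add: \<beta>_def)
    have e: "\<beta> / l = 1 - 1 / l ^ Suc n" using l(1) by (simp add: \<beta>_def \<alpha>_def field_simps)
    define D where "D = p j * C / M * (2 powr (- \<beta>) * (1 / \<kappa>) powr (- (\<beta> / l)))"
    have D: "0 < D" using p_pos[OF j(1)] C l by (simp add: D_def)
    have "D * \<bar>x - c\<bar> powr (- (1 - 1 / l ^ Suc n)) \<le> h x" if i: "i \<in> Z" and x: "x \<in> side i" for i x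
    proof -
      obtain b where b: "b \<in> Z" "s b = i" using bspec[OF Z(2) i] by blast
      have r: "x \<in> rng j b" using x s b by simp
      define y where "y = \<psi> j b x"
      have y: "y \<in> side b" "T j y = x" using psi_inverse(1,2)[OF j(1) r] by (auto simp: y_def)
      then have yX: "y \<in> X" using side_bounds(4) by blast
      have yc: "0 < \<bar>y - c\<bar>" using yX by (simp add: X_def)
      have xX: "x \<in> X" using x side_bounds(4) by blast
      then have xc: "0 < \<bar>x - c\<bar>" by (simp add: X_def)
      have "\<kappa> * (\<bar>y - c\<bar> / 2) powr (l - 1 + 1) \<le> \<bar>T j y - c\<bar>"
        by (rule bad_inverse_estimate[OF j(1) ng y(1) l(2)]) (use l bd in auto)
      then have "(\<bar>y - c\<bar> / 2) powr l \<le> \<bar>x - c\<bar> / \<kappa>" using l(2) y(2) by (simp add: field_simps)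
      then have "((\<bar>y - c\<bar> / 2) powr l) powr (1 / l) \<le> (\<bar>x - c\<bar> / \<kappa>) powr (1 / l)"
        using l(1) by (intro powr_mono2) auto
      then have "\<bar>y - c\<bar> \<le> 2 * (\<bar>x - c\<bar> / \<kappa>) powr (1 / l)" using l(1) yc by (simp add: powr_powr)
      then have "(2 * (\<bar>x - c\<bar> / \<kappa>) powr (1 / l)) powr (- \<beta>) \<le> \<bar>y - c\<bar> powr (- \<beta>)"
        using yc \<beta> by (intro powr_mono2') auto
      also have "(2 * (\<bar>x - c\<bar> / \<kappa>) powr (1 / l)) powr (- \<beta>) = 2 powr (- \<beta>) * (1 / \<kappa>) powr (- (\<beta> / l)) * \<bar>x - c\<bar> powr (- (\<beta> / l))"
      proof -
        define v where "v = 1 / \<kappa>"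
        have v: "0 < v" "\<bar>x - c\<bar> / \<kappa> = v * \<bar>x - c\<bar>" using l(2) by (auto simp: v_def)
        show ?thesis unfolding v(2) v_def[symmetric] using v(1) xc by (simp add: powr_mult powr_powr)
      qed
      finally have key: "2 powr (- \<beta>) * (1 / \<kappa>) powr (- (\<beta> / l)) * \<bar>x - c\<bar> powr (- (\<beta> / l)) \<le> \<bar>y - c\<bar> powr (- \<beta>)" .
      have dpos: "0 < \<bar>deriv (T j) y\<bar>" using T_deriv(2)[OF j(1) yX] by simp
      have split: "\<bar>y - c\<bar> powr (- \<beta>) = \<bar>y - c\<bar> powr (- \<alpha>) / \<bar>y - c\<bar> powr (l - 1)"
      proof -
        have "- \<beta> = - \<alpha> - (l - 1)" by (simp add: \<beta>_def)
        then show ?thesis by (simp only: powr_diff)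
      qed
      have "D * \<bar>x - c\<bar> powr (- (\<beta> / l)) \<le> p j * C / M * \<bar>y - c\<bar> powr (- \<beta>)"
        using mult_left_mono[OF key, of "p j * C / M"] p_pos[OF j(1)] C l by (simp add: D_def mult_ac)
      also have "\<dots> = p j * (C * \<bar>y - c\<bar> powr (- \<alpha>)) / (M * \<bar>y - c\<bar> powr (l - 1))"
        unfolding split by simp
      also have "\<dots> \<le> p j * h y / \<bar>deriv (T j) y\<bar>"
        using C(2)[OF b(1) y(1)] bd[OF yX] dpos p_pos[OF j(1)] C(1)
        by (intro frac_le mult_left_mono) (auto simp: \<alpha>_def h_pos less_imp_le)
      also have "\<dots> = p j * wt j b x * h (\<psi>0 j b x)" using r by (simp add: wt_def y_def psi0_eq)
      also have "\<dots> \<le> Pr h x" by (rule Pr_ge[OF j(1)]) (use h_pos in \<open>auto intro: less_imp_le\<close>)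
      finally show ?thesis using h_inv[OF xX] e by simp
    qed
    with D show ?case by blast
  qed
  obtain i where i: "i \<in> Z" using Z(1) by blast
  have "\<exists>C>0. \<forall>x\<in>side i. C * \<bar>x - c\<bar> powr (- (1 - 1 / l ^ n)) \<le> h x" for n :: nat
    using claim[of n] i by blast
  then show ?thesis using l(1) by blast
qed

lemma inverse_distance_integral: "(\<integral>\<^sup>+x. ennreal (1 / \<bar>x - c\<bar>) * indicator (side i) x \<partial>lborel) = \<infinity>"
proof -
  define R where "R = (hi i - lo i) / 2"
  have R: "0 < R" using side_bounds(1)[of i] by (simp add: R_def)
  have bound: "ennreal (ln R - ln t) \<le> (\<integral>\<^sup>+x. ennreal (1 / \<bar>x - c\<bar>) * indicator (side i) x \<partial>lborel)" if t: "0 < t" "t \<le> R" for t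
  proof (cases i)
    case True
    then have R1: "c + R < 1" using c1 by (simp add: R_def lo_def hi_def field_simps)
    have "(\<integral>\<^sup>+x. ennreal (1 / \<bar>x - c\<bar>) * indicator {c + t..c + R} x \<partial>lborel) = ennreal (ln (c + R - c) - ln (c + t - c))"
      by (rule nn_integral_FTC_Icc) (use t in \<open>auto intro!: derivative_eq_intros\<close>)
    moreover have "(\<integral>\<^sup>+x. ennreal (1 / \<bar>x - c\<bar>) * indicator {c + t..c + R} x \<partial>lborel) \<le> (\<integral>\<^sup>+x. ennreal (1 / \<bar>x - c\<bar>) * indicator (side i) x \<partial>lborel)"
      using t R1 True by (intro nn_integral_mono mult_left_mono) (auto simp: lo_def hi_def split: split_indicator)
    ultimately show ?thesis by simp
  next
    case False
    then have R1: "0 < c - R" using c0 by (simp add: R_def lo_def hi_def field_simps)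
    have "(\<integral>\<^sup>+x. ennreal (1 / \<bar>x - c\<bar>) * indicator {c - R..c - t} x \<partial>lborel) = ennreal (- ln (c - (c - t)) - - ln (c - (c - R)))"
      by (rule nn_integral_FTC_Icc) (use t in \<open>auto intro!: derivative_eq_intros\<close>)
    moreover have "(\<integral>\<^sup>+x. ennreal (1 / \<bar>x - c\<bar>) * indicator {c - R..c - t} x \<partial>lborel) \<le> (\<integral>\<^sup>+x. ennreal (1 / \<bar>x - c\<bar>) * indicator (side i) x \<partial>lborel)"
      using t R1 False by (intro nn_integral_mono mult_left_mono) (auto simp: lo_def hi_def split: split_indicator)
    ultimately show ?thesis by simp
  qed
  show ?thesis
  proof (rule ccontr)
    assume "\<not> ?thesis"
    then obtain k where k: "0 \<le> k" "(\<integral>\<^sup>+x. ennreal (1 / \<bar>x - c\<bar>) * indicator (side i) x \<partial>lborel) = ennreal k"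
      by (cases "\<integral>\<^sup>+x. ennreal (1 / \<bar>x - c\<bar>) * indicator (side i) x \<partial>lborel") auto
    \<comment> \<open>Makes \<open>ln R - ln t\<close> equal to \<open>k + 1\<close>, beyond the
      supposed value \<open>k\<close> of the integral.\<close>
    define t where "t = R * exp (- (k + 1))"
    have t: "0 < t" "t \<le> R" using R k(1) by (auto simp: t_def mult_le_cancel_left1)
    have "ln R - ln t = k + 1" using R by (simp add: t_def ln_mult)
    then have "ennreal (k + 1) \<le> ennreal k" using bound[OF t] k(2) by simp
    then show False using k(1) by simp
  qed
qed

text \<open>The exponents \<open>1 - 1 / l ^ n\<close> tend to 1, so for some \<open>n\<close> the
  product with \<open>q > 1\<close> is at least 1; then \<open>h\<close> to the power
  \<open>q\<close> dominates a multiple of \<open>1 / |x - c|\<close> on a whole side.\<close>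

lemma h_not_Lq:
  assumes q: "1 < q"
  shows "\<not> integrable L (\<lambda>x. \<bar>h x\<bar> powr q)"
proof
  assume int: "integrable L (\<lambda>x. \<bar>h x\<bar> powr q)"
  obtain l i where l: "1 < l" and blow: "\<forall>n::nat. \<exists>C>0. \<forall>x\<in>side i. C * \<bar>x - c\<bar> powr (- (1 - 1 / l ^ n)) \<le> h x"
    using h_blow_up by (elim exE conjE)
  obtain n where n: "1 / (1 - 1 / q) < l ^ n" using real_arch_pow[OF l] by blast
  have q1: "0 < 1 - 1 / q" using q by simp
  have "1 < l ^ n * (1 - 1 / q)" using n q1 by (simp only: pos_divide_less_eq)
  then have "1 / l ^ n < 1 - 1 / q" using l by (simp add: pos_divide_less_eq mult.commute)
  then have "1 / q \<le> 1 - 1 / l ^ n" by simp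
  then have e: "1 \<le> (1 - 1 / l ^ n) * q" using q by (simp add: pos_divide_le_eq)
  obtain C where C: "0 < C" "\<And>x. x \<in> side i \<Longrightarrow> C * \<bar>x - c\<bar> powr (- (1 - 1 / l ^ n)) \<le> h x" using blow by blast
  have ge: "C powr q * (1 / \<bar>x - c\<bar>) \<le> \<bar>h x\<bar> powr q" if x: "x \<in> side i" for x
  proof -
    have "x \<in> X" using x side_bounds(4) by blast
    then have xc: "0 < \<bar>x - c\<bar>" "\<bar>x - c\<bar> < 1" using c0 c1 by (auto simp: X_def)
    have "1 / \<bar>x - c\<bar> = \<bar>x - c\<bar> powr (- 1)" using xc by (simp add: powr_minus_divide)
    also have "\<dots> \<le> \<bar>x - c\<bar> powr (- ((1 - 1 / l ^ n) * q))" using xc e by (intro powr_mono') auto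
    finally have "C powr q * (1 / \<bar>x - c\<bar>) \<le> C powr q * \<bar>x - c\<bar> powr (- ((1 - 1 / l ^ n) * q))"
      by (rule mult_left_mono) simp
    also have "\<dots> = (C * \<bar>x - c\<bar> powr (- (1 - 1 / l ^ n))) powr q"
      using C(1) by (simp only: powr_mult powr_powr mult_minus_left)
    also have "\<dots> \<le> \<bar>h x\<bar> powr q" using C(1) C(2)[OF x] h_pos[of x] q by (intro powr_mono2) auto
    finally show ?thesis .
  qed
  have "ennreal (C powr q) * (\<integral>\<^sup>+x. ennreal (1 / \<bar>x - c\<bar>) * indicator (side i) x \<partial>lborel)
      = (\<integral>\<^sup>+x. ennreal (C powr q) * (ennreal (1 / \<bar>x - c\<bar>) * indicator (side i) x) \<partial>lborel)"
    by (rule nn_integral_cmult[symmetric]) measurable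
  also have "\<dots> \<le> (\<integral>\<^sup>+x. ennreal (\<bar>h x\<bar> powr q) * indicator {0..1} x \<partial>lborel)"
  proof (rule nn_integral_mono)
    fix x
    show "ennreal (C powr q) * (ennreal (1 / \<bar>x - c\<bar>) * indicator (side i) x) \<le> ennreal (\<bar>h x\<bar> powr q) * indicator {0..1} x"
      using ge[of x] side_bounds(2,3)[of i]
      by (cases "x \<in> side i") (auto simp: ennreal_mult[symmetric] intro!: ennreal_leI)
  qed
  also have "\<dots> = (\<integral>\<^sup>+x. ennreal (\<bar>h x\<bar> powr q) \<partial>L)" by (simp only: nn_integral_L)
  also have "\<dots> < \<infinity>" using int by (simp add: integrable_iff_bounded)
  finally show False using C(1) by (simp add: inverse_distance_integral ennreal_mult_top)
qed

end

context trapped_system begin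

lemma trapped_density_exists: "\<exists>h. trapped_density c N p T \<delta> \<delta>' \<Lambda> h"
proof -
  obtain l where l: "\<And>i. koebe_cone (lo i) (hi i) l" "\<And>x. x \<in> X \<Longrightarrow> Pr l x = l x" "\<And>x. x \<in> X \<Longrightarrow> 0 < l x"
    using invariant_density by blast
  \<comment> \<open>Preimages of points under the branches lie in \<open>X\<close>, so this change
    leaves \<open>Pr\<close> as it was; it makes the density positive at 0, \<open>c\<close> and 1
    too.\<close>
  define h where "h x = (if x \<in> X then l x else 1)" for x
  have Pr_eq: "Pr h x = Pr l x" for x
  proof -
    have "p j * wt j b x * h (\<psi>0 j b x) = p j * wt j b x * l (\<psi>0 j b x)" if j: "j \<in> {1..N}" for j b
    proof (cases "x \<in> rng j b")
      case True
      then show ?thesis using psi0_X[OF j True] by (simp add: h_def)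
    next
      case False
      from wt_zero[OF this] show ?thesis by simp
    qed
    then show ?thesis unfolding Pr_def by (intro sum.cong refl)
  qed
  have "trapped_density c N p T \<delta> \<delta>' \<Lambda> h"
  proof
    show "koebe_cone (lo i) (hi i) h" for i
      by (rule koebe_cone_cong[OF l(1)]) (use side_bounds(4)[of i] in \<open>auto simp: h_def\<close>)
    show "Pr h x = h x" if "x \<in> X" for x using Pr_eq l(2)[OF that] that by (simp add: h_def)
    show "0 < h x" for x using l(3)[of x] by (simp add: h_def)
  qed
  then show ?thesis by blast
qed

end

section \<open>Existence, uniqueness, ergodicity and the properties of the density combined\<close>

theorem theorem1p2:
  fixes c :: real and N :: nat and p :: "nat \<Rightarrow> real" and T :: "nat \<Rightarrow> real \<Rightarrow> real"
  assumes "0 < c" and "c < 1"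
    and "\<And>j. j \<in> {1..N} \<Longrightarrow> T j \<in> good_maps c \<union> bad_maps c"
    and "{j \<in> {1..N}. T j \<in> good_maps c} \<noteq> {}"
    and "{j \<in> {1..N}. T j \<in> bad_maps c} \<noteq> {}"
    and "\<And>j. j \<in> {1..N} \<Longrightarrow> p j > 0"
    and "(\<Sum>j\<in>{1..N}. p j) = 1"
  shows "\<exists>\<mu>. sigma_finite_acsm N p T \<mu>
    \<and> (\<forall>\<nu>. sigma_finite_acsm N p T \<nu> \<longrightarrow> (\<exists>a::real. a > 0 \<and> \<nu> = scale_measure (ennreal a) \<mu>))
    \<and> ergodic_for N p T \<mu>
    \<and> (\<exists>h::real \<Rightarrow> real. h \<in> borel_measurable lebesgue01
        \<and> (AE x in lebesgue01. RN_deriv lebesgue01 \<mu> x = ennreal (h x))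
        \<and> (\<exists>\<epsilon>>0. \<forall>x\<in>{0..1}. \<epsilon> \<le> h x)
        \<and> locally_lipschitz_on h {0<..<c}
        \<and> locally_lipschitz_on h {c<..<1}
        \<and> (\<forall>q::real. q > 1 \<longrightarrow> \<not> integrable lebesgue01 (\<lambda>x. \<bar>h x\<bar> powr q)))"
proof -
  interpret good_bad_system c N p T by unfold_locales (fact assms)+
  obtain \<delta> \<delta>' \<Lambda> where tr: "0 < \<delta>" "0 < \<delta>'" "1 < \<Lambda>" "\<delta> \<le> min c (1 - c) / 4" "\<delta>' \<le> min c (1 - c) / 4"
    "\<And>j x. j \<in> {1..N} \<Longrightarrow> 0 < end_dist x \<Longrightarrow> end_dist x < \<delta> \<Longrightarrow>
       T j x \<in> X \<and> \<delta>' \<le> \<bar>T j x - c\<bar> \<and> \<Lambda> * end_dist x \<le> end_dist (T j x)"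
    "\<And>j x. j \<in> good \<Longrightarrow> x \<in> X \<Longrightarrow> \<bar>x - c\<bar> < \<delta>' \<Longrightarrow> T j x \<in> X \<and> \<delta>' \<le> \<bar>T j x - c\<bar>"
    using trapping_constants_exist by blast
  interpret trapped_system c N p T \<delta> \<delta>' \<Lambda> by unfold_locales (fact tr)+
  obtain h where "trapped_density c N p T \<delta> \<delta>' \<Lambda> h" using trapped_density_exists by blast
  then interpret trapped_density c N p T \<delta> \<delta>' \<Lambda> h .
  have sides: "side False = {0<..<c}" "side True = {c<..<1}" by (simp_all add: lo_def hi_def)
  show ?thesis
  proof (intro exI[of _ \<mu>] exI[of _ h] conjI allI impI)
    show "h \<in> borel_measurable lebesgue01" using h_measurable_borel by (simp add: L_def)
    show "AE x in lebesgue01. RN_deriv lebesgue01 \<mu> x = ennreal (h x)" using RN_deriv_mu unfolding L_def .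
    show "locally_lipschitz_on h {0<..<c}" "locally_lipschitz_on h {c<..<1}"
      using h_locally_lipschitz[of False] h_locally_lipschitz[of True] by (simp_all only: sides)
    show "\<not> integrable lebesgue01 (\<lambda>x. \<bar>h x\<bar> powr q)" if "1 < q" for q :: real
      using h_not_Lq[OF that] by (simp add: L_def)
  qed (use sigma_finite_acsm_mu unique_acsm ergodic_mu h_lower in blast)+
qed

end
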